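(* The following decision problem is decidable and NP-hard: given a finite set $G$ of matrices in $\mathrm{SL}(2,\mathbb{Z})$, generating the multiplicative semigroup $S$, decide whether $S$ contains a matrix that has infinitely many different factorizations over $G$.
   Context: $\mathrm{SL}(2,\mathbb{Z})$ is the group of $2\times2$ integer matrices with determinant $1$. For a finite set $G$ of matrices, $S=\langle G\rangle$ denotes the semigroup of all finite nonempty products of elements of $G$. A factorization of $M\in S$ over $G$ is a finite nonempty sequence $(A_1,\dots,A_t)$ of elements of $G$ with $A_1A_2\cdots A_t=M$; two factorizations are different if they are different sequences. *)

theory Defs
  imports "HOL-Analysis.Determinants" "HOL-Computational_Algebra.Polynomial"
begin

text \<open>
  Deterministic multi-tape Turing machines. States and tape symbols are initial segments of the
  natural numbers; the transition function only matters on this finite domain. Symbol 0 is the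
  blank, 1 and 2 are the bits 0 and 1. Tapes are infinite in both directions; a tape is its
  contents together with the head position.
\<close>

datatype move = Left | Stay | Right

type_synonym tape = "(int \<Rightarrow> nat) \<times> int"
type_synonym config = "nat \<times> tape list"

record tm =
  num_tapes :: nat
  num_states :: nat
  num_symbols :: nat
  start_state :: nat
  accept_state :: nat
  reject_state :: nat
  delta :: "nat \<Rightarrow> nat list \<Rightarrow> nat \<times> (nat \<times> move) list"

definition turing_machine :: "tm \<Rightarrow> bool" where
  "turing_machine M \<longleftrightarrow>
     num_tapes M \<ge> 1 \<and> num_symbols M \<ge> 3 \<and>
     start_state M < num_states M \<and> accept_state M < num_states M \<and>
     reject_state M < num_states M \<and> accept_state M \<noteq> reject_state M \<and>
     (\<forall>q ss. q < num_states M \<and> length ss = num_tapes M \<and> (\<forall>s\<in>set ss. s < num_symbols M) \<longrightarrow>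
        fst (delta M q ss) < num_states M \<and>
        length (snd (delta M q ss)) = num_tapes M \<and>
        (\<forall>(s, m)\<in>set (snd (delta M q ss)). s < num_symbols M))"

fun move_head :: "move \<Rightarrow> int \<Rightarrow> int" where
  "move_head Left h = h - 1"
| "move_head Stay h = h"
| "move_head Right h = h + 1"

fun read_tape :: "tape \<Rightarrow> nat" where
  "read_tape (f, h) = f h"

fun act_tape :: "tape \<Rightarrow> nat \<times> move \<Rightarrow> tape" where
  "act_tape (f, h) (s, m) = (f(h := s), move_head m h)"

fun step :: "tm \<Rightarrow> config \<Rightarrow> config" where
  "step M (q, ts) =
     (if q = accept_state M \<or> q = reject_state M then (q, ts)
      else let (q', as) = delta M q (map read_tape ts) in (q', map2 act_tape ts as))"

definition bit_symbol :: "bool \<Rightarrow> nat" where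
  "bit_symbol b = (if b then 2 else 1)"

definition blank_tape :: tape where
  "blank_tape = (\<lambda>_. 0, 0)"

definition input_tape :: "bool list \<Rightarrow> tape" where
  "input_tape w =
     (\<lambda>i. if 0 \<le> i \<and> i < int (length w) then bit_symbol (w ! nat i) else 0, 0)"

definition initial_config :: "tm \<Rightarrow> bool list \<Rightarrow> config" where
  "initial_config M w = (start_state M, input_tape w # replicate (num_tapes M - 1) blank_tape)"

definition run :: "tm \<Rightarrow> bool list \<Rightarrow> nat \<Rightarrow> config" where
  "run M w t = (step M ^^ t) (initial_config M w)"

text \<open>The output is read on the first tape, from the head rightwards up to the first blank.\<close>

fun tape_holds :: "tape \<Rightarrow> bool list \<Rightarrow> bool" where
  "tape_holds (f, h) w \<longleftrightarrow>
     (\<forall>i<length w. f (h + int i) = bit_symbol (w ! i)) \<and> f (h + int (length w)) = 0"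

type_synonym language = "bool list set"

definition decided_at :: "tm \<Rightarrow> language \<Rightarrow> bool list \<Rightarrow> nat \<Rightarrow> bool" where
  "decided_at M L w t \<longleftrightarrow>
     fst (run M w t) = (if w \<in> L then accept_state M else reject_state M)"

definition decidable :: "language \<Rightarrow> bool" where
  "decidable L \<longleftrightarrow> (\<exists>M. turing_machine M \<and> (\<forall>w. \<exists>t. decided_at M L w t))"

definition polytime_decidable :: "language \<Rightarrow> bool" where
  "polytime_decidable L \<longleftrightarrow>
     (\<exists>M (p :: nat poly). turing_machine M \<and>
        (\<forall>w. \<exists>t \<le> poly p (length w). decided_at M L w t))"

definition polytime_computable :: "(bool list \<Rightarrow> bool list) \<Rightarrow> bool" where
  "polytime_computable f \<longleftrightarrow>
     (\<exists>M (p :: nat poly). turing_machine M \<and>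
        (\<forall>w. \<exists>t \<le> poly p (length w).
           fst (run M w t) = accept_state M \<and> tape_holds (hd (snd (run M w t))) (f w)))"

definition polytime_reducible :: "language \<Rightarrow> language \<Rightarrow> bool" where
  "polytime_reducible L L' \<longleftrightarrow>
     (\<exists>f. polytime_computable f \<and> (\<forall>w. w \<in> L \<longleftrightarrow> f w \<in> L'))"

text \<open>Self-delimiting code of a word: every bit is preceded by \<open>True\<close>, and \<open>False\<close> marks the end.\<close>

definition delimit :: "bool list \<Rightarrow> bool list" where
  "delimit w = concat (map (\<lambda>b. [True, b]) w) @ [False]"

definition pair_code :: "bool list \<Rightarrow> bool list \<Rightarrow> bool list" where
  "pair_code x y = delimit x @ y"

definition in_NP :: "language \<Rightarrow> bool" where
  "in_NP L \<longleftrightarrow>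
     (\<exists>V (p :: nat poly). polytime_decidable V \<and>
        L = {x. \<exists>y. length y \<le> poly p (length x) \<and> pair_code x y \<in> V})"

definition NP_hard :: "language \<Rightarrow> bool" where
  "NP_hard L \<longleftrightarrow> (\<forall>L'. in_NP L' \<longrightarrow> polytime_reducible L' L)"

definition SL2Z :: "(int^2^2) set" where
  "SL2Z = {A. det A = 1}"

definition mat_prod :: "(int^2^2) list \<Rightarrow> int^2^2" where
  "mat_prod As = foldr (**) As (mat 1)"

definition factorizations :: "(int^2^2) set \<Rightarrow> int^2^2 \<Rightarrow> (int^2^2) list set" where
  "factorizations G M = {As. As \<noteq> [] \<and> set As \<subseteq> G \<and> mat_prod As = M}"

definition generated_semigroup :: "(int^2^2) set \<Rightarrow> (int^2^2) set" where
  "generated_semigroup G = {mat_prod As | As. As \<noteq> [] \<and> set As \<subseteq> G}"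

definition has_infinitely_factorizable :: "(int^2^2) set \<Rightarrow> bool" where
  "has_infinitely_factorizable G \<longleftrightarrow>
     (\<exists>M \<in> generated_semigroup G. infinite (factorizations G M))"

text \<open>Binary expansion, least significant bit first. It has to be binary rather than unary:
  the complexity of the problem is measured in the bit length of the matrix entries.\<close>

fun nat_bits :: "nat \<Rightarrow> bool list" where
  "nat_bits n = (if n = 0 then [] else odd n # nat_bits (n div 2))"

declare nat_bits.simps [simp del]

definition int_code :: "int \<Rightarrow> bool list" where
  "int_code i = (i < 0) # delimit (nat_bits (nat \<bar>i\<bar>))"

definition matrix_code :: "int^2^2 \<Rightarrow> bool list" where
  "matrix_code A =
     int_code (A $ 1 $ 1) @ int_code (A $ 1 $ 2) @ int_code (A $ 2 $ 1) @ int_code (A $ 2 $ 2)"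

definition instance_code :: "(int^2^2) list \<Rightarrow> bool list" where
  "instance_code As = concat (map (\<lambda>A. True # matrix_code A) As) @ [False]"

text \<open>An instance is a finite set of matrices, presented by any list enumerating it, possibly with
  repetitions. Words that are not codes of lists of matrices in SL(2,Z) are not in the language.\<close>

definition infinite_factorization_problem :: language where
  "infinite_factorization_problem =
     {instance_code As | As. set As \<subseteq> SL2Z \<and> has_infinitely_factorizable (set As)}"

lemma delimit_append_eq: "delimit v @ r = delimit w @ s \<longleftrightarrow> v = w \<and> r = s"
proof (induction v arbitrary: w)
  case Nil
  then show ?case by (cases w) (auto simp: delimit_def)
next
  case (Cons a v)
  then show ?case by (cases w) (auto simp: delimit_def)
qed

lemma nat_bits_inject: "nat_bits m = nat_bits n \<longleftrightarrow> m = n"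
proof (induction m arbitrary: n rule: less_induct)
  case (less m)
  show ?case
  proof (cases "m = 0 \<or> n = 0")
    case True
    then show ?thesis
      by (subst (1 2) nat_bits.simps) auto
  next
    case False
    then have "nat_bits m = nat_bits n \<longleftrightarrow> odd m = odd n \<and> m div 2 = n div 2"
      using less.IH[of "m div 2" "n div 2"] by (subst (1 2) nat_bits.simps) auto
    also have "\<dots> \<longleftrightarrow> m = n"
      by presburger
    finally show ?thesis .
  qed
qed

lemma int_code_append_eq: "int_code i @ r = int_code j @ s \<longleftrightarrow> i = j \<and> r = s"
  by (auto simp: int_code_def delimit_append_eq nat_bits_inject)

lemma matrix_code_append_eq: "matrix_code A @ r = matrix_code B @ s \<longleftrightarrow> A = B \<and> r = s"
  by (auto simp: matrix_code_def int_code_append_eq vec_eq_iff forall_2)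

lemma inj_instance_code: "inj instance_code"
proof (rule injI)
  fix As Bs :: "(int^2^2) list"
  assume "instance_code As = instance_code Bs"
  then show "As = Bs"
  proof (induction As arbitrary: Bs)
    case Nil
    then show ?case by (cases Bs) (auto simp: instance_code_def)
  next
    case (Cons A As)
    then show ?case by (cases Bs) (auto simp: instance_code_def matrix_code_append_eq)
  qed
qed

end

theory Submission imports Defs begin

text \<open>
  Modulo sign, the elements of SL(2,Z) are reduced words in a letter \<open>S\<close> of order 2 and letters \<open>U\<close>,
  \<open>V = U\<^sup>-\<^sup>1\<close> of order 3, and multiplication by a letter on the right only changes the end of a word.
  So a product of generators is a walk in a tree, and a long product that stays near its start must
  climb and return through the same positions. By pigeonhole, a matrix with infinitely many
  factorizations yields words \<open>v\<close>, \<open>w\<close>, \<open>x\<close> over the generators, of computably bounded length and with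
  \<open>v x\<close> nonempty, such that \<open>v w x = w\<close> as matrices; conversely such words give infinitely many
  factorizations \<open>v\<^sup>n w x\<^sup>n\<close> of \<open>w\<close>. A bounded search therefore decides the problem.

  For NP-hardness, let \<open>a = [[1,2],[0,1]]\<close> and \<open>b = [[1,0],[2,1]]\<close>, which generate a free group. Given a
  finite set \<open>X\<close> of positive integers and a target \<open>t\<close>, take the matrices \<open>a\<^sup>x\<close> for \<open>x\<close> in \<open>X\<close> together with
  \<open>b a\<^sup>-\<^sup>t\<close> and \<open>b\<^sup>-\<^sup>1 a\<^sup>t\<close>. If \<open>t\<close> is a sum of elements of \<open>X\<close>, then \<open>(b a\<^sup>-\<^sup>t) a\<^sup>t (b\<^sup>-\<^sup>1 a\<^sup>t) = a\<^sup>t\<close> can be pumped;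
  otherwise nothing ever cancels in a product. Deciding whether \<open>t\<close> is such a sum, repetitions allowed
  and numbers in binary, is NP-hard: the tableau of a verifier is a tiling problem with finitely many
  tiles, and a tiling is an exact cover of the cells and of the bits on their edges.

  Turing machines are programmed in a language of stack programs, one tape per stack, in which trees
  in prefix notation are duplicated, exchanged and dropped at the top of a stack.
\<close>

section \<open>A language of stack programs\<close>

text \<open>Pumping has to be two-sided because the walk lives in a tree: a long product that
  repeats no element goes up and comes back, so whatever is repeated on the way up must be matched
  on the way down. For hardness, sums with repetition are the natural source problem, since a
  generator may be used any number of times; the price is that arithmetic alone must forbid using a
  summand twice, which the weights in a leading digit achieve. The summands have exponential size
  but are handled only as lists of bits, with digits placed so that no arithmetic on binary numbers
  has to be programmed; every number that a program does compute with is unary. Tilings mediate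
  because a fixed machine has a fixed set of tiles: the number of colours is then a constant, and
  colours can be spelled out in unary on every edge and compared by covering bits. Decidability asks
  for no time bound and may search exhaustively, whereas the reduction must be polynomial; both are
  assembled from the same combinators.\<close>

datatype reg = R0 | R1 | R2 | R3

type_synonym store = "reg \<Rightarrow> bool list"

datatype com =
    Skip
  | Push reg bool
  | Pop reg
  | Seq com com (infixr ";;" 60)
  | Cond reg "bool option \<Rightarrow> bool" com com
  | While reg "bool option \<Rightarrow> bool" com

definition top_of :: "bool list \<Rightarrow> bool option" where
  "top_of w = (case w of [] \<Rightarrow> None | b # _ \<Rightarrow> Some b)"

lemma top_of_simps [simp]: "top_of [] = None" "top_of (b # w) = Some b"
  by (simp_all add: top_of_def)

datatype effect = Idle | PushE reg bool | PopE reg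

text \<open>A step is split into the successor command, which depends on the store only through the
  tops of the stacks, and an effect on at most one stack. This is what a machine with one tape per
  stack can see and do.\<close>

fun next_com :: "com \<Rightarrow> (reg \<Rightarrow> bool option) \<Rightarrow> com" where
  "next_com Skip \<tau> = Skip"
| "next_com (Push r b) \<tau> = Skip"
| "next_com (Pop r) \<tau> = Skip"
| "next_com (Seq c d) \<tau> = (if c = Skip then d else Seq (next_com c \<tau>) d)"
| "next_com (Cond r \<phi> c d) \<tau> = (if \<phi> (\<tau> r) then c else d)"
| "next_com (While r \<phi> c) \<tau> = (if \<phi> (\<tau> r) then Seq c (While r \<phi> c) else Skip)"

fun effect_of :: "com \<Rightarrow> effect" where
  "effect_of (Push r b) = PushE r b"
| "effect_of (Pop r) = PopE r"
| "effect_of (Seq c d) = effect_of c"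
| "effect_of _ = Idle"

fun apply_effect :: "effect \<Rightarrow> store \<Rightarrow> store" where
  "apply_effect Idle s = s"
| "apply_effect (PushE r b) s = s(r := b # s r)"
| "apply_effect (PopE r) s = s(r := tl (s r))"

definition small_step :: "com \<times> store \<Rightarrow> com \<times> store" where
  "small_step cs = (next_com (fst cs) (\<lambda>r. top_of (snd cs r)), apply_effect (effect_of (fst cs)) (snd cs))"

text \<open>As \<open>small_step\<close> fixes \<open>Skip\<close>, the number \<open>n\<close> is
  an upper bound on the running time rather than the exact number of steps, and time bounds may be
  enlarged freely.\<close>

definition runs :: "com \<Rightarrow> store \<Rightarrow> nat \<Rightarrow> store \<Rightarrow> bool" where
  "runs c s n s' \<longleftrightarrow> (small_step ^^ n) (c, s) = (Skip, s')"

lemma small_step_Skip [simp]: "small_step (Skip, s) = (Skip, s)"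
  by (simp add: small_step_def)

lemma small_steps_Skip [simp]: "(small_step ^^ n) (Skip, s) = (Skip, s)"
  by (induction n) auto

lemma runs_mono:
  assumes "runs c s n s'" "n \<le> m"
  shows "runs c s m s'"
proof -
  have "(small_step ^^ m) (c, s) = (small_step ^^ (m - n)) ((small_step ^^ n) (c, s))"
    using assms(2) by (metis add.commute comp_apply funpow_add le_add_diff_inverse)
  then show ?thesis
    using assms(1) by (simp add: runs_def)
qed

lemma runs_Suc: "runs c' s' n s'' \<Longrightarrow> small_step (c, s) = (c', s') \<Longrightarrow> runs c s (Suc n) s''"
  by (simp add: runs_def funpow_Suc_right del: funpow.simps)

lemma runs_Skip: "runs Skip s n s"
  by (simp add: runs_def)

lemma runs_Push: "runs (Push r b) s 1 (s(r := b # s r))"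
  by (simp add: runs_def small_step_def)

lemma runs_Pop: "runs (Pop r) s 1 (s(r := tl (s r)))"
  by (simp add: runs_def small_step_def)

text \<open>The extra 1 pays for the step from \<open>Skip ;; d\<close> to \<open>d\<close>. The
  induction peels off the first step of \<open>c\<close>; since \<open>n\<close> is only an upper
  bound, \<open>c\<close> may already be \<open>Skip\<close> with steps left over.\<close>

lemma runs_Seq:
  assumes "runs c s n s'" "runs d s' m s''"
  shows "runs (c ;; d) s (n + m + 1) s''"
  using assms(1)
proof (induction n arbitrary: c s)
  case 0
  then have "c = Skip" "s = s'" by (auto simp: runs_def)
  then show ?case
    using runs_Suc[OF assms(2), of "Skip ;; d" s'] by (simp add: small_step_def)
next
  case (Suc n)
  show ?case
  proof (cases "c = Skip")
    case True
    then have "s = s'" using Suc.prems by (simp add: runs_def del: funpow.simps)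
    then show ?thesis
      using runs_mono[OF runs_Suc[OF assms(2), of "Skip ;; d" s'], of "Suc n + m + 1"] True
      by (simp add: small_step_def)
  next
    case False
    obtain c1 s1 where 1: "small_step (c, s) = (c1, s1)" by fastforce
    then have "runs c1 s1 n s'"
      using Suc.prems by (simp add: runs_def funpow_Suc_right del: funpow.simps)
    moreover have "small_step (c ;; d, s) = (c1 ;; d, s1)"
      using 1 False by (auto simp: small_step_def)
    ultimately show ?thesis
      using runs_Suc[OF Suc.IH] by simp
  qed
qed

lemma runs_Cond:
  assumes "runs (if \<phi> (top_of (s r)) then c else d) s n s'"
  shows "runs (Cond r \<phi> c d) s (n + 1) s'"
  using runs_Suc[OF assms, of "Cond r \<phi> c d" s] by (simp add: small_step_def)

lemma runs_While_False:
  assumes "\<not> \<phi> (top_of (s r))"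
  shows "runs (While r \<phi> c) s 1 s"
  using assms by (simp add: runs_def small_step_def)

lemma runs_While_True:
  assumes "\<phi> (top_of (s r))" "runs c s n s'" "runs (While r \<phi> c) s' m s''"
  shows "runs (While r \<phi> c) s (n + m + 2) s''"
  using runs_Suc[OF runs_Seq[OF assms(2,3)], of "While r \<phi> c" s] assms(1) by (simp add: small_step_def)

text \<open>A step pushes at most one symbol. Time bounds therefore control the sizes of all
  results, and no separate size analysis of programs is required.\<close>

lemma small_steps_length:
  "length (snd ((small_step ^^ n) cs) r) \<le> length (snd cs r) + n"
proof (induction n)
  case (Suc n)
  have "length (snd (small_step cs') r) \<le> length (snd cs' r) + 1" for cs'
    by (cases "effect_of (fst cs')") (auto simp: small_step_def)
  from this[of "(small_step ^^ n) cs"] Suc show ?case by simp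
qed simp

lemma runs_length: "runs c s n s' \<Longrightarrow> length (s' r) \<le> length (s r) + n"
  using small_steps_length[of n "(c, s)" r] by (simp add: runs_def)

section \<open>Compilation to Turing machines\<close>

text \<open>A finite set that contains the command and is closed under \<open>next_com\<close>; it
  supplies the control states of the machine. It stays finite because a loop keeps itself as a
  continuation.\<close>

fun residuals :: "com \<Rightarrow> com set" where
  "residuals Skip = {Skip}"
| "residuals (Push r b) = {Push r b, Skip}"
| "residuals (Pop r) = {Pop r, Skip}"
| "residuals (Seq c d) = (\<lambda>c'. Seq c' d) ` residuals c \<union> residuals d"
| "residuals (Cond r \<phi> c d) = {Cond r \<phi> c d} \<union> residuals c \<union> residuals d"
| "residuals (While r \<phi> c) = {While r \<phi> c, Skip} \<union> (\<lambda>c'. Seq c' (While r \<phi> c)) ` residuals c"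

lemma finite_residuals: "finite (residuals c)"
  by (induction c) auto

lemma self_residual: "c \<in> residuals c"
  by (induction c) auto

lemma next_com_residual: "c' \<in> residuals c \<Longrightarrow> next_com c' \<tau> \<in> residuals c"
proof (induction c arbitrary: c')
  case (Cond r \<phi> c d)
  then show ?case using self_residual by auto
next
  case (Seq c d)
  then show ?case using self_residual by auto
next
  case (While r \<phi> c)
  from While.prems consider "c' = While r \<phi> c" | "c' = Skip"
    | x where "c' = x ;; While r \<phi> c" "x \<in> residuals c" by auto
  then show ?case
  proof cases
    case 3
    then show ?thesis using While.IH[of x] by simp
  qed (use self_residual[of c] in simp_all)
qed auto

text \<open>A control state is a residual command with a phase. A stack has its top under the head and
  grows to the left, so a push needs two machine steps: one to move left and one to write.\<close>

datatype state = Control com bool | Accept | Reject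

definition control_states :: "com \<Rightarrow> state set" where
  "control_states c = {Accept, Reject} \<union> (\<lambda>(c', b). Control c' b) ` (residuals c \<times> UNIV)"

lemma finite_control_states: "finite (control_states c)"
  by (simp add: control_states_def finite_residuals)

definition state_index :: "com \<Rightarrow> state \<Rightarrow> nat" where
  "state_index c = (SOME f. bij_betw f (control_states c) {0..<card (control_states c)})"

lemma state_index_bij: "bij_betw (state_index c) (control_states c) {0..<card (control_states c)}"
  unfolding state_index_def by (rule someI_ex[OF ex_bij_betw_finite_nat[OF finite_control_states]])

definition symbol_top :: "nat \<Rightarrow> bool option" where
  "symbol_top a = (if a = 0 then None else Some (a = 2))"

fun reg_index :: "reg \<Rightarrow> nat" where
  "reg_index R0 = 0" | "reg_index R1 = 1" | "reg_index R2 = 2" | "reg_index R3 = 3"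

fun first_action :: "effect \<Rightarrow> reg \<Rightarrow> nat \<Rightarrow> nat \<times> move" where
  "first_action (PushE r b) r' a = (a, if r = r' then Left else Stay)"
| "first_action _ r' a = (a, Stay)"

fun second_action :: "effect \<Rightarrow> reg \<Rightarrow> nat \<Rightarrow> nat \<times> move" where
  "second_action Idle r' a = (a, Stay)"
| "second_action (PushE r b) r' a = (if r = r' then bit_symbol b else a, Stay)"
| "second_action (PopE r) r' a = (a, if r = r' \<and> a \<noteq> 0 then Right else Stay)"

text \<open>When the program has ended, \<open>fin\<close> judges the symbol on top of
  \<open>R0\<close>. Thus one construction serves deciders, which accept on the bit true, and
  transducers, which always accept.\<close>

fun transition :: "(nat \<Rightarrow> bool) \<Rightarrow> state \<Rightarrow> nat list \<Rightarrow> state \<times> (nat \<times> move) list" where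
  "transition fin (Control c False) ss =
    (if c = Skip then if fin (ss ! 0) then Accept else Reject else Control c True,
     map (\<lambda>r. first_action (effect_of c) r (ss ! reg_index r)) [R0, R1, R2, R3])"
| "transition fin (Control c True) ss =
    (Control (next_com c (\<lambda>r. symbol_top (ss ! reg_index r))) False,
     map (\<lambda>r. second_action (effect_of c) r (ss ! reg_index r)) [R0, R1, R2, R3])"
| "transition fin q ss = (q, map (\<lambda>a. (a, Stay)) ss)"

definition machine :: "(nat \<Rightarrow> bool) \<Rightarrow> com \<Rightarrow> tm" where
  "machine fin c = \<lparr>num_tapes = 4, num_states = card (control_states c), num_symbols = 3,
     start_state = state_index c (Control c False), accept_state = state_index c Accept,
     reject_state = state_index c Reject,
     delta = (\<lambda>q ss. let (q', as) = transition fin (the_inv_into (control_states c) (state_index c) q) ss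
                     in (state_index c q', as))\<rparr>"

lemma in_control_states [simp]:
  "Accept \<in> control_states c" "Reject \<in> control_states c"
  "Control c' b \<in> control_states c \<longleftrightarrow> c' \<in> residuals c"
  by (auto simp: control_states_def)

lemma transition_states:
  assumes "q \<in> control_states c"
  shows "fst (transition fin q ss) \<in> control_states c"
proof (cases q)
  case (Control c' b)
  then show ?thesis
    using assms next_com_residual by (cases b) auto
qed auto

lemma state_index_less: "q \<in> control_states c \<Longrightarrow> state_index c q < card (control_states c)"
  using bij_betw_apply[OF state_index_bij] by fastforce

lemma state_index_eq:
  "q \<in> control_states c \<Longrightarrow> q' \<in> control_states c \<Longrightarrow> state_index c q = state_index c q' \<longleftrightarrow> q = q'"
  using state_index_bij[of c] by (auto simp: bij_betw_def inj_on_def)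

lemma the_inv_state_index:
  "q \<in> control_states c \<Longrightarrow> the_inv_into (control_states c) (state_index c) (state_index c q) = q"
  using state_index_bij[of c] by (auto simp: bij_betw_def the_inv_into_f_f)

lemma machine_turing_machine: "turing_machine (machine fin c)"
proof -
  let ?M = "machine fin c"
  have "fst (delta ?M q ss) < num_states ?M \<and> length (snd (delta ?M q ss)) = num_tapes ?M \<and>
      (\<forall>(s, m)\<in>set (snd (delta ?M q ss)). s < num_symbols ?M)"
    if q: "q < num_states ?M" and len: "length ss = num_tapes ?M"
      and ss: "\<forall>s\<in>set ss. s < num_symbols ?M" for q ss
  proof -
    from q have "q \<in> state_index c ` control_states c"
      using state_index_bij[of c] by (simp add: machine_def bij_betw_def)
    then obtain p where p: "p \<in> control_states c" "q = state_index c p" by blast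
    have len': "length ss = 4" and ss': "\<And>i. i < 4 \<Longrightarrow> ss ! i < 3"
      using len ss by (auto simp: machine_def)
    have ri: "reg_index r < 4" for r by (cases r) auto
    have f1: "fst (first_action e r (ss ! reg_index r)) < 3" for e r
      using ss'[OF ri] by (cases e) auto
    have f2: "fst (second_action e r (ss ! reg_index r)) < 3" for e r
      using ss'[OF ri] by (cases e) (auto simp: bit_symbol_def)
    have "length (snd (transition fin p ss)) = 4 \<and> (\<forall>a\<in>set (snd (transition fin p ss)). fst a < 3)"
    proof (cases p)
      case (Control c' b)
      then show ?thesis
        using f1[of _ R0] f1[of _ R1] f1[of _ R2] f1[of _ R3] f2[of _ R0] f2[of _ R1] f2[of _ R2] f2[of _ R3]
        by (cases b) auto
    qed (use len' ss in \<open>auto simp: machine_def\<close>)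
    moreover have "delta ?M q ss = (state_index c (fst (transition fin p ss)), snd (transition fin p ss))"
      using p by (simp add: machine_def the_inv_state_index split: prod.split)
    ultimately show ?thesis
      using state_index_less[OF transition_states[OF p(1)]] by (auto simp: machine_def)
  qed
  moreover have "num_tapes ?M \<ge> 1" "num_symbols ?M \<ge> 3" "start_state ?M < num_states ?M"
      "accept_state ?M < num_states ?M" "reject_state ?M < num_states ?M" "accept_state ?M \<noteq> reject_state ?M"
    by (simp_all add: machine_def state_index_less state_index_eq self_residual)
  ultimately show ?thesis
    unfolding turing_machine_def by blast
qed

definition store_tapes :: "store \<Rightarrow> tape list \<Rightarrow> bool" where
  "store_tapes s ts \<longleftrightarrow> length ts = 4 \<and> (\<forall>r. tape_holds (ts ! reg_index r) (s r))"

lemma tape_holds_top: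
  assumes "tape_holds t w"
  shows "symbol_top (read_tape t) = top_of w"
proof (cases w)
  case (Cons b v)
  then have "read_tape t = bit_symbol b"
    using assms by (cases t) force
  then show ?thesis using Cons by (simp add: symbol_top_def bit_symbol_def)
qed (use assms in \<open>cases t; simp add: symbol_top_def\<close>)

lemma tape_holds_Push:
  assumes "tape_holds (f, h) w"
  shows "tape_holds (f(h - 1 := bit_symbol b), h - 1) (b # w)"
proof -
  have "(f(h - 1 := bit_symbol b)) (h - 1 + int i) = bit_symbol ((b # w) ! i)" if "i < Suc (length w)" for i
    using assms that by (cases i) auto
  then show ?thesis using assms by auto
qed

lemma tape_holds_Pop:
  assumes "tape_holds (f, h) w"
  shows "tape_holds (f, if f h \<noteq> 0 then h + 1 else h) (tl w)"
proof (cases w)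
  case Nil
  then show ?thesis using assms by auto
next
  case (Cons b v)
  have "f (h + 1 + int i) = bit_symbol (v ! i)" if "i < length v" for i
    using assms Cons that by (auto simp: algebra_simps dest!: spec[of _ "Suc i"])
  moreover have "f h \<noteq> 0"
    using assms Cons by (auto simp: bit_symbol_def)
  ultimately show ?thesis using assms Cons by (auto simp: algebra_simps)
qed

text \<open>Between the two phases of a push, the head stands on an unspecified cell beyond the top
  of the stack, so the symbols read in the second phase may be wrong. This does no harm: the
  successor of a pushing command ignores them.\<close>

lemma next_com_Push: "effect_of c = PushE r b \<Longrightarrow> next_com c \<tau> = next_com c \<tau>'"
  by (induction c) auto

lemma step_Control:
  assumes "q \<in> control_states c" "\<exists>c' b. q = Control c' b"
  shows "step (machine fin c) (state_index c q, ts) =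
    (state_index c (fst (transition fin q (map read_tape ts))),
     map2 act_tape ts (snd (transition fin q (map read_tape ts))))"
  using assms by (auto simp: machine_def state_index_eq the_inv_state_index split: prod.split)

lemma length_4_conv: "length ts = 4 \<longleftrightarrow> (\<exists>t0 t1 t2 t3. ts = [t0, t1, t2, t3])"
  by (auto simp: eval_nat_numeral length_Suc_conv)

lemma act_tape_Stay [simp]: "act_tape t (read_tape t, Stay) = t"
  by (cases t) simp

lemma two_steps:
  assumes "c' \<in> residuals c" "c' \<noteq> Skip" "store_tapes s ts"
    and "small_step (c', s) = (c'', s')"
  shows "\<exists>ts'. (step (machine fin c) ^^ 2) (state_index c (Control c' False), ts) =
           (state_index c (Control c'' False), ts') \<and> store_tapes s' ts'"
proof -
  let ?M = "machine fin c"
  obtain t0 t1 t2 t3 where ts: "ts = [t0, t1, t2, t3]"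
    using assms(3) by (auto simp: store_tapes_def length_4_conv)
  define acts1 where "acts1 = snd (transition fin (Control c' False) (map read_tape ts))"
  define ts1 where "ts1 = map2 act_tape ts acts1"
  have s1: "step ?M (state_index c (Control c' False), ts) = (state_index c (Control c' True), ts1)"
    using assms(1,2) by (subst step_Control) (auto simp: ts1_def acts1_def)
  define c2 where "c2 = next_com c' (\<lambda>r. symbol_top (map read_tape ts1 ! reg_index r))"
  define ts2 where "ts2 = map2 act_tape ts1 (map (\<lambda>r. second_action (effect_of c') r (map read_tape ts1 ! reg_index r)) [R0, R1, R2, R3])"
  have s2: "step ?M (state_index c (Control c' True), ts1) = (state_index c (Control c2 False), ts2)"
    using assms(1,2) by (subst step_Control) (auto simp: ts2_def c2_def)
  have h: "tape_holds t0 (s R0)" "tape_holds t1 (s R1)" "tape_holds t2 (s R2)" "tape_holds t3 (s R3)"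
    using assms(3) ts by (auto simp: store_tapes_def dest: spec[of _ R0] spec[of _ R1] spec[of _ R2] spec[of _ R3])
  have "c2 = c'' \<and> store_tapes s' ts2"
  proof (cases "effect_of c'")
    case Idle
    then have "ts1 = ts" "ts2 = ts" by (auto simp: ts1_def ts2_def acts1_def ts)
    moreover have "(\<lambda>r. symbol_top (map read_tape ts ! reg_index r)) = (\<lambda>r. top_of (s r))"
    proof
      show "symbol_top (map read_tape ts ! reg_index r) = top_of (s r)" for r
        using h ts by (cases r) (auto simp: tape_holds_top)
    qed
    ultimately show ?thesis
      using assms(3,4) Idle by (auto simp: small_step_def c2_def)
  next
    case (PushE r b)
    have "c2 = c''"
      using assms(4) next_com_Push[OF PushE] by (auto simp: small_step_def c2_def)
    moreover have "store_tapes s' ts2"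
    proof -
      have s': "s' = s(r := b # s r)" using assms(4) PushE by (auto simp: small_step_def)
      have P: "tape_holds (act_tape (act_tape t (read_tape t, Left)) (bit_symbol b, Stay)) (b # w)"
        if "tape_holds t w" for t w
        using tape_holds_Push[of "fst t" "snd t" w b] that by (cases t) (auto simp del: tape_holds.simps)
      have "length ts2 = 4" by (simp add: ts2_def ts1_def acts1_def ts)
      moreover have "tape_holds (ts2 ! reg_index r') (s' r')" for r'
        using h P PushE by (cases r; cases r'; simp add: ts2_def ts1_def acts1_def ts s' del: tape_holds.simps)
      ultimately show ?thesis by (simp add: store_tapes_def)
    qed
    ultimately show ?thesis by simp
  next
    case (PopE r)
    then have ts1: "ts1 = ts" by (auto simp: ts1_def acts1_def ts)
    have "(\<lambda>r. symbol_top (map read_tape ts ! reg_index r)) = (\<lambda>r. top_of (s r))"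
    proof
      show "symbol_top (map read_tape ts ! reg_index r) = top_of (s r)" for r
        using h ts by (cases r) (auto simp: tape_holds_top)
    qed
    then have "c2 = c''"
      using assms(4) by (auto simp: small_step_def c2_def ts1)
    moreover have "store_tapes s' ts2"
    proof -
      have s': "s' = s(r := tl (s r))" using assms(4) PopE by (auto simp: small_step_def)
      have P: "tape_holds (act_tape t (read_tape t, if read_tape t \<noteq> 0 then Right else Stay)) (tl w)"
        if "tape_holds t w" for t w
        using tape_holds_Pop[of "fst t" "snd t" w] that by (cases t) (auto simp del: tape_holds.simps)
      have "length ts2 = 4" by (simp add: ts2_def ts1 ts)
      moreover have "tape_holds (ts2 ! reg_index r') (s' r')" for r'
        using h P PopE by (cases r; cases r'; simp add: ts2_def ts1 ts s' del: tape_holds.simps)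
      ultimately show ?thesis by (simp add: store_tapes_def)
    qed
    ultimately show ?thesis by simp
  qed
  then show ?thesis
    using s1 s2 by (auto simp: numeral_2_eq_2)
qed

lemma step_accept_reject:
  assumes "q = accept_state M \<or> q = reject_state M"
  shows "(step M ^^ n) (q, ts) = (q, ts)"
  using assms by (induction n) auto

lemma simulate:
  assumes "(small_step ^^ n) (c', s) = (Skip, s')" "c' \<in> residuals c" "store_tapes s ts"
  shows "\<exists>k\<le>2 * n. \<exists>ts'. (step (machine fin c) ^^ k) (state_index c (Control c' False), ts) =
           (state_index c (Control Skip False), ts') \<and> store_tapes s' ts'"
  using assms
proof (induction n arbitrary: c' s ts)
  case 0
  then show ?case by force
next
  case (Suc n)
  show ?case
  proof (cases "c' = Skip")
    case True
    then show ?thesis using Suc.prems by (intro exI[of _ 0]) (auto simp del: funpow.simps(2))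
  next
    case False
    obtain c1 s1 where 1: "small_step (c', s) = (c1, s1)" by fastforce
    obtain ts1 where ts1: "(step (machine fin c) ^^ 2) (state_index c (Control c' False), ts) =
        (state_index c (Control c1 False), ts1)" "store_tapes s1 ts1"
      using two_steps[OF Suc.prems(2) False Suc.prems(3) 1] by blast
    have "c1 \<in> residuals c"
      using 1 next_com_residual[OF Suc.prems(2)] by (auto simp: small_step_def)
    moreover have "(small_step ^^ n) (c1, s1) = (Skip, s')"
      using Suc.prems(1) 1 by (simp add: funpow_Suc_right del: funpow.simps)
    ultimately obtain k ts' where k: "k \<le> 2 * n"
      "(step (machine fin c) ^^ k) (state_index c (Control c1 False), ts1) =
           (state_index c (Control Skip False), ts')" "store_tapes s' ts'"
      using Suc.IH ts1(2) by blast
    have "(step (machine fin c) ^^ (k + 2)) (state_index c (Control c' False), ts) =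
           (state_index c (Control Skip False), ts')"
      using k(2) ts1(1) by (simp only: funpow_add comp_apply)
    then show ?thesis using k(1,3) by (intro exI[of _ "k + 2"]) (auto simp del: funpow.simps)
  qed
qed

definition single :: "bool list \<Rightarrow> store" where
  "single w = (\<lambda>r. if r = R0 then w else [])"

lemma initial_store_tapes: "store_tapes (single w) (input_tape w # replicate 3 blank_tape)"
proof -
  have "tape_holds ((input_tape w # replicate 3 blank_tape) ! reg_index r) (single w r)" for r
    by (cases r) (auto simp: single_def input_tape_def blank_tape_def numeral_3_eq_3)
  then show ?thesis by (simp add: store_tapes_def)
qed

lemma machine_run:
  assumes "runs c (single w) n s'"
  shows "\<exists>t\<le>2 * n + 1. \<exists>ts. run (machine fin c) w t =
    (if fin (case s' R0 of [] \<Rightarrow> 0 | b # _ \<Rightarrow> bit_symbol b) then accept_state (machine fin c)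
     else reject_state (machine fin c), ts) \<and> store_tapes s' ts"
proof -
  let ?M = "machine fin c"
  have init: "initial_config ?M w = (state_index c (Control c False), input_tape w # replicate 3 blank_tape)"
    by (simp add: initial_config_def machine_def)
  obtain k ts where k: "k \<le> 2 * n" "run ?M w k = (state_index c (Control Skip False), ts)"
      and ts: "store_tapes s' ts"
    using simulate[OF assms[unfolded runs_def] self_residual initial_store_tapes, of fin]
    unfolding run_def init by blast
  have Skip: "Skip \<in> residuals c"
  proof -
    have "fst ((small_step ^^ m) (c, single w)) \<in> residuals c" for m
      by (induction m) (auto simp: self_residual small_step_def next_com_residual)
    from this[of n] show ?thesis using assms by (simp add: runs_def)
  qed
  obtain t0 t1 t2 t3 where ts4: "ts = [t0, t1, t2, t3]"
    using ts by (auto simp: store_tapes_def length_4_conv)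
  have "tape_holds t0 (s' R0)"
    using ts ts4 by (auto simp: store_tapes_def dest: spec[of _ R0])
  then have rd: "read_tape t0 = (case s' R0 of [] \<Rightarrow> 0 | b # _ \<Rightarrow> bit_symbol b)"
    by (cases t0; cases "s' R0") force+
  have "step ?M (state_index c (Control Skip False), ts) =
      (state_index c (if fin (read_tape t0) then Accept else Reject), ts)"
    unfolding ts4 by (subst step_Control) (use Skip in auto)
  then have "run ?M w (Suc k) = (state_index c (if fin (read_tape t0) then Accept else Reject), ts)"
    using k(2) by (simp add: run_def)
  then show ?thesis
    using k(1) ts rd by (intro exI[of _ "Suc k"]) (auto simp: machine_def)
qed

lemma decidable_by_com:
  assumes "\<And>w. \<exists>n s'. runs c (single w) n s' \<and> s' R0 \<noteq> [] \<and> (hd (s' R0) \<longleftrightarrow> w \<in> L)"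
  shows "decidable L"
proof -
  let ?M = "machine (\<lambda>a. a = 2) c"
  have "\<exists>t. decided_at ?M L w t" for w
  proof -
    obtain n s' where n: "runs c (single w) n s'" "s' R0 \<noteq> []" "hd (s' R0) \<longleftrightarrow> w \<in> L"
      using assms by blast
    obtain b v where v: "s' R0 = b # v" using n(2) by (cases "s' R0") auto
    obtain t ts where "run ?M w t = (if b then accept_state ?M else reject_state ?M, ts)"
      using machine_run[OF n(1), of "\<lambda>a. a = 2"] v by (auto simp: bit_symbol_def split: if_splits)
    then have "decided_at ?M L w t"
      using n(3) v by (simp add: decided_at_def)
    then show ?thesis ..
  qed
  then show ?thesis
    using machine_turing_machine unfolding decidable_def by blast
qed

lemma polytime_computable_by_com:
  fixes p :: "nat poly"
  assumes "\<And>w. \<exists>n\<le>poly p (length w). runs c (single w) n (single (f w))"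
  shows "polytime_computable f"
proof -
  let ?M = "machine (\<lambda>_. True) c"
  have "\<exists>t\<le>poly ([:2:] * p + 1) (length w). fst (run ?M w t) = accept_state ?M \<and>
      tape_holds (hd (snd (run ?M w t))) (f w)" for w
  proof -
    obtain n where n: "n \<le> poly p (length w)" "runs c (single w) n (single (f w))"
      using assms by blast
    obtain t ts where t: "t \<le> 2 * n + 1" "run ?M w t = (accept_state ?M, ts)" "store_tapes (single (f w)) ts"
      using machine_run[OF n(2), of "\<lambda>_. True"] by auto
    obtain t0 t1 t2 t3 where ts4: "ts = [t0, t1, t2, t3]"
      using t(3) by (auto simp: store_tapes_def length_4_conv)
    have "tape_holds t0 (f w)"
      using t(3) ts4 by (auto simp: store_tapes_def single_def dest: spec[of _ R0])
    then show ?thesis using t n(1) ts4 by (intro exI[of _ t]) auto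
  qed
  then show ?thesis
    using machine_turing_machine unfolding polytime_computable_def by blast
qed


section \<open>Trees on a stack\<close>

datatype tree = Leaf | Node tree tree

fun code :: "tree \<Rightarrow> bool list" where
  "code Leaf = [False]"
| "code (Node a b) = True # code a @ code b"

definition regs :: "bool list \<Rightarrow> bool list \<Rightarrow> bool list \<Rightarrow> bool list \<Rightarrow> store" where
  "regs a b c d = (\<lambda>r. case r of R0 \<Rightarrow> a | R1 \<Rightarrow> b | R2 \<Rightarrow> c | R3 \<Rightarrow> d)"

lemma regs_simps [simp]:
  "regs a b c d R0 = a" "regs a b c d R1 = b" "regs a b c d R2 = c" "regs a b c d R3 = d"
  "(regs a b c d)(R0 := x) = regs x b c d" "(regs a b c d)(R1 := x) = regs a x c d"
  "(regs a b c d)(R2 := x) = regs a b x d" "(regs a b c d)(R3 := x) = regs a b c x"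
  by (auto simp: regs_def fun_eq_iff split: reg.split)

lemma single_regs: "single w = regs w [] [] []"
  by (auto simp: single_def regs_def fun_eq_iff split: reg.split)

abbreviation nonempty :: "bool option \<Rightarrow> bool" where
  "nonempty b \<equiv> b \<noteq> None"

abbreviation is_true :: "bool option \<Rightarrow> bool" where
  "is_true b \<equiv> b = Some True"

text \<open>Register \<open>R1\<close> counts, in unary, the trees that are still to be read from \<open>R0\<close>.\<close>

definition move_tree_loop :: "reg \<Rightarrow> com" where
  "move_tree_loop b = While R1 nonempty (Cond R0 is_true
     (Pop R0 ;; Push b True ;; Push R1 True) (Pop R0 ;; Push b False ;; Pop R1))"

definition move_tree :: "reg \<Rightarrow> com" where
  "move_tree b = Push R1 True ;; move_tree_loop b"

definition move_all :: "reg \<Rightarrow> reg \<Rightarrow> com" where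
  "move_all a b = While a nonempty (Cond a is_true (Pop a ;; Push b True) (Pop a ;; Push b False))"

definition move_all2 :: "reg \<Rightarrow> reg \<Rightarrow> reg \<Rightarrow> com" where
  "move_all2 a b c = While a nonempty (Cond a is_true
     (Pop a ;; Push b True ;; Push c True) (Pop a ;; Push b False ;; Push c False))"

text \<open>Moving to another stack reverses, so each copy is moved an even number of times: twice
  for the copy that \<open>move_all2\<close> returns to \<open>R0\<close>, four times for the one
  that it leaves on \<open>R3\<close>.\<close>

definition dup_tree :: com where
  "dup_tree = move_tree R2 ;; move_all2 R2 R0 R3 ;; move_all R3 R2 ;; move_all R2 R0"

definition swap_tree :: com where
  "swap_tree = move_tree R2 ;; move_tree R3 ;; move_all R2 R0 ;; move_all R3 R0"

definition drop_tree :: com where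
  "drop_tree = move_tree R2 ;; While R2 nonempty (Pop R2)"

text \<open>The invariant: \<open>R0\<close> begins with the codes of as many trees as
  \<open>R1\<close> counts. Reading a node replaces one awaited tree by its two children, reading a
  leaf completes one. The list of trees may grow, so the induction is on the remaining code
  length.\<close>

lemma runs_move_tree_loop:
  assumes "b \<noteq> R0" "b \<noteq> R1" "s R0 = concat (map code ts) @ r" "s R1 = replicate (length ts) True"
  shows "runs (move_tree_loop b) s (8 * length (concat (map code ts)) + 1)
    (s(R0 := r, R1 := [], b := rev (concat (map code ts)) @ s b))"
  using assms
proof (induction "length (concat (map code ts))" arbitrary: ts s rule: less_induct)
  case less
  show ?case
  proof (cases ts)
    case Nil
    then have "s(R0 := r, R1 := [], b := rev (concat (map code ts)) @ s b) = s"
      using less.prems by (auto simp: fun_eq_iff)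
    then show ?thesis
      using runs_While_False[of nonempty s R1] less.prems Nil by (simp add: move_tree_loop_def)
  next
    case (Cons t ts')
    have R1: "s R1 = True # replicate (length ts') True" using less.prems Cons by simp
    show ?thesis
    proof (cases t)
      case Leaf
      define s' where "s' = s(R0 := concat (map code ts') @ r, b := False # s b, R1 := replicate (length ts') True)"
      have 1: "runs (Pop R0 ;; Push b False ;; Pop R1) s 5 s'"
        using runs_Seq[OF runs_Pop[of R0 s] runs_Seq[OF runs_Push runs_Pop], of b False R1] less.prems Cons Leaf
        by (auto simp: s'_def elim!: runs_mono)
      have "runs (Cond R0 is_true (Pop R0 ;; Push b True ;; Push R1 True) (Pop R0 ;; Push b False ;; Pop R1)) s 6 s'"
        using runs_Cond[of is_true s R0 "Pop R0 ;; Push b True ;; Push R1 True" "Pop R0 ;; Push b False ;; Pop R1" 5 s']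
          1 less.prems Cons Leaf by simp
      moreover have "runs (move_tree_loop b) s' (8 * length (concat (map code ts')) + 1)
          (s'(R0 := r, R1 := [], b := rev (concat (map code ts')) @ s' b))"
        using less.prems Cons Leaf by (intro less.hyps) (auto simp: s'_def)
      moreover have "s'(R0 := r, R1 := [], b := rev (concat (map code ts')) @ s' b) =
          s(R0 := r, R1 := [], b := rev (concat (map code ts)) @ s b)"
        using less.prems Cons Leaf by (auto simp: s'_def fun_eq_iff)
      ultimately show ?thesis
        using runs_While_True[of nonempty s R1 _ 6 s'] R1 Cons Leaf
        unfolding move_tree_loop_def by fastforce
    next
      case (Node x y)
      define s' where "s' = s(R0 := concat (map code (x # y # ts')) @ r, b := True # s b,
          R1 := replicate (length (x # y # ts')) True)"
      have 1: "runs (Pop R0 ;; Push b True ;; Push R1 True) s 5 s'"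
        using runs_Seq[OF runs_Pop[of R0 s] runs_Seq[OF runs_Push runs_Push], of b True R1 True] less.prems Cons Node
        by (auto simp: s'_def elim!: runs_mono)
      have "runs (Cond R0 is_true (Pop R0 ;; Push b True ;; Push R1 True) (Pop R0 ;; Push b False ;; Pop R1)) s 6 s'"
        using runs_Cond[of is_true s R0 "Pop R0 ;; Push b True ;; Push R1 True" "Pop R0 ;; Push b False ;; Pop R1" 5 s']
          1 less.prems Cons Node by simp
      moreover have "runs (move_tree_loop b) s' (8 * length (concat (map code (x # y # ts'))) + 1)
          (s'(R0 := r, R1 := [], b := rev (concat (map code (x # y # ts'))) @ s' b))"
        using less.prems Cons Node by (intro less.hyps) (auto simp: s'_def)
      moreover have "s'(R0 := r, R1 := [], b := rev (concat (map code (x # y # ts'))) @ s' b) =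
          s(R0 := r, R1 := [], b := rev (concat (map code ts)) @ s b)"
        using less.prems Cons Node by (auto simp: s'_def fun_eq_iff)
      ultimately show ?thesis
        using runs_While_True[of nonempty s R1 _ 6 s'] R1 Cons Node
        unfolding move_tree_loop_def by fastforce
    qed
  qed
qed

lemma runs_move_tree:
  assumes "b \<noteq> R0" "b \<noteq> R1" "s R0 = code t @ r" "s R1 = []"
  shows "runs (move_tree b) s (8 * length (code t) + 3) (s(R0 := r, b := rev (code t) @ s b))"
proof -
  let ?s = "s(R1 := [True])"
  have "runs (move_tree_loop b) ?s (8 * length (concat (map code [t])) + 1)
      (?s(R0 := r, R1 := [], b := rev (concat (map code [t])) @ ?s b))"
    using assms by (intro runs_move_tree_loop) auto
  moreover have "?s(R0 := r, R1 := [], b := rev (concat (map code [t])) @ ?s b) =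
      s(R0 := r, b := rev (code t) @ s b)"
    using assms by (auto simp: fun_eq_iff)
  ultimately have 1: "runs (move_tree_loop b) (s(R1 := True # s R1)) (8 * length (code t) + 1)
      (s(R0 := r, b := rev (code t) @ s b))"
    using assms by simp
  show ?thesis
    unfolding move_tree_def by (rule runs_mono[OF runs_Seq[OF runs_Push 1]]) simp
qed

lemma runs_move_all:
  assumes "a \<noteq> b"
  shows "runs (move_all a b) s (6 * length (s a) + 1) (s(a := [], b := rev (s a) @ s b))"
proof (induction "s a" arbitrary: s)
  case Nil
  then have eq: "s(a := [], b := rev (s a) @ s b) = s" by (auto simp: fun_eq_iff)
  show ?case
    unfolding eq move_all_def using Nil[symmetric] by (intro runs_mono[OF runs_While_False]) simp_all
next
  case (Cons x w)
  define s' where "s' = s(a := w, b := x # s b)"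
  have "runs (Pop a ;; Push b x) s 3 s'"
    using runs_Seq[OF runs_Pop[of a s] runs_Push[of b x]] Cons(2)[symmetric] assms
    by (auto simp: s'_def elim!: runs_mono)
  then have 1: "runs (Cond a is_true (Pop a ;; Push b True) (Pop a ;; Push b False)) s 4 s'"
    using runs_Cond[of is_true s a "Pop a ;; Push b True" "Pop a ;; Push b False" 3 s'] Cons(2)[symmetric]
    by (cases x) auto
  have 2: "runs (move_all a b) s' (6 * length w + 1) (s'(a := [], b := rev w @ s' b))"
    using Cons(1)[of s'] assms by (simp add: s'_def)
  have "s'(a := [], b := rev w @ s' b) = s(a := [], b := rev (s a) @ s b)"
    using Cons(2)[symmetric] assms by (auto simp: s'_def fun_eq_iff)
  then show ?case
    using runs_While_True[of nonempty s a _ 4 s', OF _ 1] 2 Cons(2)[symmetric]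
    unfolding move_all_def by fastforce
qed

lemma runs_move_all2:
  assumes "a \<noteq> b" "a \<noteq> c" "b \<noteq> c"
  shows "runs (move_all2 a b c) s (8 * length (s a) + 1) (s(a := [], b := rev (s a) @ s b, c := rev (s a) @ s c))"
proof (induction "s a" arbitrary: s)
  case Nil
  then have eq: "s(a := [], b := rev (s a) @ s b, c := rev (s a) @ s c) = s" by (auto simp: fun_eq_iff)
  show ?case
    unfolding eq move_all2_def using Nil[symmetric] by (intro runs_mono[OF runs_While_False]) simp_all
next
  case (Cons x w)
  define s' where "s' = s(a := w, b := x # s b, c := x # s c)"
  have "runs (Pop a ;; Push b x ;; Push c x) s 5 s'"
    using runs_Seq[OF runs_Pop[of a s] runs_Seq[OF runs_Push[of b x] runs_Push[of c x]]] Cons(2)[symmetric] assms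
    by (auto simp: s'_def elim!: runs_mono)
  then have 1: "runs (Cond a is_true (Pop a ;; Push b True ;; Push c True) (Pop a ;; Push b False ;; Push c False)) s 6 s'"
    using runs_Cond[of is_true s a "Pop a ;; Push b True ;; Push c True" "Pop a ;; Push b False ;; Push c False" 5 s']
      Cons(2)[symmetric] by (cases x) auto
  have 2: "runs (move_all2 a b c) s' (8 * length w + 1) (s'(a := [], b := rev w @ s' b, c := rev w @ s' c))"
    using Cons(1)[of s'] assms by (simp add: s'_def)
  have "s'(a := [], b := rev w @ s' b, c := rev w @ s' c) = s(a := [], b := rev (s a) @ s b, c := rev (s a) @ s c)"
    using Cons(2)[symmetric] assms by (auto simp: s'_def fun_eq_iff)
  then show ?case
    using runs_While_True[of nonempty s a _ 6 s', OF _ 1] 2 Cons(2)[symmetric]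
    unfolding move_all2_def by fastforce
qed

lemma runs_dup_tree:
  "runs dup_tree (single (code t @ r)) (30 * length (code t) + 10) (single (code t @ code t @ r))"
proof -
  have 1: "runs (move_tree R2) (single (code t @ r)) (8 * length (code t) + 3) (regs r [] (rev (code t)) [])"
    using runs_move_tree[of R2 "single (code t @ r)" t r] by (simp add: single_regs)
  have 2: "runs (move_all2 R2 R0 R3) (regs r [] (rev (code t)) []) (8 * length (code t) + 1)
      (regs (code t @ r) [] [] (code t))"
    using runs_move_all2[of R2 R0 R3 "regs r [] (rev (code t)) []"] by simp
  have 3: "runs (move_all R3 R2) (regs (code t @ r) [] [] (code t)) (6 * length (code t) + 1)
      (regs (code t @ r) [] (rev (code t)) [])"
    using runs_move_all[of R3 R2 "regs (code t @ r) [] [] (code t)"] by simp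
  have 4: "runs (move_all R2 R0) (regs (code t @ r) [] (rev (code t)) []) (6 * length (code t) + 1)
      (single (code t @ code t @ r))"
    using runs_move_all[of R2 R0 "regs (code t @ r) [] (rev (code t)) []"] by (simp add: single_regs)
  show ?thesis
    unfolding dup_tree_def
    by (rule runs_mono[OF runs_Seq[OF 1 runs_Seq[OF 2 runs_Seq[OF 3 4]]]]) simp
qed

lemma runs_swap_tree:
  "runs swap_tree (single (code t @ code u @ r)) (14 * (length (code t) + length (code u)) + 11)
    (single (code u @ code t @ r))"
proof -
  have 1: "runs (move_tree R2) (single (code t @ code u @ r)) (8 * length (code t) + 3)
      (regs (code u @ r) [] (rev (code t)) [])"
    using runs_move_tree[of R2 "single (code t @ code u @ r)" t "code u @ r"] by (simp add: single_regs)
  have 2: "runs (move_tree R3) (regs (code u @ r) [] (rev (code t)) []) (8 * length (code u) + 3)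
      (regs r [] (rev (code t)) (rev (code u)))"
    using runs_move_tree[of R3 "regs (code u @ r) [] (rev (code t)) []" u r] by simp
  have 3: "runs (move_all R2 R0) (regs r [] (rev (code t)) (rev (code u))) (6 * length (code t) + 1)
      (regs (code t @ r) [] [] (rev (code u)))"
    using runs_move_all[of R2 R0 "regs r [] (rev (code t)) (rev (code u))"] by simp
  have 4: "runs (move_all R3 R0) (regs (code t @ r) [] [] (rev (code u))) (6 * length (code u) + 1)
      (single (code u @ code t @ r))"
    using runs_move_all[of R3 R0 "regs (code t @ r) [] [] (rev (code u))"] by (simp add: single_regs)
  show ?thesis
    unfolding swap_tree_def
    by (rule runs_mono[OF runs_Seq[OF 1 runs_Seq[OF 2 runs_Seq[OF 3 4]]]]) simp
qed

lemma runs_drop_tree: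
  "runs drop_tree (single (code t @ r)) (11 * length (code t) + 5) (single r)"
proof -
  have 1: "runs (move_tree R2) (single (code t @ r)) (8 * length (code t) + 3) (regs r [] (rev (code t)) [])"
    using runs_move_tree[of R2 "single (code t @ r)" t r] by (simp add: single_regs)
  have 2: "runs (While R2 nonempty (Pop R2)) (regs r [] w []) (3 * length w + 1) (regs r [] [] [])" for w
  proof (induction w)
    case Nil
    show ?case using runs_While_False[of nonempty "regs r [] [] []" R2] by simp
  next
    case (Cons x w)
    have "runs (Pop R2) (regs r [] (x # w) []) 1 (regs r [] w [])"
      using runs_Pop[of R2 "regs r [] (x # w) []"] by simp
    from runs_While_True[of nonempty "regs r [] (x # w) []" R2, OF _ this Cons] show ?case
      by (auto elim!: runs_mono)
  qed
  show ?thesis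
    unfolding drop_tree_def single_regs[of r]
    by (rule runs_mono[OF runs_Seq[OF 1 2]]) simp
qed

definition push_list :: "bool list \<Rightarrow> com" where
  "push_list w = foldr (\<lambda>b c. c ;; Push R0 b) w Skip"

lemma runs_push_list: "runs (push_list w) (single r) (2 * length w) (single (w @ r))"
proof (induction w)
  case Nil
  show ?case by (simp add: push_list_def runs_Skip)
next
  case (Cons b w)
  have "runs (Push R0 b) (single (w @ r)) 1 (single ((b # w) @ r))"
    using runs_Push[of R0 b "single (w @ r)"] by (simp add: single_regs)
  from runs_Seq[OF Cons this] show ?case by (simp add: push_list_def)
qed

section \<open>Functions on encodable data\<close>

class enc = fixes enc :: "'a \<Rightarrow> tree"

instantiation unit :: enc
begin
definition enc_unit :: "unit \<Rightarrow> tree" where "enc_unit x = Leaf"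
instance ..
end

instantiation bool :: enc
begin
definition enc_bool :: "bool \<Rightarrow> tree" where "enc_bool b = (if b then Node Leaf Leaf else Leaf)"
instance ..
end

text \<open>Naturals are unary and have the same trees as lists of units. A bound polynomial in
  \<open>sz\<close> is then polynomial in the value of the number, which suits indices of grid
  cells.\<close>

instantiation nat :: enc
begin
primrec enc_nat :: "nat \<Rightarrow> tree" where
  "enc_nat 0 = Leaf" | "enc_nat (Suc n) = Node Leaf (enc_nat n)"
instance ..
end

instantiation prod :: (enc, enc) enc
begin
definition enc_prod :: "'a \<times> 'b \<Rightarrow> tree" where "enc_prod p = Node (enc (fst p)) (enc (snd p))"
instance ..
end

instantiation list :: (enc) enc
begin
primrec enc_list :: "'a list \<Rightarrow> tree" where
  "enc_list [] = Leaf" | "enc_list (x # xs) = Node (enc x) (enc_list xs)"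
instance ..
end

definition sz :: "'a::enc \<Rightarrow> nat" where
  "sz x = length (code (enc x))"

lemma sz_simps [simp]:
  "sz () = 1" "sz False = 1" "sz True = 3" "sz (0::nat) = 1" "sz (Suc n) = sz n + 2"
  "sz (a, b) = sz a + sz b + 1" "sz [] = 1" "sz (x # xs) = sz x + sz xs + 1"
  by (simp_all add: sz_def enc_unit_def enc_bool_def enc_prod_def)

lemma sz_pos [simp]: "0 < sz x"
  unfolding sz_def by (cases "enc x") auto

text \<open>The remainder \<open>r\<close> of the stack is left untouched. This frame condition
  allows a program to run on top of saved data.\<close>

definition computes :: "com \<Rightarrow> ('a::enc \<Rightarrow> 'b::enc) \<Rightarrow> ('a \<Rightarrow> nat) \<Rightarrow> bool" where
  "computes c f t \<longleftrightarrow>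
    (\<forall>x r. runs c (single (code (enc x) @ r)) (t x) (single (code (enc (f x)) @ r)))"

text \<open>A result cannot outgrow the argument by more than one symbol per step, by
  \<open>runs_length\<close>.\<close>

lemma computes_sz:
  assumes "computes c f t"
  shows "sz (f x) \<le> sz x + t x"
proof -
  have "runs c (single (code (enc x) @ [])) (t x) (single (code (enc (f x)) @ []))"
    using assms unfolding computes_def by blast
  from runs_length[OF this, of R0] show ?thesis by (simp add: sz_def single_def)
qed

text \<open>A second copy of the argument waits below while \<open>cf\<close> runs, and a swap
  brings it up for \<open>cg\<close>. The final \<open>True\<close> is the code of the node that
  joins the results. The factor 200 is a crude allowance; the sizes of the results are absorbed into
  the times by \<open>computes_sz\<close>.\<close>

lemma computes_pair:
  fixes f :: "'a::enc \<Rightarrow> 'b::enc" and g :: "'a \<Rightarrow> 'c::enc"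
  assumes f: "computes cf f tf" and g: "computes cg g tg"
  shows "computes (dup_tree ;; cf ;; swap_tree ;; cg ;; swap_tree ;; Push R0 True)
    (\<lambda>x. (f x, g x)) (\<lambda>x. 200 * (sz x + tf x + tg x))"
  unfolding computes_def
proof (intro allI)
  fix x :: 'a and r :: "bool list"
  let ?x = "code (enc x)" and ?f = "code (enc (f x))" and ?g = "code (enc (g x))"
  have 1: "runs dup_tree (single (?x @ r)) (30 * sz x + 10) (single (?x @ ?x @ r))"
    using runs_dup_tree by (simp add: sz_def)
  have 2: "runs cf (single (?x @ ?x @ r)) (tf x) (single (?f @ ?x @ r))"
    using f by (simp add: computes_def)
  have 3: "runs swap_tree (single (?f @ ?x @ r)) (14 * (sz (f x) + sz x) + 11) (single (?x @ ?f @ r))"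
    using runs_swap_tree by (simp add: sz_def)
  have 4: "runs cg (single (?x @ ?f @ r)) (tg x) (single (?g @ ?f @ r))"
    using g by (simp add: computes_def)
  have 5: "runs swap_tree (single (?g @ ?f @ r)) (14 * (sz (g x) + sz (f x)) + 11) (single (?f @ ?g @ r))"
    using runs_swap_tree by (simp add: sz_def)
  have 6: "runs (Push R0 True) (single (?f @ ?g @ r)) 1 (single (code (enc (f x, g x)) @ r))"
    using runs_Push[of R0 True "single (?f @ ?g @ r)"] by (simp add: enc_prod_def single_regs)
  show "runs (dup_tree ;; cf ;; swap_tree ;; cg ;; swap_tree ;; Push R0 True) (single (?x @ r))
      (200 * (sz x + tf x + tg x)) (single (code (enc (f x, g x)) @ r))"
    using computes_sz[OF f, of x] computes_sz[OF g, of x] sz_pos[of x]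
    by (intro runs_mono[OF runs_Seq[OF 1 runs_Seq[OF 2 runs_Seq[OF 3 runs_Seq[OF 4 runs_Seq[OF 5 6]]]]]]) (auto simp del: sz_pos)
qed

lemma computes_comp:
  assumes f: "computes cf f tf" and g: "computes cg g tg"
  shows "computes (cf ;; cg) (\<lambda>x. g (f x)) (\<lambda>x. tf x + tg (f x) + 1)"
  using assms unfolding computes_def by (blast intro: runs_Seq)

lemma computes_const:
  fixes a :: "'b::enc"
  shows "computes (drop_tree ;; push_list (code (enc a))) (\<lambda>x::'a::enc. a) (\<lambda>x. 11 * sz x + 6 + 2 * sz a)"
  unfolding computes_def
proof (intro allI)
  fix x :: 'a and r
  show "runs (drop_tree ;; push_list (code (enc a))) (single (code (enc x) @ r))
      (11 * sz x + 6 + 2 * sz a) (single (code (enc a) @ r))"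
    by (rule runs_mono[OF runs_Seq[OF runs_drop_tree runs_push_list]]) (simp add: sz_def)
qed

lemma runs_Pop_single: "runs (Pop R0) (single (b # w)) 1 (single w)"
  using runs_Pop[of R0 "single (b # w)"] by (simp add: single_regs)

lemma runs_Push_single: "runs (Push R0 b) (single w) 1 (single (b # w))"
  using runs_Push[of R0 b "single w"] by (simp add: single_regs)

lemma computes_fst: "computes (Pop R0 ;; swap_tree ;; drop_tree) (fst :: 'a::enc \<times> 'b::enc \<Rightarrow> 'a) (\<lambda>x. 40 * sz x)"
  unfolding computes_def
proof (intro allI)
  fix x :: "'a \<times> 'b" and r
  let ?a = "code (enc (fst x))" and ?b = "code (enc (snd x))"
  have x: "code (enc x) = True # ?a @ ?b" by (simp add: enc_prod_def)
  have "runs (Pop R0 ;; swap_tree ;; drop_tree) (single (True # ?a @ ?b @ r))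
     (1 + ((14 * (length ?a + length ?b) + 11) + (11 * length ?b + 5) + 1) + 1) (single (?a @ r))"
    by (rule runs_Seq[OF runs_Pop_single runs_Seq[OF runs_swap_tree runs_drop_tree]])
  then show "runs (Pop R0 ;; swap_tree ;; drop_tree) (single (code (enc x) @ r)) (40 * sz x) (single (?a @ r))"
    by (auto simp: x sz_def elim!: runs_mono)
qed

lemma computes_snd: "computes (Pop R0 ;; drop_tree) (snd :: 'a::enc \<times> 'b::enc \<Rightarrow> 'b) (\<lambda>x. 40 * sz x)"
  unfolding computes_def
proof (intro allI)
  fix x :: "'a \<times> 'b" and r
  let ?a = "code (enc (fst x))" and ?b = "code (enc (snd x))"
  have x: "code (enc x) = True # ?a @ ?b" by (simp add: enc_prod_def)
  have "runs (Pop R0 ;; drop_tree) (single (True # ?a @ ?b @ r)) (1 + (11 * length ?a + 5) + 1) (single (?b @ r))"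
    by (rule runs_Seq[OF runs_Pop_single runs_drop_tree])
  then show "runs (Pop R0 ;; drop_tree) (single (code (enc x) @ r)) (40 * sz x) (single (?b @ r))"
    by (auto simp: x sz_def elim!: runs_mono)
qed

lemma top_of_enc_bool: "is_true (top_of (single (code (enc b) @ r) R0)) \<longleftrightarrow> b"
  by (simp add: enc_bool_def single_def)

lemma computes_if:
  fixes f g :: "'a::enc \<Rightarrow> 'b::enc"
  assumes b: "computes cb b tb" and f: "computes cf f tf" and g: "computes cg g tg"
  shows "computes (dup_tree ;; cb ;; Cond R0 is_true (drop_tree ;; cf) (drop_tree ;; cg))
    (\<lambda>x. if b x then f x else g x) (\<lambda>x. 200 * (sz x + tb x + tf x + tg x))"
  unfolding computes_def
proof (intro allI)
  fix x :: 'a and r :: "bool list"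
  let ?x = "code (enc x)"
  have 1: "runs dup_tree (single (?x @ r)) (30 * sz x + 10) (single (?x @ ?x @ r))"
    using runs_dup_tree by (simp add: sz_def)
  have 2: "runs cb (single (?x @ ?x @ r)) (tb x) (single (code (enc (b x)) @ ?x @ r))"
    using b by (simp add: computes_def)
  let ?h = "if b x then f x else g x"
  have 3: "runs (if b x then drop_tree ;; cf else drop_tree ;; cg) (single (code (enc (b x)) @ ?x @ r))
      ((11 * sz (b x) + 5) + (tf x + tg x) + 1) (single (code (enc ?h) @ r))"
  proof (cases "b x")
    case True
    have "runs (drop_tree ;; cf) (single (code (enc (b x)) @ ?x @ r))
        ((11 * sz (b x) + 5) + tf x + 1) (single (code (enc (f x)) @ r))"
      using f runs_drop_tree by (intro runs_Seq) (auto simp: computes_def sz_def)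
    then show ?thesis using True by (auto elim!: runs_mono)
  next
    case False
    have "runs (drop_tree ;; cg) (single (code (enc (b x)) @ ?x @ r))
        ((11 * sz (b x) + 5) + tg x + 1) (single (code (enc (g x)) @ r))"
      using g runs_drop_tree by (intro runs_Seq) (auto simp: computes_def sz_def)
    then show ?thesis using False by (auto elim!: runs_mono)
  qed
  have 4: "runs (Cond R0 is_true (drop_tree ;; cf) (drop_tree ;; cg)) (single (code (enc (b x)) @ ?x @ r))
      ((11 * sz (b x) + 5) + (tf x + tg x) + 1 + 1) (single (code (enc ?h) @ r))"
    using 3 by (intro runs_Cond) (simp only: top_of_enc_bool)
  show "runs (dup_tree ;; cb ;; Cond R0 is_true (drop_tree ;; cf) (drop_tree ;; cg)) (single (?x @ r))
      (200 * (sz x + tb x + tf x + tg x)) (single (code (enc ?h) @ r))"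
    using computes_sz[OF b, of x] sz_pos[of x]
    by (intro runs_mono[OF runs_Seq[OF 1 runs_Seq[OF 2 4]]]) (auto simp del: sz_pos)
qed

text \<open>The tree of a nonempty list is already the tree of the pair of its head and tail. A
  single \<open>True\<close> pushed above the argument and the list therefore forms the triple
  \<open>(x, y, ys)\<close>, and nothing has to be taken apart.\<close>

lemma computes_case_list:
  fixes l :: "'a::enc \<Rightarrow> 'b::enc list" and f :: "'a \<Rightarrow> 'c::enc"
  assumes l: "computes cl l td" and f: "computes cf f tf" and g: "computes cg g tg"
  shows "computes (dup_tree ;; cl ;; Cond R0 is_true (swap_tree ;; Push R0 True ;; cg) (drop_tree ;; cf))
    (\<lambda>x. case l x of [] \<Rightarrow> f x | y # ys \<Rightarrow> g (x, y, ys))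
    (\<lambda>x. 200 * (sz x + td x + tf x + (case l x of [] \<Rightarrow> 0 | y # ys \<Rightarrow> tg (x, y, ys))))"
  unfolding computes_def
proof (intro allI)
  fix x :: 'a and r :: "bool list"
  let ?x = "code (enc x)" and ?l = "code (enc (l x))"
  have 1: "runs dup_tree (single (?x @ r)) (30 * sz x + 10) (single (?x @ ?x @ r))"
    using runs_dup_tree by (simp add: sz_def)
  have 2: "runs cl (single (?x @ ?x @ r)) (td x) (single (?l @ ?x @ r))"
    using l by (simp add: computes_def)
  have top: "is_true (top_of (single (?l @ ?x @ r) R0)) \<longleftrightarrow> l x \<noteq> []"
    by (cases "l x") (auto simp: single_def)
  have l_sz: "sz (l x) \<le> sz x + td x" using computes_sz[OF l] .
  let ?h = "case l x of [] \<Rightarrow> f x | y # ys \<Rightarrow> g (x, y, ys)"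
  let ?tg = "case l x of [] \<Rightarrow> 0 | y # ys \<Rightarrow> tg (x, y, ys)"
  have 3: "runs (if l x \<noteq> [] then swap_tree ;; Push R0 True ;; cg else drop_tree ;; cf)
      (single (?l @ ?x @ r)) (14 * (sz (l x) + sz x) + 15 + tf x + ?tg) (single (code (enc ?h) @ r))"
  proof (cases "l x")
    case Nil
    have "runs (drop_tree ;; cf) (single (?l @ ?x @ r)) ((11 * sz (l x) + 5) + tf x + 1) (single (code (enc (f x)) @ r))"
      using f runs_drop_tree by (intro runs_Seq) (auto simp: computes_def sz_def)
    then show ?thesis using Nil by (auto elim!: runs_mono)
  next
    case (Cons y ys)
    have "code (enc (x, y, ys)) = True # ?x @ ?l"
      using Cons by (simp add: enc_prod_def)
    then have "runs cg (single (True # ?x @ ?l @ r)) (tg (x, y, ys)) (single (code (enc (g (x, y, ys))) @ r))"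
      using g unfolding computes_def by (metis append_Cons append_assoc)
    then have "runs (swap_tree ;; Push R0 True ;; cg) (single (?l @ ?x @ r))
       ((14 * (length ?l + length ?x) + 11) + (1 + tg (x, y, ys) + 1) + 1) (single (code (enc (g (x, y, ys))) @ r))"
      by (intro runs_Seq[OF runs_swap_tree] runs_Seq[OF runs_Push_single])
    then show ?thesis using Cons by (auto simp: sz_def elim!: runs_mono)
  qed
  have 4: "runs (Cond R0 is_true (swap_tree ;; Push R0 True ;; cg) (drop_tree ;; cf))
      (single (?l @ ?x @ r)) (14 * (sz (l x) + sz x) + 15 + tf x + ?tg + 1) (single (code (enc ?h) @ r))"
    using 3 by (intro runs_Cond) (simp only: top)
  show "runs (dup_tree ;; cl ;; Cond R0 is_true (swap_tree ;; Push R0 True ;; cg) (drop_tree ;; cf)) (single (?x @ r))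
      (200 * (sz x + td x + tf x + ?tg)) (single (code (enc ?h) @ r))"
    using l_sz sz_pos[of x]
    by (intro runs_mono[OF runs_Seq[OF 1 runs_Seq[OF 2 4]]]) (auto simp del: sz_pos)
qed

text \<open>The number \<open>N x\<close> of rounds is known to the proof only: the premises on
  \<open>b\<close> say that the test fails for the first time after \<open>N x\<close> iterations.
  Termination thus becomes an explicit function, which covers folds and unbounded search
  alike.\<close>

lemma computes_while:
  fixes f :: "'a::enc \<Rightarrow> 'a"
  assumes b: "computes cb b tb" and f: "computes cf f tf"
    and "\<And>x. \<not> b ((f ^^ N x) x)" and "\<And>x k. k < N x \<Longrightarrow> b ((f ^^ k) x)"
  shows "computes (dup_tree ;; cb ;; While R0 is_true (drop_tree ;; cf ;; dup_tree ;; cb) ;; drop_tree)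
    (\<lambda>x. (f ^^ N x) x) (\<lambda>x. \<Sum>k\<le>N x. 200 * (sz ((f ^^ k) x) + tb ((f ^^ k) x) + tf ((f ^^ k) x)))"
  unfolding computes_def
proof (intro allI)
  fix x :: 'a and r :: "bool list"
  let ?W = "While R0 is_true (drop_tree ;; cf ;; dup_tree ;; cb)"
  let ?t = "\<lambda>y. 100 * (sz y + tb y + tf y)"
  let ?s = "\<lambda>y. single (code (enc (b y)) @ code (enc y) @ r)"
  have test: "runs (dup_tree ;; cb) (single (code (enc y) @ r)) ((30 * sz y + 10) + tb y + 1) (?s y)" for y
    using b by (intro runs_Seq[of dup_tree, OF runs_dup_tree[of "enc y", folded sz_def]]) (simp add: computes_def)
  \<comment> \<open>The first test is made before the loop is entered, so inside the loop tests are
    charged to the iterates 1 to \<open>n\<close> and bodies to the iterates 0 to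
    \<open>n - 1\<close>.\<close>
  have loop: "runs ?W (?s y) (50 + (\<Sum>k\<in>{1..n}. ?t ((f ^^ k) y)) + (\<Sum>k<n. 60 + tf ((f ^^ k) y))) (?s ((f ^^ n) y))"
    if "\<not> b ((f ^^ n) y)" "\<And>k. k < n \<Longrightarrow> b ((f ^^ k) y)" for n y
    using that
  proof (induction n arbitrary: y)
    case 0
    then have "runs ?W (?s y) 1 (?s y)"
      by (intro runs_While_False) (simp only: top_of_enc_bool funpow_0 not_False_eq_True)
    then show ?case by (auto elim!: runs_mono)
  next
    case (Suc n)
    have bt: "b y" using Suc.prems(2)[of 0] by simp
    have F: "runs cf (single (code (enc y) @ r)) (tf y) (single (code (enc (f y)) @ r))"
      using f by (simp add: computes_def)
    have "runs (drop_tree ;; cf ;; dup_tree ;; cb) (?s y)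
        ((11 * length (code (enc (b y))) + 5) + (tf y + ((30 * sz (f y) + 10) + tb (f y) + 1) + 1) + 1) (?s (f y))"
      by (intro runs_Seq[of drop_tree, OF runs_drop_tree] runs_Seq[of cf, OF F] test)
    then have body: "runs (drop_tree ;; cf ;; dup_tree ;; cb) (?s y) (51 + tf y + ?t (f y)) (?s (f y))"
      using bt sz_pos[of "f y"] by (elim runs_mono) (simp add: enc_bool_def)
    have IH: "runs ?W (?s (f y)) (50 + (\<Sum>k\<in>{1..n}. ?t ((f ^^ k) (f y))) + (\<Sum>k<n. 60 + tf ((f ^^ k) (f y))))
        (?s ((f ^^ n) (f y)))"
      using Suc.prems(1) Suc.prems(2)[of "Suc _"] by (intro Suc.IH) (auto simp: funpow_Suc_right simp del: funpow.simps)
    have e1: "(\<Sum>k\<in>{1..Suc n}. ?t ((f ^^ k) y)) = ?t (f y) + (\<Sum>k\<in>{1..n}. ?t ((f ^^ k) (f y)))"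
    proof -
      have "(\<Sum>k\<in>{1..Suc n}. ?t ((f ^^ k) y)) = ?t ((f ^^ 1) y) + (\<Sum>k\<in>{Suc 1..Suc n}. ?t ((f ^^ k) y))"
        by (rule sum.atLeast_Suc_atMost) simp
      also have "(\<Sum>k\<in>{Suc 1..Suc n}. ?t ((f ^^ k) y)) = (\<Sum>k\<in>{1..n}. ?t ((f ^^ Suc k) y))"
        by (rule sum.shift_bounds_cl_Suc_ivl)
      finally show ?thesis by (simp add: funpow_Suc_right del: funpow.simps)
    qed
    have e2: "(\<Sum>k<Suc n. 60 + tf ((f ^^ k) y)) = 60 + tf y + (\<Sum>k<n. 60 + tf ((f ^^ k) (f y)))"
      by (subst sum.lessThan_Suc_shift) (simp add: funpow_Suc_right del: funpow.simps(2))
    have R: "runs ?W (?s y) ((51 + tf y + ?t (f y)) +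
        (50 + (\<Sum>k\<in>{1..n}. ?t ((f ^^ k) (f y))) + (\<Sum>k<n. 60 + tf ((f ^^ k) (f y)))) + 2) (?s ((f ^^ n) (f y)))"
      by (rule runs_While_True[OF _ body IH]) (simp only: top_of_enc_bool bt)
    have fs: "(f ^^ Suc n) y = (f ^^ n) (f y)" by (simp add: funpow_Suc_right del: funpow.simps)
    show ?case unfolding e1 e2 fs by (rule runs_mono[OF R]) simp
  qed
  let ?y = "(f ^^ N x) x"
  have 1: "runs dup_tree (single (code (enc x) @ r)) (30 * sz x + 10) (single (code (enc x) @ code (enc x) @ r))"
    using runs_dup_tree by (simp add: sz_def)
  have 2: "runs cb (single (code (enc x) @ code (enc x) @ r)) (tb x) (?s x)"
    using b by (simp add: computes_def)
  have 3: "runs drop_tree (?s ?y) 16 (single (code (enc ?y) @ r))"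
    using runs_drop_tree[of "enc (b ?y)" "code (enc ?y) @ r"] assms(3) by (simp add: enc_bool_def)
  have "(\<Sum>k<N x. 60 + tf ((f ^^ k) x)) \<le> (\<Sum>k<N x. ?t ((f ^^ k) x))"
  proof (rule sum_mono)
    show "60 + tf ((f ^^ k) x) \<le> ?t ((f ^^ k) x)" for k
      using sz_pos[of "(f ^^ k) x"] by (auto simp del: sz_pos)
  qed
  moreover have "(\<Sum>k\<le>N x. ?t ((f ^^ k) x)) = (\<Sum>k<N x. ?t ((f ^^ k) x)) + ?t ?y"
    by (simp add: lessThan_Suc_atMost[symmetric])
  moreover have "(\<Sum>k\<le>N x. ?t ((f ^^ k) x)) = ?t x + (\<Sum>k\<in>{1..N x}. ?t ((f ^^ k) x))"
    unfolding atMost_atLeast0 by (subst sum.atLeast_Suc_atMost) simp_all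
  moreover have "(\<Sum>k\<le>N x. 200 * (sz ((f ^^ k) x) + tb ((f ^^ k) x) + tf ((f ^^ k) x))) =
      (\<Sum>k\<le>N x. ?t ((f ^^ k) x)) + (\<Sum>k\<le>N x. ?t ((f ^^ k) x))"
    unfolding sum.distrib[symmetric] by (intro sum.cong) auto
  moreover have "0 < sz x" "0 < sz ?y" by simp_all
  ultimately have "(30 * sz x + 10) + (tb x + ((50 + (\<Sum>k\<in>{1..N x}. ?t ((f ^^ k) x)) +
      (\<Sum>k<N x. 60 + tf ((f ^^ k) x))) + 16 + 1) + 1) + 1 \<le>
      (\<Sum>k\<le>N x. 200 * (sz ((f ^^ k) x) + tb ((f ^^ k) x) + tf ((f ^^ k) x)))"
    by (auto simp del: sz_pos)
  then show "runs (dup_tree ;; cb ;; ?W ;; drop_tree) (single (code (enc x) @ r))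
      (\<Sum>k\<le>N x. 200 * (sz ((f ^^ k) x) + tb ((f ^^ k) x) + tf ((f ^^ k) x)))
      (single (code (enc ?y) @ r))"
    using assms(3,4)
    by (intro runs_mono[OF runs_Seq[OF 1 runs_Seq[OF 2 runs_Seq[OF loop 3]]]])
qed


section \<open>Closure properties of feasible functions\<close>

definition polybounded :: "('a::enc \<Rightarrow> nat) \<Rightarrow> bool" where
  "polybounded t \<longleftrightarrow> (\<exists>p :: nat poly. \<forall>x. t x \<le> poly p (sz x))"

lemma poly_nat_mono: "x \<le> y \<Longrightarrow> poly (p :: nat poly) x \<le> poly p y"
  by (induction p) (auto intro!: add_mono mult_mono)

lemma polybounded_mono: "polybounded t \<Longrightarrow> (\<And>x. t' x \<le> t x) \<Longrightarrow> polybounded t'"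
  unfolding polybounded_def using le_trans by blast

lemma polybounded_const: "polybounded (\<lambda>x. n)"
  unfolding polybounded_def by (rule exI[of _ "[:n:]"]) simp

lemma polybounded_sz: "polybounded sz"
  unfolding polybounded_def by (rule exI[of _ "[:0, 1:]"]) simp

lemma polybounded_add: "polybounded t \<Longrightarrow> polybounded u \<Longrightarrow> polybounded (\<lambda>x. t x + u x)"
proof -
  assume "polybounded t" "polybounded u"
  then obtain p q where "\<And>x. t x \<le> poly p (sz x)" "\<And>x. u x \<le> poly q (sz x)"
    unfolding polybounded_def by blast
  then show ?thesis
    unfolding polybounded_def by (intro exI[of _ "p + q"]) (simp add: add_mono)
qed

lemma polybounded_mult: "polybounded t \<Longrightarrow> polybounded u \<Longrightarrow> polybounded (\<lambda>x. t x * u x)"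
proof -
  assume "polybounded t" "polybounded u"
  then obtain p q where "\<And>x. t x \<le> poly p (sz x)" "\<And>x. u x \<le> poly q (sz x)"
    unfolding polybounded_def by blast
  then show ?thesis
    unfolding polybounded_def by (intro exI[of _ "p * q"]) (simp add: mult_le_mono)
qed

lemma polybounded_comp:
  assumes "polybounded t" "polybounded u" "\<And>x. sz (f x) \<le> u x"
  shows "polybounded (\<lambda>x. t (f x))"
proof -
  obtain p q where p: "\<And>x. t x \<le> poly p (sz x)" and q: "\<And>x. u x \<le> poly q (sz x)"
    using assms(1,2) unfolding polybounded_def by blast
  have "t (f x) \<le> poly (pcompose p q) (sz x)" for x
  proof -
    have "t (f x) \<le> poly p (sz (f x))" by (rule p)
    also have "\<dots> \<le> poly p (poly q (sz x))"
      using assms(3)[of x] q[of x] by (intro poly_nat_mono) simp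
    finally show ?thesis by (simp add: poly_pcompose)
  qed
  then show ?thesis unfolding polybounded_def by blast
qed

lemmas polybounded_intros =
  polybounded_const polybounded_sz polybounded_add polybounded_mult

text \<open>The flag lets one set of closure rules serve both polynomial time and mere computability.\<close>

definition feasible :: "bool \<Rightarrow> ('a::enc \<Rightarrow> 'b::enc) \<Rightarrow> bool" where
  "feasible P f \<longleftrightarrow> (\<exists>c t. computes c f t \<and> (P \<longrightarrow> polybounded t))"

lemma feasible_polybounded_sz:
  assumes "feasible True f" shows "polybounded (\<lambda>x. sz (f x))"
proof -
  obtain c t where c: "computes c f t" "polybounded t" using assms by (auto simp: feasible_def)
  show ?thesis
    by (rule polybounded_mono[OF polybounded_add[OF polybounded_sz c(2)]]) (rule computes_sz[OF c(1)])
qed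

text \<open>Only the trees matter, so functions with equal encodings share a program. Consing is
  thereby pairing, the successor is pairing with a unit, and numbers are lists of units.\<close>

lemma feasible_enc:
  assumes "feasible P f" "\<And>x. enc (g x) = enc (f x)"
  shows "feasible P g"
  using assms unfolding feasible_def computes_def by simp

lemma feasible_id: "feasible P (\<lambda>x. x)"
proof -
  have "computes Skip (\<lambda>x::'a. x) (\<lambda>_. 0)" by (simp add: computes_def runs_Skip)
  then show ?thesis unfolding feasible_def using polybounded_const by blast
qed

lemma feasible_const: "feasible P (\<lambda>x::'a::enc. a)"
proof -
  have "polybounded (\<lambda>x::'a. 11 * sz x + 6 + 2 * sz a)" by (intro polybounded_intros)
  then show ?thesis unfolding feasible_def using computes_const by blast
qed

lemma feasible_comp:
  assumes f: "feasible P f" and g: "feasible P g"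
  shows "feasible P (\<lambda>x. g (f x))"
proof -
  obtain c t d u where c: "computes c f t" "P \<longrightarrow> polybounded t" and d: "computes d g u" "P \<longrightarrow> polybounded u"
    using assms by (auto simp: feasible_def)
  have "polybounded (\<lambda>x. t x + u (f x) + 1)" if P
  proof -
    have "polybounded t" "polybounded u" using c d that by auto
    moreover have "polybounded (\<lambda>x. u (f x))"
      by (rule polybounded_comp[OF calculation(2) polybounded_add[OF polybounded_sz calculation(1)]])
        (rule computes_sz[OF c(1)])
    ultimately show ?thesis by (intro polybounded_intros)
  qed
  then show ?thesis
    using computes_comp[OF c(1) d(1)] unfolding feasible_def by blast
qed

lemma feasible_Pair:
  assumes "feasible P f" "feasible P g"
  shows "feasible P (\<lambda>x. (f x, g x))"
proof -
  obtain c t d u where c: "computes c f t" "P \<longrightarrow> polybounded t" and d: "computes d g u" "P \<longrightarrow> polybounded u"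
    using assms by (auto simp: feasible_def)
  have "polybounded (\<lambda>x. 200 * (sz x + t x + u x))" if P
    using c d that by (intro polybounded_intros) auto
  then show ?thesis
    using computes_pair[OF c(1) d(1)] unfolding feasible_def by blast
qed

lemma feasible_fst: "feasible P f \<Longrightarrow> feasible P (\<lambda>x. fst (f x))"
  by (rule feasible_comp[of P f fst])
    (use computes_fst polybounded_mult[OF polybounded_const polybounded_sz] in \<open>auto simp: feasible_def\<close>)

lemma feasible_snd: "feasible P f \<Longrightarrow> feasible P (\<lambda>x. snd (f x))"
  by (rule feasible_comp[of P f snd])
    (use computes_snd polybounded_mult[OF polybounded_const polybounded_sz] in \<open>auto simp: feasible_def\<close>)

lemma feasible_if:
  assumes "feasible P b" "feasible P f" "feasible P g"
  shows "feasible P (\<lambda>x. if b x then f x else g x)"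
proof -
  obtain cb tb c t d u where b: "computes cb b tb" "P \<longrightarrow> polybounded tb"
    and c: "computes c f t" "P \<longrightarrow> polybounded t" and d: "computes d g u" "P \<longrightarrow> polybounded u"
    using assms by (auto simp: feasible_def)
  have "polybounded (\<lambda>x. 200 * (sz x + tb x + t x + u x))" if P
    using b c d that by (intro polybounded_intros) auto
  then show ?thesis
    using computes_if[OF b(1) c(1) d(1)] unfolding feasible_def by blast
qed

lemma feasible_case_list:
  fixes l :: "'a::enc \<Rightarrow> 'b::enc list"
  assumes "feasible P l" "feasible P f"
    and "feasible P (\<lambda>z. g (fst z) (fst (snd z)) (snd (snd z)))"
  shows "feasible P (\<lambda>x. case l x of [] \<Rightarrow> f x | y # ys \<Rightarrow> g x y ys)"
proof -
  let ?g = "\<lambda>z. g (fst z) (fst (snd z)) (snd (snd z))"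
  obtain cl tl c t d u where l: "computes cl l tl" "P \<longrightarrow> polybounded tl"
    and c: "computes c f t" "P \<longrightarrow> polybounded t" and d: "computes d ?g u" "P \<longrightarrow> polybounded u"
    using assms by (auto simp: feasible_def)
  let ?u = "\<lambda>x. case l x of [] \<Rightarrow> 0 | y # ys \<Rightarrow> u (x, y, ys)"
  have "polybounded (\<lambda>x. 200 * (sz x + tl x + t x + ?u x))" if P
  proof -
    have p: "polybounded tl" "polybounded t" "polybounded u" using l c d that by auto
    then obtain p where p': "\<And>z. u z \<le> poly p (sz z)" unfolding polybounded_def by blast
    have le: "?u x \<le> poly p (2 * sz x + tl x + 2)" for x
    proof (cases "l x")
      case (Cons y ys)
      have "u (x, y, ys) \<le> poly p (sz (x, y, ys))" by (rule p')
      also have "\<dots> \<le> poly p (2 * sz x + tl x + 2)"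
        using computes_sz[OF l(1), of x] Cons by (intro poly_nat_mono) simp
      finally show ?thesis using Cons by simp
    qed simp
    have "polybounded (\<lambda>x. poly p (2 * sz x + tl x + 2))"
    proof -
      have "polybounded (\<lambda>x. 2 * sz x + tl x + 2)" using p by (intro polybounded_intros)
      then obtain q where q: "\<And>x. 2 * sz x + tl x + 2 \<le> poly q (sz x)" by (auto simp: polybounded_def)
      have "poly p (2 * sz x + tl x + 2) \<le> poly (pcompose p q) (sz x)" for x
        using poly_nat_mono[OF q[of x]] by (simp add: poly_pcompose)
      then show ?thesis unfolding polybounded_def by blast
    qed
    then have "polybounded ?u" by (rule polybounded_mono) (rule le)
    then show ?thesis using p by (intro polybounded_intros)
  qed
  moreover have "computes (dup_tree ;; cl ;; Cond R0 is_true (swap_tree ;; Push R0 True ;; d) (drop_tree ;; c))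
    (\<lambda>x. case l x of [] \<Rightarrow> f x | y # ys \<Rightarrow> g x y ys) (\<lambda>x. 200 * (sz x + tl x + t x + ?u x))"
    using computes_case_list[OF l(1) c(1) d(1)] by (simp only: fst_conv snd_conv)
  ultimately show ?thesis unfolding feasible_def by blast
qed

lemma sz_take: "sz (take k xs) \<le> sz xs"
proof (induction xs arbitrary: k)
  case (Cons x xs)
  show ?case using Cons[of "k - 1"] by (cases k) auto
qed simp

lemma sz_drop: "sz (drop k xs) \<le> sz xs"
proof (induction xs arbitrary: k)
  case (Cons x xs)
  show ?case using Cons[of "k - 1"] by (cases k) auto
qed simp

lemma length_le_sz: "length xs \<le> sz xs"
  by (induction xs) auto

text \<open>A fold is a loop on triples of parameter, remaining list and accumulator. Polynomial
  time of the single step is not enough, as repeated doubling shows; the premise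
  \<open>bound\<close> controls every intermediate accumulator.\<close>

lemma feasible_foldl:
  fixes F :: "'c::enc \<Rightarrow> 'b::enc \<Rightarrow> 'a::enc \<Rightarrow> 'b"
  assumes F: "feasible P (\<lambda>z. F (fst z) (fst (snd z)) (snd (snd z)))"
    and h: "feasible P h" and g: "feasible P g"
    and bound: "P \<Longrightarrow> polybounded q"
      "\<And>c k. P \<Longrightarrow> sz (foldl (F c) (h c) (take k (g c))) \<le> q c"
  shows "feasible P (\<lambda>c. foldl (F c) (h c) (g c))"
proof -
  define stp where "stp = (\<lambda>s :: 'c \<times> 'a list \<times> 'b. case fst (snd s) of [] \<Rightarrow> s
    | y # ys \<Rightarrow> (fst s, ys, F (fst s) (snd (snd s)) y))"
  define N where "N = (\<lambda>s :: 'c \<times> 'a list \<times> 'b. length (fst (snd s)))"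
  have "feasible P stp"
  proof -
    have "feasible P (\<lambda>z :: ('c \<times> 'a list \<times> 'b) \<times> 'a \<times> 'a list.
        (\<lambda>w. F (fst w) (fst (snd w)) (snd (snd w))) (fst (fst z), snd (snd (fst z)), fst (snd z)))"
      by (rule feasible_comp[OF _ F]) (intro feasible_Pair feasible_fst feasible_snd feasible_id)
    then show ?thesis
      unfolding stp_def
      by (intro feasible_case_list feasible_Pair feasible_fst feasible_snd feasible_id) simp
  qed
  then obtain cs ts where s: "computes cs stp ts" "P \<longrightarrow> polybounded ts" by (auto simp: feasible_def)
  have "feasible P (\<lambda>s :: 'c \<times> 'a list \<times> 'b. case fst (snd s) of [] \<Rightarrow> False | y # ys \<Rightarrow> True)"
    by (intro feasible_case_list feasible_fst feasible_snd feasible_id feasible_const)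
  then have "feasible P (\<lambda>s :: 'c \<times> 'a list \<times> 'b. fst (snd s) \<noteq> [])"
    by (rule feasible_enc) (auto split: list.split)
  then obtain cb tb where b: "computes cb (\<lambda>s :: 'c \<times> 'a list \<times> 'b. fst (snd s) \<noteq> []) tb" "P \<longrightarrow> polybounded tb"
    by (auto simp: feasible_def)
  \<comment> \<open>On an exhausted list \<open>stp\<close> is the identity, so the closed form
    holds for all \<open>k\<close>.\<close>
  have iter: "(stp ^^ k) (c, xs, a) = (c, drop k xs, foldl (F c) a (take k xs))" for k c xs a
  proof (induction k arbitrary: xs a)
    case (Suc k)
    have "(stp ^^ Suc k) (c, xs, a) = (stp ^^ k) (stp (c, xs, a))"
      by (simp add: funpow_Suc_right del: funpow.simps)
    then show ?case using Suc by (cases xs) (auto simp: stp_def)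
  qed simp
  have W: "computes (dup_tree ;; cb ;; While R0 is_true (drop_tree ;; cs ;; dup_tree ;; cb) ;; drop_tree)
    (\<lambda>s. (stp ^^ N s) s) (\<lambda>s. \<Sum>k\<le>N s. 200 * (sz ((stp ^^ k) s) + tb ((stp ^^ k) s) + ts ((stp ^^ k) s)))"
    by (rule computes_while[OF b(1) s(1)]) (auto simp: iter N_def)
  have "feasible P (\<lambda>c. (c, g c, h c))"
    using g h by (intro feasible_Pair feasible_id)
  then obtain ci ti where i: "computes ci (\<lambda>c. (c, g c, h c)) ti" "P \<longrightarrow> polybounded ti"
    by (auto simp: feasible_def)
  define T where "T = (\<lambda>s. \<Sum>k\<le>N s. 200 * (sz ((stp ^^ k) s) + tb ((stp ^^ k) s) + ts ((stp ^^ k) s)))"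
  have comp: "computes (ci ;; (dup_tree ;; cb ;; While R0 is_true (drop_tree ;; cs ;; dup_tree ;; cb) ;; drop_tree))
    (\<lambda>c. (c, [] :: 'a list, foldl (F c) (h c) (g c))) (\<lambda>c. ti c + T (c, g c, h c) + 1)"
  proof -
    have "(\<lambda>c. (stp ^^ N (c, g c, h c)) (c, g c, h c)) = (\<lambda>c. (c, [] :: 'a list, foldl (F c) (h c) (g c)))"
      by (simp add: iter N_def)
    then show ?thesis using computes_comp[OF i(1) W[folded T_def]] by simp
  qed
  have "polybounded (\<lambda>c. ti c + T (c, g c, h c) + 1)" if P
  proof -
    have "feasible True g" using g that by simp
    then have pg: "polybounded (\<lambda>c. sz (g c))" by (rule feasible_polybounded_sz)
    define u where "u = (\<lambda>c. sz c + sz (g c) + q c + 2)"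
    have u: "polybounded u" unfolding u_def using pg bound(1) that by (intro polybounded_intros)
    then obtain pu where pu: "\<And>c. u c \<le> poly pu (sz c)" by (auto simp: polybounded_def)
    obtain pb where pb: "\<And>z. tb z \<le> poly pb (sz z)" using b(2) \<open>P\<close> unfolding polybounded_def by blast
    obtain ps where ps: "\<And>z. ts z \<le> poly ps (sz z)" using s(2) \<open>P\<close> unfolding polybounded_def by blast
    have le: "T (c, g c, h c) \<le> (sz (g c) + 1) * (200 * (poly pu (sz c) + poly (pcompose pb pu) (sz c) + poly (pcompose ps pu) (sz c)))"
      for c
    proof -
      let ?s = "(c, g c, h c)"
      have le: "sz ((stp ^^ k) ?s) \<le> poly pu (sz c)" for k
        using bound(2)[of c k] that sz_drop[of k "g c"] pu[of c] by (simp add: iter u_def)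
      have "tb ((stp ^^ k) ?s) \<le> poly pb (poly pu (sz c))" for k
        using pb[of "(stp ^^ k) ?s"] poly_nat_mono[OF le[of k], of pb] by simp
      moreover have "ts ((stp ^^ k) ?s) \<le> poly ps (poly pu (sz c))" for k
        using ps[of "(stp ^^ k) ?s"] poly_nat_mono[OF le[of k], of ps] by simp
      ultimately have "T ?s \<le> (\<Sum>k\<le>N ?s. 200 * (poly pu (sz c) + poly pb (poly pu (sz c)) + poly ps (poly pu (sz c))))"
        unfolding T_def using le by (intro sum_mono mult_le_mono add_mono) auto
      also have "\<dots> \<le> (sz (g c) + 1) * (200 * (poly pu (sz c) + poly pb (poly pu (sz c)) + poly ps (poly pu (sz c))))"
        using length_le_sz[of "g c"] by (simp add: N_def)
      finally show ?thesis by (simp add: poly_pcompose)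
    qed
    have "polybounded (\<lambda>c. (sz (g c) + 1) * (200 * (poly pu (sz c) + poly (pcompose pb pu) (sz c) + poly (pcompose ps pu) (sz c))))"
    proof -
      have "polybounded (\<lambda>c. poly p (sz c))" for p :: "nat poly" unfolding polybounded_def by blast
      then show ?thesis using pg by (intro polybounded_intros)
    qed
    then have "polybounded (\<lambda>c. T (c, g c, h c))" by (rule polybounded_mono) (rule le)
    then show ?thesis using i that by (intro polybounded_intros) auto
  qed
  with comp have "feasible P (\<lambda>c. (c, [] :: 'a list, foldl (F c) (h c) (g c)))"
    unfolding feasible_def by blast
  then have "feasible P (\<lambda>c. snd (snd (c, [] :: 'a list, foldl (F c) (h c) (g c))))"
    by (intro feasible_snd)
  then show ?thesis by simp
qed

lemma feasible_foldl_unbounded: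
  assumes "feasible False (\<lambda>z. F (fst z) (fst (snd z)) (snd (snd z)))"
    and "feasible False h" and "feasible False g"
  shows "feasible False (\<lambda>c. foldl (F c) (h c) (g c))"
  using assms by (rule feasible_foldl[where q = "\<lambda>_. 0"]) auto

text \<open>If a step adds an amount that depends only on the parameter and the list element, and
  not on the accumulator, then the total growth is at most the length of the list times a
  polynomial.\<close>

lemma feasible_foldl_bounded:
  fixes F :: "'c::enc \<Rightarrow> 'b::enc \<Rightarrow> 'a::enc \<Rightarrow> 'b"
  assumes F: "feasible P (\<lambda>z. F (fst z) (fst (snd z)) (snd (snd z)))"
    and h: "feasible P h" and g: "feasible P g"
    and bound: "P \<Longrightarrow> polybounded q" "\<And>c a y. P \<Longrightarrow> sz (F c a y) \<le> sz a + q (c, y)"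
  shows "feasible P (\<lambda>c. foldl (F c) (h c) (g c))"
proof (cases P)
  case False
  then show ?thesis using F h g feasible_foldl_unbounded by simp
next
  case True
  then obtain p where p: "\<And>z. q z \<le> poly p (sz z)" using bound(1) unfolding polybounded_def by blast
  have step: "sz (foldl (F c) a ys) \<le> sz a + length ys * poly p (sz c + sz ys + 1)" for c a ys
  proof (induction ys arbitrary: a)
    case (Cons y ys)
    let ?p = "poly p (sz c + sz (y # ys) + 1)"
    have "sz (foldl (F c) a (y # ys)) \<le> sz (F c a y) + length ys * poly p (sz c + sz ys + 1)"
      using Cons by simp
    also have "\<dots> \<le> sz a + poly p (sz c + sz y + 1) + length ys * poly p (sz c + sz ys + 1)"
      using bound(2)[OF True, of c a y] p[of "(c, y)"] by simp
    also have "poly p (sz c + sz y + 1) \<le> ?p" by (intro poly_nat_mono) simp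
    also have "poly p (sz c + sz ys + 1) \<le> ?p" by (intro poly_nat_mono) simp
    finally show ?case by simp
  qed simp
  let ?q = "\<lambda>c. sz (h c) + sz (g c) * poly p (sz c + sz (g c) + 1)"
  show ?thesis
  proof (rule feasible_foldl[OF F h g, of ?q])
    have pg: "polybounded (\<lambda>c. sz (g c))" "polybounded (\<lambda>c. sz (h c))"
      using g h True by (auto intro: feasible_polybounded_sz)
    have "polybounded (\<lambda>c. sz c + sz (g c) + 1)" using pg by (intro polybounded_intros)
    then obtain r where r: "\<And>c. sz c + sz (g c) + 1 \<le> poly r (sz c)" by (auto simp: polybounded_def)
    have "poly p (sz c + sz (g c) + 1) \<le> poly (pcompose p r) (sz c)" for c
      using poly_nat_mono[OF r[of c]] by (simp add: poly_pcompose)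
    then have "polybounded (\<lambda>c. poly p (sz c + sz (g c) + 1))" unfolding polybounded_def by blast
    then show "polybounded ?q" using pg by (intro polybounded_intros)
    fix c k
    have "sz (foldl (F c) (h c) (take k (g c))) \<le> sz (h c) + length (take k (g c)) * poly p (sz c + sz (take k (g c)) + 1)"
      by (rule step)
    also have "\<dots> \<le> ?q c"
      using sz_take[of k "g c"] length_le_sz[of "take k (g c)"]
      by (intro add_mono mult_le_mono poly_nat_mono le_refl) (auto intro: le_trans[OF _ length_le_sz])
    finally show "sz (foldl (F c) (h c) (take k (g c))) \<le> ?q c" .
  qed
qed

section \<open>Feasible operations on Booleans, lists and unary numbers\<close>

lemma feasible_Cons: "feasible P f \<Longrightarrow> feasible P g \<Longrightarrow> feasible P (\<lambda>x. f x # g x)"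
  by (rule feasible_enc[OF feasible_Pair[of P f g]]) (auto simp: enc_prod_def)

lemma feasible_Not: "feasible P b \<Longrightarrow> feasible P (\<lambda>x. \<not> b x)"
  by (rule feasible_enc[OF feasible_if[OF _ feasible_const[of P False] feasible_const[of P True]]]) auto

lemma feasible_conj: "feasible P a \<Longrightarrow> feasible P b \<Longrightarrow> feasible P (\<lambda>x. a x \<and> b x)"
  by (rule feasible_enc[OF feasible_if[of P a b "\<lambda>_. False"]]) (auto intro: feasible_const)

lemma feasible_disj: "feasible P a \<Longrightarrow> feasible P b \<Longrightarrow> feasible P (\<lambda>x. a x \<or> b x)"
  using feasible_Not[OF feasible_conj[OF feasible_Not feasible_Not]] by fastforce

lemma feasible_bool_eq: "feasible P a \<Longrightarrow> feasible P b \<Longrightarrow> feasible P (\<lambda>x. a x = (b x :: bool))"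
  by (rule feasible_enc[OF feasible_if[of P a b "\<lambda>x. \<not> b x"]]) (auto intro: feasible_Not)

lemma foldl_map_Cons: "foldl (\<lambda>a y. h y # a) zs xs = rev (map h xs) @ zs"
  by (induction xs arbitrary: zs) auto

lemma foldl_Cons: "foldl (\<lambda>a y. y # a) zs xs = rev xs @ zs"
  by (induction xs arbitrary: zs) auto

lemma foldl_concat: "foldl (@) zs xs = zs @ concat xs"
  by (induction xs arbitrary: zs) auto

lemma feasible_rev: "feasible P f \<Longrightarrow> feasible P (\<lambda>x. rev (f x))"
proof -
  assume f: "feasible P f"
  have "feasible P (\<lambda>x. foldl (\<lambda>a y. y # a) [] (f x))"
    using f by (intro feasible_foldl_bounded[where q = "\<lambda>z. sz (snd z) + 1"] feasible_Cons feasible_fst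
      feasible_snd feasible_id feasible_const polybounded_intros feasible_polybounded_sz) auto
  then show ?thesis by (simp add: foldl_Cons)
qed

lemma feasible_append: "feasible P f \<Longrightarrow> feasible P g \<Longrightarrow> feasible P (\<lambda>x. f x @ g x)"
proof -
  assume f: "feasible P f" and g: "feasible P g"
  have "feasible P (\<lambda>x. foldl (\<lambda>a y. y # a) (g x) (rev (f x)))"
    using f g by (intro feasible_foldl_bounded[where q = "\<lambda>z. sz (snd z) + 1"] feasible_Cons feasible_fst
      feasible_snd feasible_id feasible_rev polybounded_intros feasible_polybounded_sz) auto
  then show ?thesis by (simp add: foldl_Cons)
qed

lemma feasible_map:
  assumes f: "feasible P (\<lambda>z. f (fst z) (snd z))" and g: "feasible P g"
  shows "feasible P (\<lambda>x. map (f x) (g x))"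
proof -
  have f': "feasible P (\<lambda>z. f (fst z) (snd (snd z)))"
    using feasible_comp[OF _ f, of "\<lambda>z. (fst z, snd (snd z))"]
    by (simp add: feasible_Pair feasible_fst feasible_snd feasible_id)
  have "feasible P (\<lambda>x. foldl (\<lambda>a y. f x y # a) [] (g x))"
    using f' f g by (intro feasible_foldl_bounded[where q = "\<lambda>z. sz (f (fst z) (snd z)) + 1"] feasible_Cons
      feasible_fst feasible_snd feasible_id feasible_const polybounded_intros feasible_polybounded_sz) auto
  from feasible_rev[OF this] show ?thesis by (simp add: foldl_map_Cons)
qed

lemma sz_append: "sz (xs @ ys) + 1 = sz xs + sz ys"
  by (induction xs) auto

text \<open>The projection \<open>snd (c, ys)\<close> gives the inequality the shape of the growth
  premise of \<open>feasible_foldl_bounded\<close>.\<close>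

lemma sz_append_le: "sz (xs @ ys) \<le> sz xs + sz (snd (c, ys))"
  using sz_append[of xs ys] by simp

lemma feasible_concat: "feasible P f \<Longrightarrow> feasible P (\<lambda>x. concat (f x))"
proof -
  assume f: "feasible P f"
  have "feasible P (\<lambda>x. foldl (@) [] (f x))"
    using f by (intro feasible_foldl_bounded[where q = "\<lambda>z. sz (snd z)"] feasible_append
      feasible_fst feasible_snd feasible_id feasible_const feasible_polybounded_sz sz_append_le)
  then show ?thesis by (simp add: foldl_concat)
qed

lemma enc_replicate_unit: "enc (replicate n ()) = enc n"
  by (induction n) (auto simp: enc_unit_def)

lemma feasible_replicate_unit: "feasible P f \<Longrightarrow> feasible P (\<lambda>x. replicate (f x) ())"
  by (rule feasible_enc[of P f]) (simp_all add: enc_replicate_unit)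

lemma feasible_length: "feasible P f \<Longrightarrow> feasible P (\<lambda>x. length (f x))"
proof -
  assume "feasible P f"
  then have "feasible P (\<lambda>x. map (\<lambda>y. ()) (f x))"
    by (intro feasible_map feasible_const)
  then show ?thesis
    by (rule feasible_enc) (simp add: map_replicate_const enc_replicate_unit)
qed

lemma feasible_replicate: "feasible P f \<Longrightarrow> feasible P g \<Longrightarrow> feasible P (\<lambda>x. replicate (f x) (g x))"
proof -
  assume f: "feasible P f" and g: "feasible P g"
  have "feasible P (\<lambda>z. g (fst z))"
    by (rule feasible_comp[OF feasible_fst[OF feasible_id] g])
  then have "feasible P (\<lambda>x. map (\<lambda>y. g x) (replicate (f x) ()))"
    using f by (intro feasible_map feasible_replicate_unit)
  then show ?thesis by simp
qed

lemma feasible_Suc: "feasible P f \<Longrightarrow> feasible P (\<lambda>x. Suc (f x))"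
  by (rule feasible_enc[OF feasible_Pair[of P "\<lambda>_. ()" f]]) (auto simp: enc_prod_def enc_unit_def feasible_const)

lemma feasible_add: "feasible P f \<Longrightarrow> feasible P g \<Longrightarrow> feasible P (\<lambda>x. f x + (g x :: nat))"
  by (rule feasible_enc[OF feasible_append[OF feasible_replicate_unit feasible_replicate_unit, of P f g]])
    (simp_all add: enc_replicate_unit replicate_add[symmetric])

lemma feasible_mult: "feasible P f \<Longrightarrow> feasible P g \<Longrightarrow> feasible P (\<lambda>x. f x * (g x :: nat))"
proof -
  assume f: "feasible P f" and g: "feasible P g"
  have *: "concat (replicate m (replicate n ())) = replicate (m * n) ()" for m n
    by (induction m) (auto simp: replicate_add)
  have "feasible P (\<lambda>x. concat (replicate (f x) (replicate (g x) ())))"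
    using f g by (intro feasible_concat feasible_replicate feasible_const)
  then show ?thesis
    by (rule feasible_enc) (simp add: * enc_replicate_unit)
qed

lemma feasible_tl: "feasible P f \<Longrightarrow> feasible P (\<lambda>x. tl (f x))"
proof -
  assume "feasible P f"
  then have "feasible P (\<lambda>x. case f x of [] \<Rightarrow> [] | y # ys \<Rightarrow> ys)"
    by (intro feasible_case_list feasible_const feasible_snd feasible_id)
  then show ?thesis by (rule feasible_enc) (simp split: list.split)
qed

text \<open>Unary subtraction takes tails; truncation at 0 is the convention
  \<open>tl [] = []\<close>.\<close>

lemma feasible_diff: "feasible P f \<Longrightarrow> feasible P g \<Longrightarrow> feasible P (\<lambda>x. f x - (g x :: nat))"
proof -
  assume f: "feasible P f" and g: "feasible P g"
  have *: "foldl (\<lambda>a y. tl a) (replicate m ()) us = replicate (m - length us) ()" for m and us :: "unit list"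
  proof (induction us arbitrary: m)
    case (Cons u us)
    have "tl (replicate m ()) = replicate (m - 1) ()" by (cases m) auto
    then show ?case using Cons[of "m - 1"] by simp
  qed simp
  have "sz (tl a) \<le> sz a + 0" for a :: "unit list" by (cases a) auto
  then have "feasible P (\<lambda>x. foldl (\<lambda>a y. tl a) (replicate (f x) ()) (replicate (g x) ()))"
    using f g by (intro feasible_foldl_bounded[where q = "\<lambda>z. 0"] feasible_tl feasible_replicate_unit
      feasible_fst feasible_snd feasible_id polybounded_intros) auto
  then show ?thesis by (rule feasible_enc) (simp add: * enc_replicate_unit)
qed

lemma feasible_is_Nil: "feasible P f \<Longrightarrow> feasible P (\<lambda>x. f x = [])"
proof -
  assume "feasible P f"
  then have "feasible P (\<lambda>x. case f x of [] \<Rightarrow> True | y # ys \<Rightarrow> False)"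
    by (intro feasible_case_list feasible_const)
  then show ?thesis by (rule feasible_enc) (simp split: list.split)
qed

lemma feasible_eq0: "feasible P f \<Longrightarrow> feasible P (\<lambda>x. f x = (0 :: nat))"
  using feasible_is_Nil[OF feasible_replicate_unit[of P f]] by simp

lemma feasible_nat_le: "feasible P f \<Longrightarrow> feasible P g \<Longrightarrow> feasible P (\<lambda>x. f x \<le> (g x :: nat))"
  using feasible_eq0[OF feasible_diff[of P f g]] by simp

lemma feasible_nat_less: "feasible P f \<Longrightarrow> feasible P g \<Longrightarrow> feasible P (\<lambda>x. f x < (g x :: nat))"
  using feasible_Not[OF feasible_nat_le[of P g f]] by (simp add: not_le)

lemma feasible_nat_eq: "feasible P f \<Longrightarrow> feasible P g \<Longrightarrow> feasible P (\<lambda>x. f x = (g x :: nat))"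
  using feasible_conj[OF feasible_nat_le[of P f g] feasible_nat_le[of P g f]] by (simp add: eq_iff)

lemma sz_nat: "sz (n :: nat) = 2 * n + 1"
  by (induction n) auto

text \<open>The length of the accumulator is the next number to be consed. The growth of a step thus
  depends on the accumulator, so the quadratic bound is supplied to \<open>feasible_foldl\<close>
  directly.\<close>

lemma feasible_upt: "feasible P f \<Longrightarrow> feasible P (\<lambda>x. [0..<f x])"
proof -
  assume f: "feasible P f"
  have *: "foldl (\<lambda>a y. length a # a) [] us = rev [0..<length us]" for us :: "unit list"
    by (induction us rule: rev_induct) auto
  have sz_upt: "sz (rev [0..<n]) \<le> n * (2 * n + 2) + 1" for n
  proof (induction n)
    case (Suc n)
    then show ?case by (simp add: sz_nat algebra_simps)
  qed simp
  have "feasible P (\<lambda>x. foldl (\<lambda>a y. length a # a) [] (replicate (f x) ()))"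
  proof (rule feasible_foldl[where q = "\<lambda>x. sz (f x) * (2 * sz (f x) + 2) + 1"])
    fix c k
    let ?m = "min k (f c)"
    have eq: "foldl (\<lambda>a y. length a # a) [] (take k (replicate (f c) ())) = rev [0..<?m]"
      by (simp add: *)
    have "?m * (2 * ?m + 2) + 1 \<le> sz (f c) * (2 * sz (f c) + 2) + 1"
      by (intro add_mono mult_le_mono) (auto simp: sz_nat)
    then show "sz (foldl (\<lambda>a y. length a # a) [] (take k (replicate (f c) ()))) \<le> sz (f c) * (2 * sz (f c) + 2) + 1"
      unfolding eq using sz_upt[of ?m] le_trans by blast
  qed (use f in \<open>intro feasible_Cons feasible_length feasible_const feasible_fst feasible_snd feasible_id
      feasible_replicate_unit polybounded_intros feasible_polybounded_sz; simp\<close>)+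
  from feasible_rev[OF this] show ?thesis by (simp add: *)
qed


lemma feasible_poly: "feasible P f \<Longrightarrow> feasible P (\<lambda>x. poly (p :: nat poly) (f x))"
proof (induction p)
  case 0
  then show ?case by (simp add: feasible_const)
next
  case (pCons a p)
  then have "feasible P (\<lambda>x. a + f x * poly p (f x))"
    by (intro feasible_add feasible_const feasible_mult) auto
  then show ?case by simp
qed

section \<open>Feasible functions on words and Turing machines\<close>

text \<open>In the tree of a word, a cell with bit true contributes the code
  \<open>True True False False\<close> and one with bit false \<open>True False\<close>. Stacks grow
  at the front, so the cells are written from the last bit backwards.\<close>

definition encode_word :: com where
  "encode_word = move_all R0 R1 ;; Push R0 False ;; While R1 nonempty (Cond R1 is_true
     (Pop R1 ;; Push R0 False ;; Push R0 False ;; Push R0 True ;; Push R0 True)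
     (Pop R1 ;; Push R0 False ;; Push R0 True))"

definition decode_word :: com where
  "decode_word = While R0 is_true (Pop R0 ;; Cond R0 is_true
     (Pop R0 ;; Pop R0 ;; Pop R0 ;; Push R1 True) (Pop R0 ;; Push R1 False)) ;; Pop R0 ;; move_all R1 R0"

lemma runs_Pop_regs:
  "runs (Pop R0) (regs (x # a) b c d) 1 (regs a b c d)"
  "runs (Pop R1) (regs a (x # b) c d) 1 (regs a b c d)"
  using runs_Pop[of R0 "regs (x # a) b c d"] runs_Pop[of R1 "regs a (x # b) c d"] by simp_all

lemma runs_Push_regs:
  "runs (Push R0 x) (regs a b c d) 1 (regs (x # a) b c d)"
  "runs (Push R1 x) (regs a b c d) 1 (regs a (x # b) c d)"
  using runs_Push[of R0 x "regs a b c d"] runs_Push[of R1 x "regs a b c d"] by simp_all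

lemma runs_encode_word: "runs encode_word (single w) (20 * length w + 6) (single (code (enc w)))"
proof -
  let ?body = "Cond R1 is_true (Pop R1 ;; Push R0 False ;; Push R0 False ;; Push R0 True ;; Push R0 True)
     (Pop R1 ;; Push R0 False ;; Push R0 True)"
  have loop: "runs (While R1 nonempty ?body) (regs (code (enc u)) v [] []) (12 * length v + 1)
      (regs (code (enc (rev v @ u))) [] [] [])" for u v :: "bool list"
  proof (induction v arbitrary: u)
    case Nil
    show ?case using runs_While_False[of nonempty "regs (code (enc u)) [] [] []" R1] by simp
  next
    case (Cons x v)
    have "runs ?body (regs (code (enc u)) (x # v) [] []) 10 (regs (code (enc (x # u))) v [] [])"
    proof (cases x)
      case True
      have "runs (Pop R1 ;; Push R0 False ;; Push R0 False ;; Push R0 True ;; Push R0 True)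
          (regs (code (enc u)) (x # v) [] []) (1 + (1 + (1 + (1 + 1 + 1) + 1) + 1) + 1)
          (regs (True # True # False # False # code (enc u)) v [] [])"
        by (rule runs_Seq[OF runs_Pop_regs(2) runs_Seq[OF runs_Push_regs(1) runs_Seq[OF runs_Push_regs(1)
          runs_Seq[OF runs_Push_regs(1) runs_Push_regs(1)]]]])
      then show ?thesis
        using True by (intro runs_mono[OF runs_Cond]) (auto simp: enc_bool_def)
    next
      case False
      have "runs (Pop R1 ;; Push R0 False ;; Push R0 True)
          (regs (code (enc u)) (x # v) [] []) (1 + (1 + 1 + 1) + 1)
          (regs (True # False # code (enc u)) v [] [])"
        by (rule runs_Seq[OF runs_Pop_regs(2) runs_Seq[OF runs_Push_regs(1) runs_Push_regs(1)]])
      then show ?thesis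
        using False by (intro runs_mono[OF runs_Cond]) (auto simp: enc_bool_def)
    qed
    from runs_While_True[of nonempty "regs (code (enc u)) (x # v) [] []" R1, OF _ this Cons[of "x # u"]]
    show ?case by (auto elim!: runs_mono)
  qed
  have 1: "runs (move_all R0 R1) (single w) (6 * length w + 1) (regs [] (rev w) [] [])"
    using runs_move_all[of R0 R1 "single w"] by (simp add: single_regs)
  have 2: "runs (While R1 nonempty ?body) (regs [False] (rev w) [] []) (12 * length w + 1) (single (code (enc w)))"
    using loop[of "[]" "rev w"] by (simp add: single_regs)
  show ?thesis
    unfolding encode_word_def by (rule runs_mono[OF runs_Seq[OF 1 runs_Seq[OF runs_Push_regs(1) 2]]]) simp
qed

lemma runs_decode_word: "runs decode_word (single (code (enc w))) (20 * length w + 6) (single w)"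
proof -
  let ?body = "Pop R0 ;; Cond R0 is_true (Pop R0 ;; Pop R0 ;; Pop R0 ;; Push R1 True) (Pop R0 ;; Push R1 False)"
  have loop: "runs (While R0 is_true ?body) (regs (code (enc u)) v [] []) (12 * length u + 1)
      (regs [False] (rev u @ v) [] [])" for u v :: "bool list"
  proof (induction u arbitrary: v)
    case Nil
    show ?case using runs_While_False[of is_true "regs [False] v [] []" R0] by simp
  next
    case (Cons x u)
    have "runs (Cond R0 is_true (Pop R0 ;; Pop R0 ;; Pop R0 ;; Push R1 True) (Pop R0 ;; Push R1 False))
        (regs (code (enc x) @ code (enc u)) v [] []) 8 (regs (code (enc u)) (x # v) [] [])"
    proof (cases x)
      case True
      have "runs (Pop R0 ;; Pop R0 ;; Pop R0 ;; Push R1 True)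
          (regs (True # False # False # code (enc u)) v [] []) (1 + (1 + (1 + 1 + 1) + 1) + 1)
          (regs (code (enc u)) (True # v) [] [])"
        by (rule runs_Seq[OF runs_Pop_regs(1) runs_Seq[OF runs_Pop_regs(1)
          runs_Seq[OF runs_Pop_regs(1) runs_Push_regs(2)]]])
      then show ?thesis
        using True by (intro runs_mono[OF runs_Cond]) (auto simp: enc_bool_def)
    next
      case False
      have "runs (Pop R0 ;; Push R1 False) (regs (False # code (enc u)) v [] []) (1 + 1 + 1)
          (regs (code (enc u)) (False # v) [] [])"
        by (rule runs_Seq[OF runs_Pop_regs(1) runs_Push_regs(2)])
      then show ?thesis
        using False by (intro runs_mono[OF runs_Cond]) (auto simp: enc_bool_def)
    qed
    from runs_Seq[OF runs_Pop_regs(1) this]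
    have "runs ?body (regs (code (enc (x # u))) v [] []) (1 + 8 + 1) (regs (code (enc u)) (x # v) [] [])"
      by simp
    from runs_While_True[of is_true "regs (code (enc (x # u))) v [] []" R0, OF _ this Cons[of "x # v"]]
    show ?case by (auto elim!: runs_mono)
  qed
  have 1: "runs (While R0 is_true ?body) (single (code (enc w))) (12 * length w + 1) (regs [False] (rev w) [] [])"
    using loop[of w "[]"] by (simp add: single_regs)
  have 2: "runs (move_all R1 R0) (regs [] (rev w) [] []) (6 * length w + 1) (single w)"
    using runs_move_all[of R1 R0 "regs [] (rev w) [] []"] by (simp add: single_regs)
  show ?thesis
    unfolding decode_word_def by (rule runs_mono[OF runs_Seq[OF 1 runs_Seq[OF runs_Pop_regs(1) 2]]]) simp
qed

lemma sz_word: "sz (w :: bool list) \<le> 4 * length w + 1" "length w \<le> sz w"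
  by (induction w) (auto simp: sz_def enc_bool_def)

lemma decidable_if_feasible:
  assumes "feasible False (\<lambda>w. w \<in> L)"
  shows "decidable L"
proof -
  obtain c t where c: "computes c (\<lambda>w. w \<in> L) t" using assms by (auto simp: feasible_def)
  show ?thesis
  proof (rule decidable_by_com)
    fix w
    have "runs c (single (code (enc w))) (t w) (single (code (enc (w \<in> L))))"
      using c unfolding computes_def by (metis append_Nil2)
    from runs_Seq[OF runs_encode_word this]
    show "\<exists>n s'. runs (encode_word ;; c) (single w) n s' \<and> s' R0 \<noteq> [] \<and> (hd (s' R0) \<longleftrightarrow> w \<in> L)"
      by (intro exI conjI) (auto simp: single_def enc_bool_def split: if_splits)
  qed
qed

lemma polytime_computable_if_feasible:
  assumes "feasible True f"
  shows "polytime_computable f"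
proof -
  obtain c t where c: "computes c f t" and "polybounded t" using assms by (auto simp: feasible_def)
  then obtain p where p: "\<And>w. t w \<le> poly p (sz w)" by (auto simp: polybounded_def)
  let ?l = "[:1, 4:] :: nat poly"
  let ?q = "[:6, 20:] + pcompose p ?l + [:20:] * (?l + pcompose p ?l) + [:10:]"
  show ?thesis
  proof (rule polytime_computable_by_com[of ?q])
    fix w
    have "runs c (single (code (enc w))) (t w) (single (code (enc (f w))))"
      using c unfolding computes_def by (metis append_Nil2)
    from runs_Seq[OF runs_encode_word runs_Seq[OF this runs_decode_word]]
    have r: "runs (encode_word ;; c ;; decode_word) (single w)
       (20 * length w + 6 + (t w + (20 * length (f w) + 6) + 1) + 1) (single (f w))" .
    have t: "t w \<le> poly p (4 * length w + 1)"
      using p[of w] poly_nat_mono[OF sz_word(1)[of w], of p] by simp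
    moreover have "length (f w) \<le> 4 * length w + 1 + poly p (4 * length w + 1)"
      using computes_sz[OF c, of w] sz_word[of w] sz_word[of "f w"] t by linarith
    ultimately have "20 * length w + 6 + (t w + (20 * length (f w) + 6) + 1) + 1 \<le> poly ?q (length w)"
      by (simp add: poly_pcompose algebra_simps)
    then show "\<exists>n\<le>poly ?q (length w). runs (encode_word ;; c ;; decode_word) (single w) n (single (f w))"
      using r by blast
  qed
qed


section \<open>Words in generators of SL(2,Z)\<close>

definition mat2 :: "int \<Rightarrow> int \<Rightarrow> int \<Rightarrow> int \<Rightarrow> int^2^2" where
  "mat2 a b c d = vector [vector [a, b], vector [c, d]]"

lemma mat2_nth [simp]:
  "mat2 a b c d $ 1 $ 1 = a" "mat2 a b c d $ 1 $ 2 = b"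
  "mat2 a b c d $ 2 $ 1 = c" "mat2 a b c d $ 2 $ 2 = d"
  by (simp_all add: mat2_def)

lemma mat2_eq_iff [simp]: "mat2 a b c d = mat2 a' b' c' d' \<longleftrightarrow> a = a' \<and> b = b' \<and> c = c' \<and> d = d'"
  by (metis mat2_nth)

lemma mat2_cases: obtains a b c d where "A = mat2 a b c d"
proof
  show "A = mat2 (A $ 1 $ 1) (A $ 1 $ 2) (A $ 2 $ 1) (A $ 2 $ 2)"
    by (simp add: vec_eq_iff forall_2)
qed

lemma mat2_mult [simp]:
  "mat2 a b c d ** mat2 a' b' c' d' = mat2 (a * a' + b * c') (a * b' + b * d') (c * a' + d * c') (c * b' + d * d')"
  by (simp add: vec_eq_iff forall_2 matrix_matrix_mult_def sum_2)

lemma mat_1_mat2: "mat 1 = mat2 1 0 0 1"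
  by (simp add: vec_eq_iff forall_2 mat_def)

lemma det_mat2: "det (mat2 a b c d) = a * d - b * c"
  by (simp add: det_2)

lemma SL2Z_mat2: "mat2 a b c d \<in> SL2Z \<longleftrightarrow> a * d - b * c = 1"
  by (simp add: SL2Z_def det_mat2)

lemma SL2Z_mult: "A \<in> SL2Z \<Longrightarrow> B \<in> SL2Z \<Longrightarrow> A ** B \<in> SL2Z"
  by (simp add: SL2Z_def det_mul)

lemma SL2Z_left_inverse: "A \<in> SL2Z \<Longrightarrow> \<exists>B. B ** A = mat 1"
proof -
  assume "A \<in> SL2Z"
  moreover obtain a b c d where A: "A = mat2 a b c d" by (rule mat2_cases)
  ultimately have "mat2 d (- b) (- c) a ** A = mat 1"
    by (simp add: SL2Z_mat2 mat_1_mat2 algebra_simps)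
  then show ?thesis ..
qed

lemma SL2Z_left_cancel: "A \<in> SL2Z \<Longrightarrow> A ** X = A ** Y \<Longrightarrow> X = Y"
  using SL2Z_left_inverse by (metis matrix_mul_assoc matrix_mul_lid)

definition scalar2 :: "int \<Rightarrow> int^2^2" where
  "scalar2 e = mat2 e 0 0 e"

lemma scalar2_mult: "scalar2 e ** scalar2 f = scalar2 (e * f)"
  by (simp add: scalar2_def)

lemma scalar2_1: "scalar2 1 = mat 1"
  by (simp add: scalar2_def mat_1_mat2)

lemma scalar2_commute: "A ** scalar2 e = scalar2 e ** A"
  by (cases A rule: mat2_cases) (simp add: scalar2_def)

lemma scalar2_left_commute: "A ** (scalar2 e ** B) = scalar2 e ** (A ** B)"
  by (metis matrix_mul_assoc scalar2_commute)

lemma scalar2_mult_left: "scalar2 e ** (scalar2 f ** A) = scalar2 (e * f) ** A"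
  by (simp add: matrix_mul_assoc scalar2_mult)

lemma mat_prod_simps [simp]: "mat_prod [] = mat 1" "mat_prod (A # As) = A ** mat_prod As"
  by (simp_all add: mat_prod_def)

lemma mat_prod_append: "mat_prod (As @ Bs) = mat_prod As ** mat_prod Bs"
  by (induction As) (auto simp: matrix_mul_assoc)

lemma mat_prod_SL2Z: "set As \<subseteq> SL2Z \<Longrightarrow> mat_prod As \<in> SL2Z"
proof (induction As)
  case Nil
  show ?case by (simp add: SL2Z_def)
qed (simp add: SL2Z_mult)

datatype letter = S | U | V

text \<open>\<open>S\<close> squares to -1, \<open>V\<close> is the inverse of \<open>U\<close>, and
  the square of \<open>U\<close> is \<open>- V\<close>, so the cube of \<open>U\<close> is -1.
  Modulo sign these are the generators of the free product of cyclic groups of orders 2 and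
  3.\<close>

fun letter_mat :: "letter \<Rightarrow> int^2^2" where
  "letter_mat S = mat2 0 (-1) 1 0"
| "letter_mat U = mat2 0 (-1) 1 1"
| "letter_mat V = mat2 1 1 (-1) 0"

definition word_mat :: "letter list \<Rightarrow> int^2^2" where
  "word_mat w = mat_prod (map letter_mat w)"

lemma word_mat_simps [simp]: "word_mat [] = mat 1" "word_mat (x # w) = letter_mat x ** word_mat w"
  by (simp_all add: word_mat_def)

lemma word_mat_append: "word_mat (v @ w) = word_mat v ** word_mat w"
  by (simp add: word_mat_def mat_prod_append)

text \<open>Euclid's algorithm on the first column: a translation reduces \<open>a\<close> modulo
  \<open>c\<close>, and \<open>S\<close> exchanges the two entries up to sign. When \<open>c\<close>
  reaches 0, the matrix is a translation up to sign.\<close>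

lemma SL2Z_words:
  assumes "A \<in> SL2Z"
  shows "\<exists>w. word_mat w = A"
proof -
  let ?G = "range word_mat"
  have mult: "A ** B \<in> ?G" if "A \<in> ?G" "B \<in> ?G" for A B
    using that by (auto simp flip: word_mat_append)
  have gen: "word_mat w \<in> ?G" for w by simp
  have minus: "mat2 (-1) 0 0 (-1) \<in> ?G"
    using gen[of "[S, S]"] by (simp add: mat_1_mat2)
  have t1: "mat2 1 1 0 1 \<in> ?G"
    using gen[of "[S, S, S, U]"] by (simp add: mat_1_mat2)
  have t2: "mat2 1 (-1) 0 1 \<in> ?G"
    using gen[of "[V, S]"] by (simp add: mat_1_mat2)
  have one: "mat2 1 0 0 1 \<in> ?G"
    using gen[of "[]"] by (simp add: mat_1_mat2)
  have pos: "mat2 1 (int n) 0 1 \<in> ?G" for n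
  proof (induction n)
    case (Suc n)
    from mult[OF t1 this] show ?case by (simp add: algebra_simps)
  qed (use one in simp)
  have neg: "mat2 1 (- int n) 0 1 \<in> ?G" for n
  proof (induction n)
    case (Suc n)
    from mult[OF t2 this] show ?case by (simp add: algebra_simps)
  qed (use one in simp)
  have T: "mat2 1 k 0 1 \<in> ?G" for k
    using pos[of "nat \<bar>k\<bar>"] neg[of "nat \<bar>k\<bar>"] by (cases "k \<ge> 0") auto
  have S': "mat2 0 1 (-1) 0 \<in> ?G"
    using gen[of "[S, S, S]"] by (simp add: mat_1_mat2)
  have "mat2 a b c d \<in> ?G" if "a * d - b * c = 1" for a b c d
    using that
  proof (induction "nat \<bar>c\<bar>" arbitrary: a b c d rule: less_induct)
    case less
    show ?case
    proof (cases "c = 0")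
      case True
      then have "a * d = 1" using less.prems by simp
      then consider "a = 1" "d = 1" | "a = -1" "d = -1"
        using zmult_eq_1_iff by blast
      then show ?thesis
      proof cases
        case 1
        then show ?thesis using T[of b] True by simp
      next
        case 2
        then show ?thesis using mult[OF minus T[of "-b"]] True by simp
      qed
    next
      case False
      let ?q = "a div c"
      have "mat2 (- c) (- d) (a - ?q * c) (b - ?q * d) \<in> ?G"
      proof (rule less.hyps)
        have "a - ?q * c = a mod c" by (simp add: minus_div_mult_eq_mod)
        then show "nat \<bar>a - ?q * c\<bar> < nat \<bar>c\<bar>"
          using abs_mod_less[OF False, of a] by simp
        show "- c * (b - ?q * d) - - d * (a - ?q * c) = 1"
          using less.prems by (simp add: algebra_simps)
      qed
      then have "mat2 0 1 (-1) 0 ** mat2 (- c) (- d) (a - ?q * c) (b - ?q * d) \<in> ?G"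
        by (rule mult[OF S'])
      then have "mat2 1 ?q 0 1 ** (mat2 0 1 (-1) 0 ** mat2 (- c) (- d) (a - ?q * c) (b - ?q * d)) \<in> ?G"
        by (rule mult[OF T])
      then show ?thesis by (simp add: algebra_simps)
    qed
  qed
  moreover obtain a b c d where A: "A = mat2 a b c d" by (rule mat2_cases)
  ultimately have "A \<in> ?G"
    using assms by (simp add: SL2Z_mat2)
  then show ?thesis by auto
qed

text \<open>Normal forms: a sign and a reduced word, stored with its last letter first, so that
  multiplication on the right works at the head of the list.\<close>

type_synonym normal_form = "int \<times> letter list"

fun reduced :: "letter list \<Rightarrow> bool" where
  "reduced (x # y # w) \<longleftrightarrow> (x = S) \<noteq> (y = S) \<and> reduced (y # w)"
| "reduced _ \<longleftrightarrow> True"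

text \<open>The relations SS = -1, UU = -V, VV = -U and UV = VU = 1, applied at the end of a word;
  in all other cases the letter is appended. Only the top of the stack changes, and a reduced word
  stays reduced.\<close>

fun push :: "letter \<Rightarrow> normal_form \<Rightarrow> normal_form" where
  "push S (s, S # w) = (- s, w)"
| "push U (s, U # w) = (- s, V # w)"
| "push U (s, V # w) = (s, w)"
| "push V (s, V # w) = (- s, U # w)"
| "push V (s, U # w) = (s, w)"
| "push x (s, w) = (s, x # w)"

definition pushes :: "letter list \<Rightarrow> normal_form \<Rightarrow> normal_form" where
  "pushes = fold push"

definition stack_mat :: "letter list \<Rightarrow> int^2^2" where
  "stack_mat w = word_mat (rev w)"

lemma stack_mat_simps [simp]: "stack_mat [] = mat 1" "stack_mat (x # w) = stack_mat w ** letter_mat x"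
  by (simp_all add: stack_mat_def word_mat_append)

lemma stack_mat_append: "stack_mat (v @ w) = stack_mat w ** stack_mat v"
  by (simp add: stack_mat_def word_mat_append)

definition nf_mat :: "normal_form \<Rightarrow> int^2^2" where
  "nf_mat p = scalar2 (fst p) ** stack_mat (snd p)"

definition normal :: "normal_form \<Rightarrow> bool" where
  "normal p \<longleftrightarrow> fst p \<in> {1, -1} \<and> reduced (snd p)"

lemma reduced_tl: "reduced (x # w) \<Longrightarrow> reduced w"
  by (cases w) auto

lemma normal_push: "normal p \<Longrightarrow> normal (push x p)"
  by (induction x p rule: push.induct) (auto simp: normal_def elim: reduced.elims dest: reduced_tl)

lemma nf_mat_push: "nf_mat (push x p) = nf_mat p ** letter_mat x"
proof -
  have 1: "scalar2 (- s) ** A = scalar2 s ** (A ** scalar2 (-1))" for s A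
    by (simp add: scalar2_commute scalar2_mult matrix_mul_assoc[symmetric])
      (simp add: matrix_mul_assoc scalar2_mult)
  have m: "letter_mat S ** letter_mat S = scalar2 (-1)"
    "letter_mat U ** letter_mat U = letter_mat V ** scalar2 (-1)"
    "letter_mat V ** letter_mat V = letter_mat U ** scalar2 (-1)"
    "letter_mat U ** letter_mat V = mat 1" "letter_mat V ** letter_mat U = mat 1"
    by (simp_all add: scalar2_def mat_1_mat2)
  show ?thesis
    by (induction x p rule: push.induct)
      (simp_all add: nf_mat_def 1 m matrix_mul_assoc[symmetric] del: letter_mat.simps)
qed

lemma normal_pushes: "normal p \<Longrightarrow> normal (pushes w p)"
  by (induction w arbitrary: p) (auto simp: pushes_def normal_push)

lemma nf_mat_pushes: "nf_mat (pushes w p) = nf_mat p ** word_mat w"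
  by (induction w arbitrary: p) (auto simp: pushes_def nf_mat_push matrix_mul_assoc)

text \<open>Ping-pong on the two pairs of opposite quadrants.\<close>

fun letter_act :: "letter \<Rightarrow> int \<times> int \<Rightarrow> int \<times> int" where
  "letter_act S (x, y) = (- y, x)"
| "letter_act U (x, y) = (- y, x + y)"
| "letter_act V (x, y) = (x + y, - x)"

lemma stack_mat_act:
  "stack_mat w = mat2 a b c d \<Longrightarrow> fold letter_act w (x, y) = (a * x + b * y, c * x + d * y)"
proof (induction w arbitrary: a b c d x y)
  case Nil
  then show ?case by (simp add: mat_1_mat2)
next
  case (Cons l w)
  obtain a' b' c' d' where w: "stack_mat w = mat2 a' b' c' d'" by (rule mat2_cases)
  show ?case
    using Cons.prems by (cases l) (auto simp: w Cons.IH[OF w] algebra_simps)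
qed

text \<open>\<open>S\<close> exchanges the two pairs of quadrants, while \<open>U\<close> and
  \<open>V\<close> map the pair with positive product into the other one. The second conjunct treats
  words that return to the pair of quadrants they started from: \<open>U\<close> and
  \<open>V\<close> create coordinates of different absolute value, and every later letter keeps them
  different.\<close>

lemma ping_pong:
  assumes "reduced (l # w)" "if l = S then x * y < 0 else x * y > 0" "fold letter_act (l # w) (x, y) = (x', y')"
  shows "(if last (l # w) = S then x' * y' > 0 else x' * y' < 0) \<and> (l \<noteq> S \<or> \<bar>x\<bar> \<noteq> \<bar>y\<bar> \<longrightarrow> \<bar>x'\<bar> \<noteq> \<bar>y'\<bar>)"
  using assms
proof (induction w arbitrary: l x y)
  case Nil
  then show ?case
    by (cases l) (auto simp: zero_less_mult_iff mult_less_0_iff)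
next
  case (Cons m w)
  obtain x1 y1 where 1: "letter_act l (x, y) = (x1, y1)" by fastforce
  have "if m = S then x1 * y1 < 0 else x1 * y1 > 0"
    using Cons.prems 1 by (cases l) (auto simp: zero_less_mult_iff mult_less_0_iff)
  moreover have "l \<noteq> S \<or> \<bar>x\<bar> \<noteq> \<bar>y\<bar> \<longrightarrow> \<bar>x1\<bar> \<noteq> \<bar>y1\<bar>"
    using Cons.prems 1 by (cases l) (auto simp: zero_less_mult_iff mult_less_0_iff)
  moreover have "reduced (m # w)" "fold letter_act (m # w) (x1, y1) = (x', y')"
    using Cons.prems 1 by auto
  ultimately show ?case
    using Cons.IH[of m x1 y1] by auto
qed

lemma reduced_snoc: "reduced (w @ [l]) \<longleftrightarrow> reduced w \<and> (w = [] \<or> (last w = S) \<noteq> (l = S))"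
  by (induction w rule: reduced.induct) auto

text \<open>A word whose first acting letter is not \<open>S\<close> would map (1, 1) to a vector
  with coordinates of equal absolute value. A word acting by \<open>S\<close> at both ends would fix
  (1, -1) up to sign although it changes the quadrants. If \<open>S\<close> stands at the acting end
  only, conjugation by \<open>S\<close> leads back to the first case.\<close>

lemma reduced_trivial:
  assumes "reduced w" "stack_mat w = scalar2 e" "e = 1 \<or> e = -1"
  shows "w = []"
proof (rule ccontr)
  have 1: False if w: "reduced (l # w)" "stack_mat (l # w) = scalar2 e" "l \<noteq> S" for l w
  proof -
    have "fold letter_act (l # w) (1, 1) = (e, e)"
      using stack_mat_act[of "l # w" e 0 0 e 1 1] w(2) by (simp add: scalar2_def)
    from ping_pong[OF w(1) _ this] show False using w(3) by simp
  qed
  assume "w \<noteq> []"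
  then obtain l v where lv: "w = l # v" by (cases w) auto
  with assms 1 have l: "l = S" by blast
  have act: "fold letter_act (S # v) (1, -1) = (e, - e)"
    using stack_mat_act[of "S # v" e 0 0 e 1 "-1"] assms(2) lv l by (simp add: scalar2_def)
  have red: "reduced (S # v)" using assms lv l by simp
  show False
  proof (cases "last w = S")
    case True
    then show ?thesis
      using ping_pong[OF red _ act] assms(3) lv l by auto
  next
    case False
    then have "v \<noteq> []" using lv l by auto
    then obtain m u where mu: "v = m # u" by (cases v) auto
    have v: "stack_mat v ** letter_mat S = scalar2 e"
      using assms(2) lv l by simp
    have "letter_mat S ** stack_mat v = scalar2 e"
      using v by (cases "stack_mat v" rule: mat2_cases) (auto simp: scalar2_def)
    then have "stack_mat (v @ [S]) = scalar2 e"
      by (simp add: stack_mat_append)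
    moreover have "reduced (v @ [S])"
      using red False lv l \<open>v \<noteq> []\<close> by (auto simp: reduced_snoc dest: reduced_tl)
    ultimately show False
      using 1[of m "u @ [S]"] mu red by auto
  qed
qed

lemma push_length: "length (snd (push x p)) \<le> Suc (length (snd p)) \<and> length (snd p) \<le> Suc (length (snd (push x p)))"
  by (induction x p rule: push.induct) auto

lemma pushes_length:
  "length (snd (pushes w p)) \<le> length (snd p) + length w \<and> length (snd p) \<le> length (snd (pushes w p)) + length w"
proof (induction w arbitrary: p)
  case (Cons x w)
  show ?case using Cons[of "push x p"] push_length[of x p] by (auto simp: pushes_def)
qed (simp add: pushes_def)

fun letter_inv :: "letter \<Rightarrow> letter" where
  "letter_inv S = S" | "letter_inv U = V" | "letter_inv V = U"

text \<open>The sign appears because \<open>S\<close> is used as its own inverse although it squares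
  to -1.\<close>

lemma word_mat_inverse:
  "\<exists>e\<in>{1, -1}. word_mat w ** word_mat (rev (map letter_inv w)) = scalar2 e"
proof (induction w)
  case Nil
  then show ?case by (auto simp: scalar2_1)
next
  case (Cons x w)
  then obtain e where e: "e \<in> {1, -1}" "word_mat w ** word_mat (rev (map letter_inv w)) = scalar2 e" by blast
  obtain f where f: "f \<in> {1, -1}" "letter_mat x ** letter_mat (letter_inv x) = scalar2 f"
    by (cases x) (auto simp: scalar2_def)
  have "word_mat (x # w) ** word_mat (rev (map letter_inv (x # w))) =
      letter_mat x ** (word_mat w ** word_mat (rev (map letter_inv w))) ** letter_mat (letter_inv x)"
    by (simp add: word_mat_append matrix_mul_assoc)
  also have "\<dots> = scalar2 e ** (letter_mat x ** letter_mat (letter_inv x))"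
    by (simp only: e(2) scalar2_commute matrix_mul_assoc)
  also have "\<dots> = scalar2 (e * f)" by (simp only: f(2) scalar2_mult)
  finally show ?case using e(1) f(1) by auto
qed

text \<open>Multiplying by the inverse of \<open>w\<close> must empty the stack, by
  \<open>reduced_trivial\<close>, and each of the \<open>length w\<close> letters removes at most
  one from it. Normal forms are therefore shortest words up to sign.\<close>

lemma normal_length_le:
  assumes "normal p" "nf_mat p = scalar2 e ** word_mat w" "e \<in> {1, -1}"
  shows "length (snd p) \<le> length w"
proof -
  obtain f where f: "f \<in> {1, -1}" "word_mat w ** word_mat (rev (map letter_inv w)) = scalar2 f"
    using word_mat_inverse by blast
  let ?q = "pushes (rev (map letter_inv w)) p"
  have q: "normal ?q" by (rule normal_pushes[OF assms(1)])
  have "nf_mat ?q = scalar2 (e * f)"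
    using assms(2) f(2) by (simp add: nf_mat_pushes matrix_mul_assoc[symmetric] scalar2_mult)
  then have "scalar2 (fst ?q) ** (scalar2 (fst ?q) ** stack_mat (snd ?q)) = scalar2 (fst ?q * (e * f))"
    by (simp add: nf_mat_def scalar2_mult)
  moreover have "fst ?q * fst ?q = 1" using q by (auto simp: normal_def)
  ultimately have "stack_mat (snd ?q) = scalar2 (fst ?q * (e * f))"
    by (simp add: matrix_mul_assoc scalar2_mult scalar2_1)
  then have "snd ?q = []"
    using q f(1) assms(3) by (intro reduced_trivial[of _ "fst ?q * (e * f)"]) (auto simp: normal_def)
  then show ?thesis using pushes_length[of "rev (map letter_inv w)" p] by simp
qed

section \<open>Prefixes of reduced words\<close>

definition bottom :: "nat \<Rightarrow> letter list \<Rightarrow> letter list" where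
  "bottom r w = drop (length w - r) w"

text \<open>The end of a word is on top of its stack, so a common bottom of two stacks is a common
  prefix of the two reduced words.\<close>

definition has_bottom :: "letter list \<Rightarrow> letter list \<Rightarrow> bool" where
  "has_bottom u w \<longleftrightarrow> (\<exists>v. w = v @ u)"

lemma push_bottom:
  "has_bottom u (snd p) \<Longrightarrow> length u < length (snd p) \<Longrightarrow> has_bottom u (snd (push x p))"
proof -
  assume a: "has_bottom u (snd p)" "length u < length (snd p)"
  then obtain y v where "snd p = (y # v) @ u"
    unfolding has_bottom_def by (metis append_self_conv2 length_append less_irrefl list.exhaust)
  then show "has_bottom u (snd (push x p))"
    by (cases p; cases x; cases y) (auto simp: has_bottom_def intro: exI[of _ "_ # _"])
qed

lemma push_bottom':
  "has_bottom u (snd (push x p)) \<Longrightarrow> length u < length (snd (push x p)) \<Longrightarrow> has_bottom u (snd p)"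
proof -
  assume a: "has_bottom u (snd (push x p))" "length u < length (snd (push x p))"
  then obtain y v where yv: "snd (push x p) = (y # v) @ u"
    unfolding has_bottom_def by (metis append_self_conv2 length_append less_irrefl list.exhaust)
  obtain s w where p: "p = (s, w)" by (cases p)
  show "has_bottom u (snd p)"
  proof (cases w)
    case Nil
    then show ?thesis using yv p by (cases x) (auto simp: has_bottom_def)
  next
    case (Cons z w')
    then show ?thesis
      using yv p by (cases x; cases z) (auto simp: has_bottom_def Cons_eq_append_conv intro: exI[of _ "_ # _"])
  qed
qed

lemma pushes_bottom:
  "has_bottom u (snd p) \<Longrightarrow> length u + length w \<le> length (snd p) \<Longrightarrow> has_bottom u (snd (pushes w p))"
proof (induction w arbitrary: p)
  case (Cons x w)
  then have "has_bottom u (snd (push x p))" by (intro push_bottom) auto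
  then show ?case using Cons push_length[of x p] by (auto simp: pushes_def)
qed (simp add: pushes_def)

text \<open>\<open>pushes_bottom\<close> read backwards in time: a word that leaves the stack at
  least \<open>length w\<close> above \<open>u\<close> cannot have created \<open>u\<close>. The two
  lemmas bound the height at which a walk leaves and enters the part of the tree above
  \<open>u\<close>.\<close>

lemma pushes_bottom':
  "has_bottom u (snd (pushes w p)) \<Longrightarrow> length u + length w \<le> length (snd (pushes w p)) \<Longrightarrow> has_bottom u (snd p)"
proof (induction w arbitrary: p)
  case (Cons x w)
  then have "has_bottom u (snd (push x p))" by (auto simp: pushes_def)
  moreover have "length u < length (snd (push x p))"
    using Cons.prems(2) pushes_length[of w "push x p"] by (simp add: pushes_def)
  ultimately show ?case by (rule push_bottom')
qed (simp add: pushes_def)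

text \<open>The common prefix \<open>u\<close> cancels in the quotient of the two elements, which is
  the inverse of \<open>v\<close> times \<open>v'\<close> up to sign; its word length does not
  involve \<open>u\<close>. Stacks are stored reversed, hence the inverse of \<open>v\<close>
  appears without \<open>rev\<close> and \<open>v'\<close> with it.\<close>

lemma nf_mat_difference:
  assumes "s \<in> {1, -1}" "s' \<in> {1, -1}"
  shows "\<exists>e\<in>{1, -1}. nf_mat (s', v' @ u) = nf_mat (s, v @ u) ** (scalar2 e ** word_mat (map letter_inv v @ rev v'))"
proof -
  obtain f where f: "f \<in> {1, -1}" "word_mat (rev v) ** word_mat (rev (map letter_inv (rev v))) = scalar2 f"
    using word_mat_inverse by blast
  then have f': "stack_mat v ** word_mat (map letter_inv v) = scalar2 f"
    by (simp add: stack_mat_def rev_map)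
  have f'': "stack_mat v ** (word_mat (map letter_inv v) ** X) = scalar2 f ** X" for X
    by (simp only: matrix_mul_assoc f')
  have "nf_mat (s, v @ u) ** (scalar2 e ** word_mat (map letter_inv v @ rev v')) =
      scalar2 (s * e * f) ** stack_mat (v' @ u)" for e
  proof -
    have "nf_mat (s, v @ u) ** (scalar2 e ** word_mat (map letter_inv v @ rev v')) =
        scalar2 s ** (stack_mat u ** (stack_mat v ** (scalar2 e ** (word_mat (map letter_inv v) ** stack_mat v'))))"
      by (simp add: nf_mat_def stack_mat_append word_mat_append stack_mat_def[symmetric] matrix_mul_assoc)
    also have "\<dots> = scalar2 s ** (scalar2 e ** (scalar2 f ** (stack_mat u ** stack_mat v')))"
      by (simp only: scalar2_left_commute[of "stack_mat v"] scalar2_left_commute[of "stack_mat u"] f'')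
    finally show ?thesis by (simp add: scalar2_mult_left stack_mat_append mult.assoc)
  qed
  from this[of "s * s' * f"] show ?thesis
    using assms f(1) by (intro bexI[of _ "s * s' * f"]) (auto simp: nf_mat_def)
qed


section \<open>Bounded pumping\<close>

definition slice :: "'a list \<Rightarrow> nat \<Rightarrow> nat \<Rightarrow> 'a list" where
  "slice xs a b = take (b - a) (drop a xs)"

lemma slice_append: "a \<le> b \<Longrightarrow> b \<le> c \<Longrightarrow> slice xs a b @ slice xs b c = slice xs a c"
proof -
  assume "a \<le> b" "b \<le> c"
  then obtain j k where "b = a + j" "c = a + j + k" using le_Suc_ex by metis
  then show ?thesis by (simp add: slice_def take_add add.commute)
qed

lemma take_slice: "a \<le> b \<Longrightarrow> take b xs = take a xs @ slice xs a b"
  unfolding slice_def by (metis le_add_diff_inverse take_add)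

lemma length_slice: "b \<le> length xs \<Longrightarrow> length (slice xs a b) = b - a"
  by (simp add: slice_def)

lemma set_slice: "set (slice xs a b) \<subseteq> set xs"
  unfolding slice_def by (meson set_drop_subset set_take_subset subset_trans)

lemma maximal_interval:
  fixes R :: "nat \<Rightarrow> bool"
  assumes "R t" "\<not> R 0" "\<not> R n" "t < n"
  shows "\<exists>a b. 0 < a \<and> a \<le> t \<and> t \<le> b \<and> b < n \<and> (\<forall>i. a \<le> i \<and> i \<le> b \<longrightarrow> R i) \<and> \<not> R (a - 1) \<and> \<not> R (Suc b)"
proof -
  define A where "A = {i. i \<le> t \<and> \<not> R i}"
  define B where "B = {i. t \<le> i \<and> i \<le> n \<and> \<not> R i}"
  have "finite A" "finite B" "0 \<in> A" "n \<in> B" using assms by (auto simp: A_def B_def)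
  then have "Max A \<in> A" "Min B \<in> B" and max: "\<And>i. i \<in> A \<Longrightarrow> i \<le> Max A" and min: "\<And>i. i \<in> B \<Longrightarrow> Min B \<le> i"
    by (auto intro: Max_in Min_in)
  then have p: "Max A \<le> t" "\<not> R (Max A)" and q: "t \<le> Min B" "Min B \<le> n" "\<not> R (Min B)"
    by (auto simp: A_def B_def)
  have p': "Max A < t" using p assms(1) by (cases "Max A = t") auto
  obtain b where b: "Min B = Suc b" "t \<le> b" using q assms(1) by (cases "Min B"; cases "Min B = t") auto
  have "R i" if "Suc (Max A) \<le> i" "i \<le> b" for i
  proof (rule ccontr)
    assume "\<not> R i"
    then have "i \<in> A \<or> i \<in> B" using that b q by (auto simp: A_def B_def)
    then show False using max[of i] min[of i] that b(1) by auto
  qed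
  then show ?thesis
    using p p' q b by (intro exI[of _ "Suc (Max A)"] exI[of _ b]) auto
qed

lemma last_failure:
  fixes R :: "nat \<Rightarrow> bool"
  assumes "\<not> R 0" "R n"
  shows "\<exists>p<n. \<not> R p \<and> (\<forall>i. p < i \<and> i \<le> n \<longrightarrow> R i)"
  using assms
proof (induction n)
  case (Suc n)
  show ?case
  proof (cases "R n")
    case True
    with Suc obtain p where "p < n" "\<not> R p" "\<forall>i. p < i \<and> i \<le> n \<longrightarrow> R i" by blast
    then show ?thesis using Suc.prems(2) by (intro exI[of _ p]) (auto simp: le_Suc_eq)
  next
    case False
    then show ?thesis using Suc.prems(2) by (intro exI[of _ n]) (auto simp: le_Suc_eq)
  qed
qed simp

text \<open>Consider a walk that starts and ends near the origin and climbs above \<open>height_bound D\<close>. For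
  each of \<open>short_count D + 1\<close> prefixes of the highest word, with lengths \<open>D\<close> apart, the maximal time
  interval around the top during which the walk stays above the prefix contributes a matrix in
  \<open>short_mats D\<close>; two of these nested intervals contribute the same one. A walk below that height
  repeats a normal form within \<open>pump_bound D\<close> steps.\<close>

definition short_mats :: "nat \<Rightarrow> (int^2^2) set" where
  "short_mats D = (\<lambda>(e, w). scalar2 e ** word_mat w) ` ({1, -1} \<times> {w. length w \<le> 2 * D + 1})"

text \<open>A sign and a word of length at most \<open>n = 2 * D + 1\<close>, where
  \<open>3 ^ (n + 1)\<close> bounds the number of such words.\<close>

definition short_count :: "nat \<Rightarrow> nat" where
  "short_count D = 2 * 3 ^ (2 * D + 2)"

text \<open>Room for the prefixes of lengths \<open>2 * D + 2 + D * m\<close> with \<open>m\<close>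
  up to \<open>short_count D\<close>. Already the shortest is longer than the normal form of any
  matrix in \<open>short_mats D\<close>, so neither the start nor the end of the walk lies above
  it.\<close>

definition height_bound :: "nat \<Rightarrow> nat" where
  "height_bound D = 2 * D + 2 + D * short_count D"

text \<open>A bound for the number of normal forms of length at most
  \<open>height_bound D\<close>.\<close>

definition pump_bound :: "nat \<Rightarrow> nat" where
  "pump_bound D = 2 * 3 ^ (height_bound D + 1)"

lemma card_letter_lists: "finite {w :: letter list. length w \<le> n} \<and> card {w :: letter list. length w \<le> n} \<le> 3 ^ (n + 1)"
proof -
  have L: "(UNIV :: letter set) = {S, U, V}" using letter.exhaust by blast
  then have fin: "finite (UNIV :: letter set)" and card: "card (UNIV :: letter set) = 3" unfolding L by auto
  have "(\<Sum>i\<le>n. 3 ^ i) \<le> (3 :: nat) ^ (n + 1)"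
    by (induction n) auto
  then show ?thesis
    using card_lists_length_le[OF fin, of n] finite_lists_length_le[OF fin, of n] by (simp add: card)
qed

lemma card_signed_letter_lists:
  "finite ({1, -1 :: int} \<times> {w :: letter list. length w \<le> n}) \<and>
   card ({1, -1 :: int} \<times> {w :: letter list. length w \<le> n}) \<le> 2 * 3 ^ (n + 1)"
  using card_letter_lists[of n] by (simp add: card_cartesian_product)

lemma card_short_mats: "finite (short_mats D) \<and> card (short_mats D) \<le> short_count D"
proof -
  have "card (short_mats D) \<le> card ({1, -1 :: int} \<times> {w :: letter list. length w \<le> 2 * D + 1})"
    unfolding short_mats_def using card_signed_letter_lists by (intro card_image_le) blast
  then show ?thesis
    using card_signed_letter_lists[of "2 * D + 1"] unfolding short_mats_def short_count_def
    by (auto intro: finite_imageI)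
qed

lemma infinitely_factorizable_if_pump:
  assumes vwx: "set (v @ w @ x) \<subseteq> G" "v @ x \<noteq> []" "mat_prod (v @ w @ x) = mat_prod w"
  shows "has_infinitely_factorizable G"
proof -
  \<comment> \<open>At least one copy of \<open>v\<close> and \<open>x\<close> is taken, so that the
    factorization is nonempty even for empty \<open>w\<close>.\<close>
  define f where "f n = concat (replicate (Suc n) v) @ w @ concat (replicate (Suc n) x)" for n
  have rep: "concat (replicate (Suc n) y) = concat (replicate n y) @ y" for n and y :: "'b list"
    by (induction n) auto
  have prod: "mat_prod (f n) = mat_prod w" for n
  proof (induction n)
    case 0
    then show ?case using vwx(3) by (simp add: f_def)
  next
    case (Suc n)
    have "f (Suc n) = v @ f n @ x" unfolding f_def by (subst rep[of "Suc n" x]) simp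
    then show ?case using Suc vwx(3) by (simp add: mat_prod_append)
  qed
  have len: "length (f n) = Suc n * length (v @ x) + length w" for n
    by (simp add: f_def length_concat sum_list_replicate algebra_simps)
  have "inj f"
  proof (rule injI)
    fix m n assume "f m = f n"
    then have "Suc m * length (v @ x) = Suc n * length (v @ x)" using len[of m] len[of n] by (metis \<open>f m = f n\<close> add_right_cancel)
    then have "m = n \<or> length (v @ x) = 0" by (metis mult_cancel2 Suc_inject)
    then show "m = n" using vwx(2) by (metis length_0_conv)
  qed
  moreover have "f n \<in> factorizations G (mat_prod w)" for n
    using vwx(1,2) prod[of n] by (auto simp: factorizations_def f_def)
  ultimately have "infinite (factorizations G (mat_prod w))"
    by (metis finite_imageD finite_subset image_subset_iff infinite_UNIV_nat)
  moreover have "mat_prod w \<in> generated_semigroup G"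
  proof -
    have "f 0 \<noteq> []" "set (f 0) \<subseteq> G" "mat_prod w = mat_prod (f 0)"
      using \<open>f 0 \<in> factorizations G (mat_prod w)\<close> by (simp_all add: factorizations_def)
    then show ?thesis unfolding generated_semigroup_def by blast
  qed
  ultimately show ?thesis
    unfolding has_infinitely_factorizable_def by blast
qed

text \<open>\<open>\<kappa>\<close> picks a word for every generator; \<open>D\<close> then limits
  how far one factor can move the top of the stack.\<close>

locale letter_words =
  fixes G :: "(int^2^2) set" and \<kappa> :: "int^2^2 \<Rightarrow> letter list" and D :: nat
  assumes word: "A \<in> G \<Longrightarrow> word_mat (\<kappa> A) = A" and word_length: "A \<in> G \<Longrightarrow> length (\<kappa> A) \<le> D"
begin

definition state :: "(int^2^2) list \<Rightarrow> nat \<Rightarrow> normal_form" where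
  "state As i = fold (\<lambda>A. pushes (\<kappa> A)) (take i As) (1, [])"

lemma state_0: "state As 0 = (1, [])"
  by (simp add: state_def)

lemma state_Suc: "i < length As \<Longrightarrow> state As (Suc i) = pushes (\<kappa> (As ! i)) (state As i)"
  by (simp add: state_def take_Suc_conv_app_nth)

lemma normal_state: "normal (state As i)"
proof -
  have "normal p \<Longrightarrow> normal (fold (\<lambda>A. pushes (\<kappa> A)) Bs p)" for Bs p
    by (induction Bs arbitrary: p) (auto simp: normal_pushes)
  then show ?thesis unfolding state_def by (simp add: normal_def)
qed

lemma nf_mat_state:
  assumes "set As \<subseteq> G"
  shows "nf_mat (state As i) = mat_prod (take i As)"
proof -
  have "nf_mat (fold (\<lambda>A. pushes (\<kappa> A)) Bs p) = nf_mat p ** mat_prod Bs" if "set Bs \<subseteq> G" for Bs p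
    using that by (induction Bs arbitrary: p) (auto simp: nf_mat_pushes word matrix_mul_assoc)
  moreover have "set (take i As) \<subseteq> G" using assms set_take_subset by fastforce
  ultimately show ?thesis
    unfolding state_def by (simp add: nf_mat_def scalar2_1)
qed

lemma G_SL2Z: "G \<subseteq> SL2Z"
proof
  fix A assume "A \<in> G"
  have "letter_mat l \<in> SL2Z" for l by (cases l) (auto simp: SL2Z_mat2)
  then have "set (map letter_mat (\<kappa> A)) \<subseteq> SL2Z" by auto
  then have "word_mat (\<kappa> A) \<in> SL2Z" unfolding word_mat_def by (rule mat_prod_SL2Z)
  then show "A \<in> SL2Z" using word[OF \<open>A \<in> G\<close>] by simp
qed

text \<open>The product of a slice is the quotient of the states at its ends, and if both are close
  to a common prefix, that quotient has a short word.\<close>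

lemma slice_short:
  assumes As: "set As \<subseteq> G" and ab: "a \<le> b"
    and "snd (state As a) = v @ u" "snd (state As b) = v' @ u" "length v + length v' \<le> 2 * D + 1"
  shows "mat_prod (slice As a b) \<in> short_mats D"
proof -
  obtain s s' where s: "state As a = (s, v @ u)" "state As b = (s', v' @ u)"
    using assms(3,4) by (metis prod.collapse)
  then have "s \<in> {1, -1}" "s' \<in> {1, -1}"
    using normal_state[of As a] normal_state[of As b] by (auto simp: normal_def)
  from nf_mat_difference[OF this, of v' u v] obtain e where e: "e \<in> {1, -1}"
    "mat_prod (take b As) = mat_prod (take a As) ** (scalar2 e ** word_mat (map letter_inv v @ rev v'))"
    unfolding s[symmetric] nf_mat_state[OF As] by blast
  have "mat_prod (take a As) ** mat_prod (slice As a b) =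
      mat_prod (take a As) ** (scalar2 e ** word_mat (map letter_inv v @ rev v'))"
    using e(2) unfolding take_slice[OF ab, of As] mat_prod_append by simp
  moreover have "mat_prod (take a As) \<in> SL2Z"
    using As G_SL2Z set_take_subset[of a As] by (intro mat_prod_SL2Z) blast
  ultimately have "mat_prod (slice As a b) = scalar2 e ** word_mat (map letter_inv v @ rev v')"
    by (rule SL2Z_left_cancel[rotated])
  then show ?thesis
    using e(1) assms(5) unfolding short_mats_def
    by (intro image_eqI[of _ _ "(e, map letter_inv v @ rev v')"]) auto
qed

text \<open>A single factor is a word of at most \<open>D\<close> letters, so it cannot both
  complete \<open>u\<close> and put \<open>D\<close> or more letters on top of it.\<close>

lemma enter_length:
  assumes "set As \<subseteq> G" "i < length As" "\<not> has_bottom u (snd (state As i))" "has_bottom u (snd (state As (Suc i)))"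
  shows "length (snd (state As (Suc i))) < length u + D"
proof (rule ccontr)
  assume "\<not> ?thesis"
  moreover have "length (\<kappa> (As ! i)) \<le> D" using assms(1,2) word_length nth_mem by blast
  ultimately have "length u + length (\<kappa> (As ! i)) \<le> length (snd (state As (Suc i)))" by simp
  then show False
    using pushes_bottom' assms(2-4) state_Suc[OF assms(2)] by metis
qed

lemma leave_length:
  assumes "set As \<subseteq> G" "i < length As" "has_bottom u (snd (state As i))" "\<not> has_bottom u (snd (state As (Suc i)))"
  shows "length (snd (state As i)) < length u + D"
proof (rule ccontr)
  assume "\<not> ?thesis"
  moreover have "length (\<kappa> (As ! i)) \<le> D" using assms(1,2) word_length nth_mem by blast
  ultimately have "length u + length (\<kappa> (As ! i)) \<le> length (snd (state As i))" by simp
  then show False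
    using pushes_bottom assms(2-4) state_Suc[OF assms(2)] by metis
qed

definition pumpable :: "nat \<Rightarrow> bool" where
  "pumpable B \<longleftrightarrow> (\<exists>v w x. set (v @ w @ x) \<subseteq> G \<and> length v \<le> B \<and> length w \<le> B \<and> length x \<le> B \<and>
     v @ x \<noteq> [] \<and> mat_prod (v @ w @ x) = mat_prod w)"

text \<open>Induction on the length is what bounds the pump. The slice between the ends
  \<open>a 0\<close> and \<open>b 0\<close> of the outermost interval is a strictly shorter walk
  whose product is again short. If it is still longer than \<open>pump_bound D\<close>, it replaces
  \<open>As\<close>; otherwise all nested intervals have bounded length.\<close>

lemma long_short_pumpable:
  assumes "set As \<subseteq> G" "pump_bound D < length As" "mat_prod As \<in> short_mats D"
  shows "pumpable (pump_bound D)"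
  using assms
proof (induction As rule: measure_induct_rule[where f = length])
  case (less As)
  let ?n = "length As" and ?B = "pump_bound D" and ?st = "state As"
  show ?case
  proof (cases "\<forall>i\<le>?B. length (snd (?st i)) \<le> height_bound D")
    case True
    let ?X = "{1, -1 :: int} \<times> {w :: letter list. length w \<le> height_bound D}"
    have "?st ` {..?B} \<subseteq> ?X"
    proof
      fix p assume "p \<in> ?st ` {..?B}"
      then obtain i where "i \<le> ?B" "p = ?st i" by auto
      then show "p \<in> ?X" using normal_state[of As i] True by (auto simp: normal_def mem_Times_iff)
    qed
    \<comment> \<open>There are \<open>pump_bound D + 1\<close> states but at most
      \<open>pump_bound D\<close> normal forms of this height. Two states coincide, the slice
      between them has product 1, and it is pumped with \<open>w\<close> and \<open>x\<close>
      empty.\<close>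
    then have "card (?st ` {..?B}) \<le> ?B"
      using card_signed_letter_lists[of "height_bound D"] card_mono[of ?X "?st ` {..?B}"]
      unfolding pump_bound_def by linarith
    then have "\<not> inj_on ?st {..?B}"
      using card_image[of ?st "{..?B}"] by auto
    then obtain i j where ij: "i < j" "j \<le> ?B" "?st i = ?st j"
      unfolding inj_on_def by (metis atMost_iff linorder_neqE_nat)
    have "mat_prod (take j As) = mat_prod (take i As)"
      using nf_mat_state[OF less.prems(1)] ij(3) by metis
    then have "mat_prod (take i As) ** mat_prod (slice As i j) = mat_prod (take i As) ** mat 1"
      using ij(1) by (simp add: take_slice[of i j As] mat_prod_append)
    moreover have "mat_prod (take i As) \<in> SL2Z"
      using less.prems(1) G_SL2Z set_take_subset[of i As] by (intro mat_prod_SL2Z) blast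
    ultimately have "mat_prod (slice As i j) = mat 1" by (rule SL2Z_left_cancel[rotated])
    moreover have "length (slice As i j) = j - i"
      using ij less.prems(2) by (intro length_slice) simp
    ultimately show ?thesis
      unfolding pumpable_def using ij set_slice[of As i j] less.prems(1)
      by (intro exI[of _ "slice As i j"] exI[of _ "[]"]) auto
  next
    case False
    then obtain t where t: "t \<le> ?B" "height_bound D < length (snd (?st t))" by force
    let ?w = "snd (?st t)"
    \<comment> \<open>Successive prefixes differ by \<open>D\<close> letters, the largest distance
      one factor can cover; this makes the left ends of the intervals distinct.\<close>
    define r where "r m = 2 * D + 2 + D * m" for m
    define u where "u m = bottom (r m) ?w" for m
    define R where "R m i \<longleftrightarrow> has_bottom (u m) (snd (?st i))" for m i
    have r_le: "r m \<le> length ?w" if "m \<le> short_count D" for m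
    proof -
      have "D * m \<le> D * short_count D" using that by simp
      then show ?thesis using t(2) unfolding r_def height_bound_def by linarith
    qed
    have len_u: "length (u m) = r m" if "m \<le> short_count D" for m
      using r_le[OF that] by (simp add: u_def bottom_def)
    have end_len: "length (snd (?st ?n)) \<le> 2 * D + 1"
    proof -
      obtain e w where "e \<in> {1, -1}" "length w \<le> 2 * D + 1" "mat_prod As = scalar2 e ** word_mat w"
        using less.prems(3) unfolding short_mats_def by auto
      then show ?thesis
        using normal_length_le[OF normal_state[of As ?n], of e w] nf_mat_state[OF less.prems(1), of ?n] by simp
    qed
    have ex: "\<exists>a b. 0 < a \<and> a \<le> t \<and> t \<le> b \<and> b < ?n \<and> (\<forall>i. a \<le> i \<and> i \<le> b \<longrightarrow> R m i) \<and> \<not> R m (a - 1) \<and> \<not> R m (Suc b)"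
      if m: "m \<le> short_count D" for m
    proof (rule maximal_interval)
      show "R m t" unfolding R_def u_def bottom_def has_bottom_def by (metis append_take_drop_id)
      show "\<not> R m 0" using len_u[OF m] by (auto simp: R_def has_bottom_def state_0 r_def)
      show "\<not> R m ?n"
      proof
        assume "R m ?n"
        then have "length (u m) \<le> length (snd (?st ?n))" by (auto simp: R_def has_bottom_def)
        then show False using end_len len_u[OF m] by (simp add: r_def)
      qed
      show "t < ?n" using t(1) less.prems(2) by simp
    qed
    then obtain a b where ab: "\<And>m. m \<le> short_count D \<Longrightarrow> 0 < a m \<and> a m \<le> t \<and> t \<le> b m \<and> b m < ?n \<and>
        (\<forall>i. a m \<le> i \<and> i \<le> b m \<longrightarrow> R m i) \<and> \<not> R m (a m - 1) \<and> \<not> R m (Suc (b m))"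
      by metis
    have R_mono: "R m i" if "R m' i" "m \<le> m'" "m' \<le> short_count D" for m m' i
    proof -
      have "r m \<le> r m'" using that(2) by (simp add: r_def)
      then have "u m = drop (r m' - r m) (u m')"
        using r_le[OF that(3)] by (simp add: u_def bottom_def)
      then have "u m' = take (r m' - r m) (u m') @ u m" by simp
      then show ?thesis using that(1) unfolding R_def has_bottom_def by (metis append_assoc)
    qed
    have nest: "a m \<le> a m' \<and> b m' \<le> b m" if m: "m \<le> m'" "m' \<le> short_count D" for m m'
    proof (intro conjI; rule ccontr)
      have m1: "m \<le> short_count D" using m by simp
      {
        assume "\<not> a m \<le> a m'"
        then have "a m' \<le> a m - 1" "a m - 1 \<le> b m'" using ab[OF m(2)] ab[OF m1] by auto
        then have "R m' (a m - 1)" using ab[OF m(2)] by blast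
        then show False using R_mono m ab[OF m1] by blast
      }
      {
        assume "\<not> b m' \<le> b m"
        then have "a m' \<le> Suc (b m)" "Suc (b m) \<le> b m'" using ab[OF m(2)] ab[OF m1] by auto
        then have "R m' (Suc (b m))" using ab[OF m(2)] by blast
        then show False using R_mono m ab[OF m1] by blast
      }
    qed
    have lens: "r m \<le> length (snd (?st (a m))) \<and> length (snd (?st (a m))) < r m + D \<and>
        length (snd (?st (b m))) < r m + D \<and> mat_prod (slice As (a m) (b m)) \<in> short_mats D"
      if m: "m \<le> short_count D" for m
    proof -
      have Ra: "R m (a m)" and Rb: "R m (b m)" using ab[OF m] by auto
      have la: "length (snd (?st (a m))) < r m + D"
      proof -
        have "a m - 1 < ?n" "Suc (a m - 1) = a m" using ab[OF m] by auto
        then show ?thesis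
          using enter_length[OF less.prems(1), of "a m - 1" "u m"] ab[OF m] Ra len_u[OF m] by (simp add: R_def)
      qed
      have lb: "length (snd (?st (b m))) < r m + D"
        using leave_length[OF less.prems(1), of "b m" "u m"] ab[OF m] Rb len_u[OF m] by (simp add: R_def)
      obtain v v' where v: "snd (?st (a m)) = v @ u m" "snd (?st (b m)) = v' @ u m"
        using Ra Rb by (auto simp: R_def has_bottom_def)
      have "mat_prod (slice As (a m) (b m)) \<in> short_mats D"
        using la lb len_u[OF m] v ab[OF m] by (intro slice_short[OF less.prems(1) _ v]) auto
      then show ?thesis using la lb v len_u[OF m] by simp
    qed
    show ?thesis
    proof (cases "?B < b 0 - a 0")
      case True
      have "length (slice As (a 0) (b 0)) = b 0 - a 0" using ab[of 0] by (intro length_slice) simp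
      then show ?thesis
        using less.IH[of "slice As (a 0) (b 0)"] True ab[of 0] lens[of 0] set_slice[of As "a 0" "b 0"] less.prems(1)
        by auto
    next
      case False
      let ?X = "\<lambda>m. mat_prod (slice As (a m) (b m))"
      have "?X ` {..short_count D} \<subseteq> short_mats D" using lens by auto
      then have "card (?X ` {..short_count D}) \<le> short_count D"
        using card_short_mats[of D] card_mono[of "short_mats D" "?X ` {..short_count D}"] by linarith
      then have "\<not> inj_on ?X {..short_count D}"
        using card_image[of ?X "{..short_count D}"] by auto
      then obtain m m' where m: "m < m'" "m' \<le> short_count D" "?X m = ?X m'"
        unfolding inj_on_def by (metis atMost_iff linorder_neqE_nat)
      have m1: "m \<le> short_count D" using m by simp
      have n1: "a m \<le> a m'" "b m' \<le> b m" using nest[of m m'] m by auto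
      have n2: "a m' \<le> b m'" using ab[OF m(2)] by auto
      \<comment> \<open>At time \<open>a m\<close> the stack is lower than \<open>r m + D\<close>,
        at time \<open>a m'\<close> it has at least \<open>r m'\<close> letters. The times therefore
        differ, which makes the slice chosen for \<open>v\<close> nonempty.\<close>
      have "r m + D \<le> r m'"
        using m(1) mult_le_mono2[of "Suc m" m' D] by (simp add: r_def)
      then have "a m \<noteq> a m'" using lens[OF m1] lens[OF m(2)] by auto
      then have strict: "a m < a m'" using n1 by simp
      let ?v = "slice As (a m) (a m')" and ?w = "slice As (a m') (b m')" and ?x = "slice As (b m') (b m)"
      have vwx: "?v @ ?w @ ?x = slice As (a m) (b m)"
        using n1 n2 by (simp add: slice_append)
      have bn: "b m < ?n" "b m' < ?n" using ab[OF m1] ab[OF m(2)] by auto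
      have bd: "b m - a m \<le> ?B"
        using nest[of 0 m] m1 False by auto
      have "length ?v = a m' - a m" "length ?w = b m' - a m'" "length ?x = b m - b m'"
        using bn n2 by (auto intro!: length_slice)
      moreover have "mat_prod (?v @ ?w @ ?x) = mat_prod ?w" using m(3) vwx by simp
      moreover have "set (?v @ ?w @ ?x) \<subseteq> G" using vwx set_slice[of As "a m" "b m"] less.prems(1) by simp
      ultimately show ?thesis
        unfolding pumpable_def using bd n1 n2 strict
        by (intro exI[of _ ?v] exI[of _ ?w] exI[of _ ?x]) auto
    qed
  qed
qed

text \<open>Every factorization of \<open>M\<close> is cut where it leaves the prefixes of the normal form of \<open>M\<close> behind
  for the last time; the number of pieces depends only on \<open>M\<close>, so a long one has a long piece.\<close>

lemma infinite_long_short: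
  assumes "finite G" "infinite (factorizations G M)"
  shows "\<exists>As. set As \<subseteq> G \<and> pump_bound D < length As \<and> mat_prod As \<in> short_mats D"
proof (rule ccontr)
  let ?B = "pump_bound D"
  assume none: "\<not> ?thesis"
  obtain As0 where As0: "As0 \<in> factorizations G M" using assms(2) by (metis finite.emptyI ex_in_conv)
  let ?wM = "concat (map \<kappa> As0)"
  have "word_mat (concat (map \<kappa> Bs)) = mat_prod Bs" if "set Bs \<subseteq> G" for Bs
    using that by (induction Bs) (auto simp: word_mat_append word)
  then have w0: "word_mat ?wM = M" using As0 by (auto simp: factorizations_def)
  have bound: "length As \<le> (length ?wM + 1) * ?B" if As: "As \<in> factorizations G M" for As
  proof -
    let ?n = "length As" and ?st = "state As"
    have AsG: "set As \<subseteq> G" and M: "mat_prod As = M" using As by (auto simp: factorizations_def)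
    have no_gap: "b - a \<le> ?B" if "mat_prod (slice As a b) \<in> short_mats D" "b \<le> ?n" for a b
    proof (rule ccontr)
      assume "\<not> b - a \<le> ?B"
      then have "?B < length (slice As a b)" using that(2) by (simp add: length_slice)
      moreover have "set (slice As a b) \<subseteq> G" by (rule subset_trans[OF set_slice AsG])
      ultimately have "set (slice As a b) \<subseteq> G \<and> ?B < length (slice As a b) \<and> mat_prod (slice As a b) \<in> short_mats D"
        using that(1) by simp
      then show False using none by blast
    qed
    let ?w = "snd (?st ?n)"
    have len_w: "length ?w \<le> length ?wM"
      using normal_length_le[OF normal_state[of As ?n], of 1 ?wM] nf_mat_state[OF AsG, of ?n] M w0
      by (simp add: scalar2_1)
    \<comment> \<open>The time \<open>a\<close> is one from which on the walk stays above the prefix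
      of length \<open>r\<close> of its final element. Its bound grows by one
      \<open>pump_bound D\<close> per letter, because each piece between successive times has a
      short product.\<close>
    have ex: "\<exists>a v. a \<le> ?n \<and> a \<le> r * ?B \<and> snd (?st a) = v @ bottom r ?w \<and> length v \<le> D \<and>
        (\<forall>i. a \<le> i \<and> i \<le> ?n \<longrightarrow> has_bottom (bottom r ?w) (snd (?st i)))"
      if "r \<le> length ?w" for r
      using that
    proof (induction r)
      case 0
      show ?case by (rule exI[of _ 0]) (auto simp: state_0 bottom_def has_bottom_def)
    next
      case (Suc r)
      then obtain a v where a: "a \<le> ?n" "a \<le> r * ?B" "snd (?st a) = v @ bottom r ?w" "length v \<le> D"
        "\<And>i. a \<le> i \<Longrightarrow> i \<le> ?n \<Longrightarrow> has_bottom (bottom r ?w) (snd (?st i))" by auto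
      let ?u = "bottom (Suc r) ?w"
      have len_u: "length ?u = Suc r" using Suc.prems by (simp add: bottom_def)
      have u: "?u = ?w ! (length ?w - Suc r) # bottom r ?w"
        using Suc.prems Cons_nth_drop_Suc[of "length ?w - Suc r" ?w] by (simp add: bottom_def Suc_diff_Suc)
      have "\<not> has_bottom ?u (snd (?st 0))" using len_u by (auto simp: state_0 has_bottom_def)
      moreover have at_n: "has_bottom ?u (snd (?st ?n))"
        unfolding bottom_def has_bottom_def by (metis append_take_drop_id)
      ultimately obtain p where lt: "p < ?n" and p: "\<not> has_bottom ?u (snd (?st p))"
        and after: "\<And>i. p < i \<Longrightarrow> i \<le> ?n \<Longrightarrow> has_bottom ?u (snd (?st i))"
        using last_failure[of "\<lambda>i. has_bottom ?u (snd (?st i))" ?n] by blast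
      let ?a = "Suc p"
      have ha: "has_bottom ?u (snd (?st ?a))" using after lt by simp
      then obtain v' where v': "snd (?st ?a) = v' @ ?u" by (auto simp: has_bottom_def)
      have "length (snd (?st ?a)) < length ?u + D"
        by (rule enter_length[OF AsG lt p ha])
      then have lv': "length v' < D" using v' by simp
      have "?a \<le> Suc r * ?B"
      proof (cases "a \<le> ?a")
        case True
        \<comment> \<open>Both states lie above the shorter prefix; the additional letter of the
          longer one is counted together with \<open>v'\<close>, whose length is less than
          \<open>D\<close>.\<close>
        have "mat_prod (slice As a ?a) \<in> short_mats D"
          using slice_short[OF AsG True a(3), of "v' @ [?w ! (length ?w - Suc r)]"] v' u a(4) lv' by simp
        then show ?thesis using no_gap[of a ?a] lt a(2) by simp
      next
        case False
        then show ?thesis using a(2) by simp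
      qed
      then show ?case
        using lt v' lv' after by (intro exI[of _ ?a] exI[of _ v']) auto
    qed
    from ex[of "length ?w"] obtain a v where a: "a \<le> ?n" "a \<le> length ?w * ?B" "snd (?st a) = v @ bottom (length ?w) ?w" "length v \<le> D"
      by auto
    have "mat_prod (slice As a ?n) \<in> short_mats D"
      using slice_short[OF AsG a(1,3), of "[]"] a(4) by (simp add: bottom_def)
    then have "?n \<le> length ?w * ?B + ?B" using no_gap[of a ?n] a(2) by simp
    also have "\<dots> \<le> length ?wM * ?B + ?B" using len_w by simp
    finally show ?thesis by simp
  qed
  have "factorizations G M \<subseteq> {As. set As \<subseteq> G \<and> length As \<le> (length ?wM + 1) * ?B}"
    using bound by (auto simp: factorizations_def)
  then show False
    using assms finite_lists_length_le[OF assms(1)] finite_subset by blast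
qed

lemma has_infinitely_factorizable_iff_pumpable:
  assumes "finite G"
  shows "has_infinitely_factorizable G \<longleftrightarrow> pumpable (pump_bound D)"
proof
  assume "has_infinitely_factorizable G"
  then show "pumpable (pump_bound D)"
    using infinite_long_short[OF assms] long_short_pumpable unfolding has_infinitely_factorizable_def by blast
next
  assume "pumpable (pump_bound D)"
  then show "has_infinitely_factorizable G"
    unfolding pumpable_def using infinitely_factorizable_if_pump by blast
qed

end


section \<open>Decidability\<close>

lemma feasible_comp2:
  "feasible P (\<lambda>p. h (fst p) (snd p)) \<Longrightarrow> feasible P f \<Longrightarrow> feasible P g \<Longrightarrow> feasible P (\<lambda>x. h (f x) (g x))"
  using feasible_comp[OF feasible_Pair, of P f g "\<lambda>p. h (fst p) (snd p)"] by simp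

lemmas feasible_intros = feasible_const feasible_id feasible_fst feasible_snd feasible_Pair feasible_Cons
  feasible_Not feasible_conj feasible_disj feasible_bool_eq feasible_if feasible_append feasible_rev
  feasible_concat feasible_map feasible_length feasible_replicate feasible_Suc feasible_add feasible_mult
  feasible_diff feasible_tl feasible_is_Nil feasible_eq0 feasible_nat_le feasible_nat_less feasible_nat_eq
  feasible_upt feasible_case_list feasible_poly

lemma feasible_Bex:
  assumes "feasible False (\<lambda>z. Q (fst z) (snd z))" "feasible False g"
  shows "feasible False (\<lambda>x. \<exists>y\<in>set (g x). Q x y)"
proof -
  have *: "foldl (\<lambda>a y. a \<or> R y) b ys \<longleftrightarrow> b \<or> (\<exists>y\<in>set ys. R y)" for R b and ys :: "'b list"
    by (induction ys arbitrary: b) auto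
  have "feasible False (\<lambda>z. Q (fst z) (snd (snd z)))"
    by (rule feasible_comp2[OF assms(1)]) (intro feasible_intros)+
  then have "feasible False (\<lambda>x. foldl (\<lambda>a y. a \<or> Q x y) False (g x))"
    using assms(2) by (intro feasible_foldl_unbounded feasible_intros)
  then show ?thesis by (simp add: *)
qed

lemma feasible_Ball:
  assumes "feasible False (\<lambda>z. Q (fst z) (snd z))" "feasible False g"
  shows "feasible False (\<lambda>x. \<forall>y\<in>set (g x). Q x y)"
  using feasible_Not[OF feasible_Bex[OF feasible_Not[OF assms(1)] assms(2)]] by simp

text \<open>The loop rule demands termination from every state, that is from every initial value of
  the counter and not only from 0. Monotonicity of \<open>Q\<close> ensures that a search started
  late still succeeds.\<close>

lemma feasible_Least:
  assumes Q: "feasible False (\<lambda>z. Q (fst z) (snd z))"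
    and ex: "\<And>x. \<exists>n. Q x n" and mono: "\<And>x n. Q x n \<Longrightarrow> Q x (Suc n)"
  shows "feasible False (\<lambda>x. LEAST n :: nat. Q x n)"
proof -
  define f where "f z = (fst z, Suc (snd z))" for z :: "'a \<times> nat"
  define N where "N z = (LEAST k. Q (fst z) (snd z + k))" for z
  have iter: "(f ^^ k) z = (fst z, snd z + k)" for k z
    by (induction k) (auto simp: f_def)
  have ex': "\<exists>k. Q x (n + k)" for x n
  proof -
    obtain m where m: "Q x m" using ex by blast
    have "Q x (m + j)" for j by (induction j) (auto intro: m mono)
    from this[of n] show ?thesis by (auto simp: add.commute)
  qed
  have N: "Q (fst z) (snd z + N z)" and N_least: "k < N z \<Longrightarrow> \<not> Q (fst z) (snd z + k)" for z k
    unfolding N_def by (rule LeastI_ex[OF ex'], rule not_less_Least)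
  have "feasible False (\<lambda>z. \<not> Q (fst z) (snd z))" "feasible False f"
    unfolding f_def by (intro feasible_intros Q)+
  then obtain cb tb cf tf where "computes cb (\<lambda>z. \<not> Q (fst z) (snd z)) tb" "computes cf f tf"
    by (auto simp: feasible_def)
  from computes_while[OF this, of N] have "feasible False (\<lambda>z. (f ^^ N z) z)"
    using N N_least by (auto simp: feasible_def iter)
  from feasible_comp[OF feasible_Pair[OF feasible_id feasible_const] this, of 0]
  have "feasible False (\<lambda>x. snd ((f ^^ N (x, 0)) (x, 0)))"
    by (intro feasible_snd)
  then show ?thesis by (simp add: iter N_def)
qed

fun words :: "nat \<Rightarrow> 'a list \<Rightarrow> 'a list list" where
  "words 0 xs = [[]]"
| "words (Suc n) xs = [] # concat (map (\<lambda>x. map (\<lambda>w. x # w) (words n xs)) xs)"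

lemma set_words: "set (words n xs) = {w. set w \<subseteq> set xs \<and> length w \<le> n}"
proof (induction n)
  case (Suc n)
  show ?case
  proof (intro set_eqI)
    show "w \<in> set (words (Suc n) xs) \<longleftrightarrow> w \<in> {w. set w \<subseteq> set xs \<and> length w \<le> Suc n}" for w
      using Suc by (cases w) auto
  qed
qed auto

lemma feasible_words: "feasible False f \<Longrightarrow> feasible False g \<Longrightarrow> feasible False (\<lambda>x. words (f x) (g x))"
proof (rule feasible_comp2[where h = words])
  have *: "foldl (\<lambda>a y. [] # concat (map (\<lambda>x. map (\<lambda>w. x # w) a) xs)) (words m xs) (replicate n ()) = words (m + n) xs"
    for m n and xs :: "'b list"
  proof (induction n arbitrary: m)
    case (Suc n)
    from Suc[of "Suc m"] show ?case by simp
  qed simp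
  have "feasible False (\<lambda>p :: nat \<times> 'b list. foldl (\<lambda>a y. [] # concat (map (\<lambda>x. map (\<lambda>w. x # w) a) (snd p)))
      [[]] (replicate (fst p) ()))"
    by (intro feasible_foldl_unbounded feasible_intros)
  then show "feasible False (\<lambda>p :: nat \<times> 'b list. words (fst p) (snd p))"
    using *[where m = 0] by simp
qed

lemma feasible_power: "feasible False f \<Longrightarrow> feasible False (\<lambda>x. b ^ f x :: nat)"
proof -
  assume f: "feasible False f"
  have *: "foldl (\<lambda>a y. a * b) m (replicate n ()) = m * b ^ n" for m n
    by (induction n arbitrary: m) auto
  have "feasible False (\<lambda>x. foldl (\<lambda>a y. a * b) 1 (replicate (f x) ()))"
    using f by (intro feasible_foldl_unbounded feasible_intros)
  then show ?thesis by (simp add: *)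
qed

lemma feasible_word_eq: "feasible False f \<Longrightarrow> feasible False g \<Longrightarrow> feasible False (\<lambda>x. f x = (g x :: bool list))"
proof (rule feasible_comp2[where h = "\<lambda>v w. v = w"])
  let ?step = "\<lambda>s :: bool \<times> bool list. \<lambda>x. case snd s of [] \<Rightarrow> (False, []) | y # ys \<Rightarrow> (fst s \<and> x = y, ys)"
  have *: "fst (foldl ?step (b, ys) xs) \<and> snd (foldl ?step (b, ys) xs) = [] \<longleftrightarrow> b \<and> xs = ys" for b xs ys
    by (induction xs arbitrary: b ys) (auto split: list.split)
  have "feasible False (\<lambda>p :: bool list \<times> bool list. foldl ?step (True, snd p) (fst p))"
    by (intro feasible_foldl_unbounded feasible_intros)
  then have "feasible False (\<lambda>p :: bool list \<times> bool list. fst (foldl ?step (True, snd p) (fst p)) \<and>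
      snd (foldl ?step (True, snd p) (fst p)) = [])"
    by (intro feasible_conj feasible_fst feasible_is_Nil feasible_snd)
  then show "feasible False (\<lambda>p :: bool list \<times> bool list. fst p = snd p)"
    unfolding * by simp
qed

lemma feasible_delimit: "feasible P f \<Longrightarrow> feasible P (\<lambda>x. delimit (f x))"
  unfolding delimit_def by (intro feasible_intros)

lemma feasible_half: "feasible False f \<Longrightarrow> feasible False (\<lambda>x. (f x div 2 :: nat, odd (f x)))"
proof -
  assume f: "feasible False f"
  let ?step = "\<lambda>s :: nat \<times> bool. \<lambda>y :: unit. if snd s then (Suc (fst s), False) else (fst s, True)"
  have *: "foldl ?step (0, False) (replicate n ()) = (n div 2, odd n)" for n
  proof (induction n)
    case (Suc n)
    have "replicate (Suc n) () = replicate n () @ [()]" by (simp add: replicate_append_same)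
    then have "foldl ?step (0, False) (replicate (Suc n) ()) = ?step (n div 2, odd n) ()"
      using Suc by (simp only: List.foldl_append foldl.simps)
    then show ?case by auto
  qed simp
  have "feasible False (\<lambda>x. foldl ?step (0, False) (replicate (f x) ()))"
    using f by (intro feasible_foldl_unbounded feasible_intros)
  then show ?thesis unfolding * .
qed

text \<open>The unary number itself serves as the counter of the loop: halving \<open>n\<close>
  times certainly reaches 0, and further rounds change nothing.\<close>

lemma feasible_nat_bits: "feasible False f \<Longrightarrow> feasible False (\<lambda>x. nat_bits (f x))"
proof -
  assume f: "feasible False f"
  let ?step = "\<lambda>s :: nat \<times> bool list. \<lambda>y :: unit. if fst s = 0 then s
    else (fst (fst s div 2, odd (fst s)), snd s @ [snd (fst s div 2, odd (fst s))])"
  have *: "foldl ?step (m, bs) (replicate n ()) = (0, bs @ nat_bits m)" if "m \<le> n" for m n bs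
    using that
  proof (induction n arbitrary: m bs)
    case 0
    then show ?case by (simp add: nat_bits.simps)
  next
    case (Suc n)
    show ?case
    proof (cases "m = 0")
      case True
      then show ?thesis using Suc.IH[of 0 bs] by simp
    next
      case False
      then have "m div 2 \<le> n" using Suc.prems by simp
      from Suc.IH[OF this, of "bs @ [odd m]"] show ?thesis
        using False nat_bits.simps[of m] by simp
    qed
  qed
  have "feasible False (\<lambda>x. snd (foldl ?step (f x, []) (replicate (f x) ())))"
    using f by (intro feasible_snd feasible_foldl_unbounded feasible_half feasible_intros)
  then show ?thesis using * by simp
qed

text \<open>Integers are formal differences of unary naturals, so that sums, products and equality
  are computed without distinguishing signs.\<close>

type_synonym entry = "nat \<times> nat"
type_synonym entries = "(entry \<times> entry) \<times> (entry \<times> entry)"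

definition entry_val :: "entry \<Rightarrow> int" where
  "entry_val a = int (fst a) - int (snd a)"

definition entry_add :: "entry \<Rightarrow> entry \<Rightarrow> entry" where
  "entry_add a b = (fst a + fst b, snd a + snd b)"

definition entry_mult :: "entry \<Rightarrow> entry \<Rightarrow> entry" where
  "entry_mult a b = (fst a * fst b + snd a * snd b, fst a * snd b + snd a * fst b)"

definition entry_eq :: "entry \<Rightarrow> entry \<Rightarrow> bool" where
  "entry_eq a b \<longleftrightarrow> fst a + snd b = fst b + snd a"

definition entry_code :: "entry \<Rightarrow> bool list" where
  "entry_code a = (fst a < snd a) # delimit (nat_bits ((fst a - snd a) + (snd a - fst a)))"

lemma entry_simps:
  "entry_val (entry_add a b) = entry_val a + entry_val b"
  "entry_val (entry_mult a b) = entry_val a * entry_val b"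
  "entry_eq a b \<longleftrightarrow> entry_val a = entry_val b"
  "entry_code a = int_code (entry_val a)"
proof -
  have "nat \<bar>int (fst a) - int (snd a)\<bar> = (fst a - snd a) + (snd a - fst a)" by linarith
  then show "entry_code a = int_code (entry_val a)"
    by (simp add: entry_code_def int_code_def entry_val_def)
qed (auto simp: entry_val_def entry_add_def entry_mult_def entry_eq_def algebra_simps)

lemma feasible_entry:
  assumes "feasible False f" "feasible False g"
  shows "feasible False (\<lambda>x. entry_add (f x) (g x))" "feasible False (\<lambda>x. entry_mult (f x) (g x))"
    "feasible False (\<lambda>x. entry_eq (f x) (g x))"
  unfolding entry_add_def entry_mult_def entry_eq_def
  by (intro feasible_intros assms)+

lemma feasible_entry_code: "feasible False f \<Longrightarrow> feasible False (\<lambda>x. entry_code (f x))"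
  unfolding entry_code_def by (intro feasible_intros feasible_delimit feasible_nat_bits)

definition mat_of :: "entries \<Rightarrow> int^2^2" where
  "mat_of A = mat2 (entry_val (fst (fst A))) (entry_val (snd (fst A))) (entry_val (fst (snd A))) (entry_val (snd (snd A)))"

definition entries_mult :: "entries \<Rightarrow> entries \<Rightarrow> entries" where
  "entries_mult A B =
    ((entry_add (entry_mult (fst (fst A)) (fst (fst B))) (entry_mult (snd (fst A)) (fst (snd B))),
      entry_add (entry_mult (fst (fst A)) (snd (fst B))) (entry_mult (snd (fst A)) (snd (snd B)))),
     (entry_add (entry_mult (fst (snd A)) (fst (fst B))) (entry_mult (snd (snd A)) (fst (snd B))),
      entry_add (entry_mult (fst (snd A)) (snd (fst B))) (entry_mult (snd (snd A)) (snd (snd B)))))"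

definition entries_eq :: "entries \<Rightarrow> entries \<Rightarrow> bool" where
  "entries_eq A B \<longleftrightarrow> entry_eq (fst (fst A)) (fst (fst B)) \<and> entry_eq (snd (fst A)) (snd (fst B)) \<and>
    entry_eq (fst (snd A)) (fst (snd B)) \<and> entry_eq (snd (snd A)) (snd (snd B))"

definition entries_det1 :: "entries \<Rightarrow> bool" where
  "entries_det1 A \<longleftrightarrow> entry_eq (entry_mult (fst (fst A)) (snd (snd A)))
    (entry_add (entry_mult (snd (fst A)) (fst (snd A))) (1, 0))"

definition entries_code :: "entries \<Rightarrow> bool list" where
  "entries_code A = entry_code (fst (fst A)) @ entry_code (snd (fst A)) @ entry_code (fst (snd A)) @ entry_code (snd (snd A))"

lemma entries_simps:
  "mat_of (entries_mult A B) = mat_of A ** mat_of B"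
  "entries_eq A B \<longleftrightarrow> mat_of A = mat_of B"
  "entries_det1 A \<longleftrightarrow> mat_of A \<in> SL2Z"
  "entries_code A = matrix_code (mat_of A)"
  unfolding mat_of_def entries_mult_def entries_eq_def entries_det1_def entries_code_def matrix_code_def
  by (auto simp: entry_simps SL2Z_mat2) (auto simp: entry_val_def)

lemma feasible_entries:
  assumes "feasible False f" "feasible False g"
  shows "feasible False (\<lambda>x. entries_mult (f x) (g x))" "feasible False (\<lambda>x. entries_eq (f x) (g x))"
  unfolding entries_mult_def entries_eq_def by (intro feasible_intros feasible_entry assms)+

lemma feasible_entries_unary:
  assumes "feasible False f"
  shows "feasible False (\<lambda>x. entries_det1 (f x))" "feasible False (\<lambda>x. entries_code (f x))"
  unfolding entries_det1_def entries_code_def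
  by (intro feasible_intros feasible_entry feasible_entry_code assms)+

definition entries_prod :: "entries list \<Rightarrow> entries" where
  "entries_prod As = foldl entries_mult (((1, 0), (0, 0)), ((0, 0), (1, 0))) As"

lemma mat_of_entries_prod: "mat_of (entries_prod As) = mat_prod (map mat_of As)"
proof -
  have "mat_of (foldl entries_mult A As) = mat_of A ** mat_prod (map mat_of As)" for A
    by (induction As arbitrary: A) (auto simp: entries_simps matrix_mul_assoc)
  moreover have "mat_of (((1, 0), (0, 0)), ((0, 0), (1, 0))) = mat 1"
    by (simp add: mat_of_def entry_val_def mat_1_mat2)
  ultimately show ?thesis by (simp add: entries_prod_def)
qed

lemma feasible_entries_prod: "feasible False f \<Longrightarrow> feasible False (\<lambda>x. entries_prod (f x))"
  unfolding entries_prod_def by (intro feasible_foldl_unbounded feasible_entries feasible_intros)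

definition entries_instance_code :: "entries list \<Rightarrow> bool list" where
  "entries_instance_code As = concat (map (\<lambda>A. True # entries_code A) As) @ [False]"

lemma entries_instance_code: "entries_instance_code As = instance_code (map mat_of As)"
  by (simp add: entries_instance_code_def instance_code_def entries_simps comp_def)

section \<open>The bounded search\<close>

definition letter_entries :: "entries list" where
  "letter_entries = [(((0, 0), (0, 1)), ((1, 0), (0, 0))), (((0, 0), (0, 1)), ((1, 0), (1, 0))),
     (((1, 0), (1, 0)), ((0, 1), (0, 0)))]"

lemma mat_of_letter_entries: "mat_of ` set letter_entries = range letter_mat"
proof -
  have L: "(UNIV :: letter set) = {S, U, V}" using letter.exhaust by blast
  show ?thesis unfolding L by (simp add: letter_entries_def mat_of_def entry_val_def)
qed

lemma letter_words_entries:
  "(\<exists>w\<in>set (words n letter_entries). entries_eq (entries_prod w) A) \<longleftrightarrow>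
   (\<exists>w. length w \<le> n \<and> word_mat w = mat_of A)"
proof
  assume "\<exists>w\<in>set (words n letter_entries). entries_eq (entries_prod w) A"
  then obtain w where w: "set w \<subseteq> set letter_entries" "length w \<le> n" "mat_prod (map mat_of w) = mat_of A"
    by (auto simp: set_words entries_simps mat_of_entries_prod)
  have "\<exists>l. letter_mat l = mat_of B" if "B \<in> set w" for B
  proof -
    have "mat_of B \<in> range letter_mat" using that w(1) mat_of_letter_entries by blast
    then show ?thesis by auto
  qed
  then obtain l where "\<forall>B\<in>set w. letter_mat (l B) = mat_of B" by metis
  then have "map letter_mat (map l w) = map mat_of w" by simp
  then show "\<exists>w. length w \<le> n \<and> word_mat w = mat_of A"
    using w unfolding word_mat_def by (metis length_map)
next
  assume "\<exists>w. length w \<le> n \<and> word_mat w = mat_of A"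
  then obtain w where w: "length w \<le> n" "word_mat w = mat_of A" by blast
  have "\<exists>B. B \<in> set letter_entries \<and> mat_of B = letter_mat l" for l
    using mat_of_letter_entries by (metis imageE rangeI)
  then obtain B where B: "\<And>l. B l \<in> set letter_entries \<and> mat_of (B l) = letter_mat l" by metis
  then have "map mat_of (map B w) = map letter_mat w" by simp
  then have "entries_eq (entries_prod (map B w)) A"
    using w(2) by (simp only: entries_simps mat_of_entries_prod word_mat_def)
  moreover have "map B w \<in> set (words n letter_entries)"
    using B w(1) by (auto simp: set_words)
  ultimately show "\<exists>w\<in>set (words n letter_entries). entries_eq (entries_prod w) A" by blast
qed

definition letters_suffice :: "entries list \<Rightarrow> nat \<Rightarrow> bool" where
  "letters_suffice As n \<longleftrightarrow>
    (\<forall>A\<in>set As. \<not> entries_det1 A \<or> (\<exists>w\<in>set (words n letter_entries). entries_eq (entries_prod w) A))"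

text \<open>The word length that the generators require is found by search rather than extracted
  from Euclid's algorithm. Matrices outside SL(2,Z) are exempted in \<open>letters_suffice\<close>,
  so that the search ends on every input.\<close>

definition letter_bound :: "entries list \<Rightarrow> nat" where
  "letter_bound As = (LEAST n. letters_suffice As n)"

lemma ex_letters_suffice: "\<exists>n. letters_suffice As n"
proof -
  have "\<exists>w. mat_of A \<in> SL2Z \<longrightarrow> word_mat w = mat_of A" for A using SL2Z_words by blast
  then obtain w where w: "\<And>A. mat_of A \<in> SL2Z \<longrightarrow> word_mat (w A) = mat_of A" by metis
  have "length (w A) \<le> Max (insert 0 ((\<lambda>A. length (w A)) ` set As))" if "A \<in> set As" for A
    using that by (intro Max_ge) auto
  then show ?thesis
    unfolding letters_suffice_def letter_words_entries entries_simps(3) using w by blast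
qed

lemma letters_suffice_Suc: "letters_suffice As n \<Longrightarrow> letters_suffice As (Suc n)"
  unfolding letters_suffice_def letter_words_entries using le_SucI by blast

lemma feasible_letter_bound: "feasible False f \<Longrightarrow> feasible False (\<lambda>x. letter_bound (f x))"
proof (rule feasible_comp[of False f letter_bound])
  have "feasible False (\<lambda>z. letters_suffice (fst z) (snd z))"
    unfolding letters_suffice_def
    by (intro feasible_Ball feasible_Bex feasible_entries feasible_entries_unary feasible_entries_prod feasible_words feasible_intros)
  then show "feasible False letter_bound"
    unfolding letter_bound_def[abs_def] using ex_letters_suffice letters_suffice_Suc by (rule feasible_Least)
qed

definition pump_test :: "entries list \<Rightarrow> entries list list \<Rightarrow> bool" where
  "pump_test As W \<longleftrightarrow> (\<exists>v\<in>set W. \<exists>w\<in>set W. \<exists>x\<in>set W. \<not> v @ x = [] \<and>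
     entries_eq (entries_prod (v @ w @ x)) (entries_prod w))"

definition entry_candidates :: "nat \<Rightarrow> entry list" where
  "entry_candidates n = concat (map (\<lambda>p. map (\<lambda>q. (p, q)) [0..<n]) [0..<n])"

definition candidates :: "nat \<Rightarrow> entries list" where
  "candidates n = (let E = entry_candidates n; R = concat (map (\<lambda>p. map (\<lambda>q. (p, q)) E) E) in
     concat (map (\<lambda>p. map (\<lambda>q. (p, q)) R) R))"

lemma set_concat_pairs: "set (concat (map (\<lambda>p. map (\<lambda>q. (p, q)) ys) xs)) = set xs \<times> set ys"
  by auto

lemma set_candidates: "set (candidates n) = (({..<n} \<times> {..<n}) \<times> ({..<n} \<times> {..<n})) \<times> (({..<n} \<times> {..<n}) \<times> ({..<n} \<times> {..<n}))"
proof -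
  have "set [0..<n] = {..<n}" by auto
  then show ?thesis
    unfolding candidates_def Let_def entry_candidates_def
    by (simp only: set_concat_pairs)
qed

text \<open>There is no parser: all lists of matrices that are small enough to have the code \<open>w\<close> are tried.\<close>

definition decision :: "bool list \<Rightarrow> bool" where
  "decision w \<longleftrightarrow> (\<exists>As\<in>set (words (length w) (candidates (2 ^ length w))).
     entries_instance_code As = w \<and> (\<forall>A\<in>set As. entries_det1 A) \<and>
     pump_test As (words (pump_bound (letter_bound As)) As))"

lemma feasible_decision: "feasible False decision"
proof -
  have pb: "feasible False (\<lambda>x. pump_bound (f x))" if "feasible False f" for f :: "'z::enc \<Rightarrow> nat"
    unfolding pump_bound_def height_bound_def short_count_def by (intro feasible_intros feasible_power that)
  have ca: "feasible False (\<lambda>x. candidates (f x))" if "feasible False f" for f :: "'z::enc \<Rightarrow> nat"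
  proof (rule feasible_comp[OF that])
    show "feasible False candidates"
      unfolding candidates_def[abs_def] Let_def entry_candidates_def by (intro feasible_intros)
  qed
  have pt: "feasible False (\<lambda>x. pump_test (f x) (g x))" if "feasible False f" "feasible False g"
    for f :: "bool list \<times> entries list \<Rightarrow> entries list" and g
    by (rule feasible_comp2[OF _ that], unfold pump_test_def)
      (intro feasible_Bex feasible_entries feasible_entries_prod feasible_intros)
  show ?thesis
    unfolding decision_def[abs_def] entries_instance_code_def
    by (intro feasible_Bex feasible_Ball feasible_words feasible_word_eq feasible_entries_unary pt pb ca
      feasible_letter_bound feasible_power feasible_intros)
qed

lemma nat_bits_length: "n < 2 ^ length (nat_bits n)"
proof (induction n rule: less_induct)
  case (less n)
  show ?case
  proof (cases "n = 0")
    case False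
    then have "n div 2 < 2 ^ length (nat_bits (n div 2))" using less by simp
    then show ?thesis using False by (subst nat_bits.simps) auto
  qed simp
qed

lemma length_delimit: "length (delimit w) = 2 * length w + 1"
  by (induction w) (auto simp: delimit_def)

lemma int_code_bound: "length (int_code i) \<le> n \<Longrightarrow> nat \<bar>i\<bar> < 2 ^ n"
proof -
  assume "length (int_code i) \<le> n"
  then have "length (nat_bits (nat \<bar>i\<bar>)) \<le> n" by (simp add: int_code_def length_delimit)
  then have "(2::nat) ^ length (nat_bits (nat \<bar>i\<bar>)) \<le> 2 ^ n" by (intro power_increasing) auto
  then show ?thesis using nat_bits_length[of "nat \<bar>i\<bar>"] by linarith
qed

lemma instance_code_bound:
  "length As \<le> length (instance_code As)"
  "A \<in> set As \<Longrightarrow> length (matrix_code A) \<le> length (instance_code As)"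
  by (induction As) (auto simp: instance_code_def)

lemma ex_candidate:
  assumes "length (matrix_code A) \<le> n"
  shows "\<exists>B\<in>set (candidates (2 ^ n)). mat_of B = A"
proof -
  define e :: "int \<Rightarrow> entry" where "e i = (nat i, nat (- i))" for i
  have e: "entry_val (e i) = i" for i by (simp add: e_def entry_val_def)
  have e': "e i \<in> {..<2 ^ n} \<times> {..<2 ^ n}" if "length (int_code i) \<le> n" for i
    using int_code_bound[OF that] by (auto simp: e_def)
  obtain a b c d where A: "A = mat2 a b c d" by (rule mat2_cases)
  have "((e a, e b), (e c, e d)) \<in> set (candidates (2 ^ n))"
    unfolding set_candidates using assms e' by (intro SigmaI) (auto simp: A matrix_code_def simp del: mem_Times_iff)
  moreover have "mat_of ((e a, e b), (e c, e d)) = A" by (simp add: mat_of_def e A)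
  ultimately show ?thesis by blast
qed

lemma pump_test_iff:
  assumes "\<forall>A\<in>set As. mat_of A \<in> SL2Z"
  shows "pump_test As (words (pump_bound (letter_bound As)) As) \<longleftrightarrow> has_infinitely_factorizable (set (map mat_of As))"
proof -
  let ?D = "letter_bound As" and ?G = "set (map mat_of As)"
  have "letters_suffice As ?D"
    unfolding letter_bound_def using ex_letters_suffice by (rule LeastI_ex)
  then have "\<forall>M\<in>?G. \<exists>w. length w \<le> ?D \<and> word_mat w = M"
    using assms unfolding letters_suffice_def letter_words_entries entries_simps(3) by simp
  then obtain \<kappa> where \<kappa>: "\<And>M. M \<in> ?G \<Longrightarrow> length (\<kappa> M) \<le> ?D \<and> word_mat (\<kappa> M) = M" by metis
  interpret letter_words ?G \<kappa> ?D by unfold_locales (use \<kappa> in auto)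
  \<comment> \<open>A matrix has many representations by differences of naturals; the test ranges
    over those listed in \<open>As\<close>, so words must be lifted to these.\<close>
  have lift: "\<exists>us'. set us' \<subseteq> set As \<and> map mat_of us' = us" if "set us \<subseteq> ?G" for us
    using that
  proof (induction us)
    case (Cons u us)
    then obtain us' where "set us' \<subseteq> set As" "map mat_of us' = us" by auto
    moreover obtain A where "A \<in> set As" "mat_of A = u" using Cons.prems by auto
    ultimately show ?case by (intro exI[of _ "A # us'"]) simp
  qed simp
  have "pump_test As (words (pump_bound ?D) As) \<longleftrightarrow> pumpable (pump_bound ?D)"
  proof
    assume "pump_test As (words (pump_bound ?D) As)"
    then obtain v w x where "set v \<subseteq> set As" "set w \<subseteq> set As" "set x \<subseteq> set As"
      "length v \<le> pump_bound ?D" "length w \<le> pump_bound ?D" "length x \<le> pump_bound ?D" "v @ x \<noteq> []"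
      "mat_prod (map mat_of v @ map mat_of w @ map mat_of x) = mat_prod (map mat_of w)"
      by (auto simp: pump_test_def set_words entries_simps mat_of_entries_prod)
    then show "pumpable (pump_bound ?D)"
      unfolding pumpable_def
      by (intro exI[of _ "map mat_of v"] exI[of _ "map mat_of w"] exI[of _ "map mat_of x"]) auto
  next
    assume "pumpable (pump_bound ?D)"
    then obtain v w x where vwx: "set v \<subseteq> ?G" "set w \<subseteq> ?G" "set x \<subseteq> ?G"
      "length v \<le> pump_bound ?D" "length w \<le> pump_bound ?D" "length x \<le> pump_bound ?D" "v @ x \<noteq> []"
      "mat_prod (v @ w @ x) = mat_prod w"
      unfolding pumpable_def by auto
    obtain v' w' x' where l: "set v' \<subseteq> set As" "map mat_of v' = v" "set w' \<subseteq> set As" "map mat_of w' = w"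
      "set x' \<subseteq> set As" "map mat_of x' = x"
      using lift[OF vwx(1)] lift[OF vwx(2)] lift[OF vwx(3)] by blast
    have "entries_eq (entries_prod (v' @ w' @ x')) (entries_prod w')"
      using vwx(8) by (simp add: entries_simps mat_of_entries_prod l)
    moreover have "v' @ x' \<noteq> []" using vwx(7) l by auto
    moreover have "v' \<in> set (words (pump_bound ?D) As)" "w' \<in> set (words (pump_bound ?D) As)"
      "x' \<in> set (words (pump_bound ?D) As)"
      using vwx(4-6) l by (auto simp: set_words)
    ultimately show "pump_test As (words (pump_bound ?D) As)"
      unfolding pump_test_def by blast
  qed
  then show ?thesis using has_infinitely_factorizable_iff_pumpable by simp
qed

lemma decision_correct: "decision w \<longleftrightarrow> w \<in> infinite_factorization_problem"
proof
  assume "decision w"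
  then obtain As where As: "entries_instance_code As = w" "\<forall>A\<in>set As. entries_det1 A"
    "pump_test As (words (pump_bound (letter_bound As)) As)"
    unfolding decision_def by blast
  then show "w \<in> infinite_factorization_problem"
    using pump_test_iff[of As] unfolding infinite_factorization_problem_def
    by (auto simp: entries_simps entries_instance_code intro!: exI[of _ "map mat_of As"])
next
  assume "w \<in> infinite_factorization_problem"
  then obtain Ms where Ms: "w = instance_code Ms" "set Ms \<subseteq> SL2Z" "has_infinitely_factorizable (set Ms)"
    unfolding infinite_factorization_problem_def by blast
  have "\<exists>B. M \<in> set Ms \<longrightarrow> B \<in> set (candidates (2 ^ length w)) \<and> mat_of B = M" for M
    using ex_candidate instance_code_bound(2)[of M Ms] Ms(1) by blast
  then obtain B where B: "\<And>M. M \<in> set Ms \<longrightarrow> B M \<in> set (candidates (2 ^ length w)) \<and> mat_of (B M) = M" by metis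
  let ?As = "map B Ms"
  have Ms': "map mat_of ?As = Ms" using B by (simp add: map_idI)
  have "?As \<in> set (words (length w) (candidates (2 ^ length w)))"
    using B instance_code_bound(1)[of Ms] Ms(1) by (auto simp: set_words)
  moreover have "entries_instance_code ?As = w" unfolding entries_instance_code Ms' Ms(1) ..
  moreover have sl: "\<forall>A\<in>set ?As. mat_of A \<in> SL2Z" using B Ms(2) by auto
  moreover have "pump_test ?As (words (pump_bound (letter_bound ?As)) ?As)"
    using pump_test_iff[OF sl] Ms(3) unfolding Ms' by simp
  ultimately show "decision w"
    unfolding decision_def by (intro bexI[of _ ?As]) (auto simp: entries_simps)
qed

lemma decidable_infinite_factorization_problem: "decidable infinite_factorization_problem"
  using feasible_decision decision_correct by (intro decidable_if_feasible) (simp add: decision_correct[symmetric])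


section \<open>From sums with repetition to factorizations\<close>

text \<open>In terms of the two free generators, the matrices defined here are \<open>a^x\<close>,
  \<open>b a^-t\<close> and \<open>b^-1 a^t\<close>, in this order.\<close>

definition shift_mat :: "int \<Rightarrow> int^2^2" where
  "shift_mat x = mat2 1 (2 * x) 0 1"

definition open_mat :: "int \<Rightarrow> int^2^2" where
  "open_mat t = mat2 1 (- 2 * t) 2 (1 - 4 * t)"

definition close_mat :: "int \<Rightarrow> int^2^2" where
  "close_mat t = mat2 1 (2 * t) (- 2) (1 - 4 * t)"

definition sum_mats :: "int set \<Rightarrow> int \<Rightarrow> (int^2^2) set" where
  "sum_mats X t = {open_mat t, close_mat t} \<union> shift_mat ` X"

lemma sum_mats_SL2Z: "sum_mats X t \<subseteq> SL2Z"
  by (auto simp: sum_mats_def open_mat_def close_mat_def shift_mat_def SL2Z_mat2)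

lemma mat_prod_shift: "mat_prod (map shift_mat xs) = shift_mat (sum_list xs)"
  by (induction xs) (auto simp: shift_mat_def mat_1_mat2)

lemma sum_mats_infinite:
  assumes "set xs \<subseteq> X" "sum_list xs = t"
  shows "has_infinitely_factorizable (sum_mats X t)"
proof (rule infinitely_factorizable_if_pump)
  show "set ([open_mat t] @ map shift_mat xs @ [close_mat t]) \<subseteq> sum_mats X t"
    using assms(1) by (auto simp: sum_mats_def)
  show "mat_prod ([open_mat t] @ map shift_mat xs @ [close_mat t]) = mat_prod (map shift_mat xs)"
    by (simp add: mat_prod_append mat_prod_shift assms(2))
      (simp add: open_mat_def close_mat_def shift_mat_def mat_1_mat2 algebra_simps)
qed simp

text \<open>Both non-shift generators are a power of [[1,0],[2,1]] with exponent 1 or -1, followed by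
  a power of [[1,2],[0,1]]. If no exponent of the latter cancels, ping-pong shows that the row
  vector (1,2) grows along every product, which bounds the length of its factorizations.\<close>

definition row_bounded :: "int set \<Rightarrow> int \<Rightarrow> int \<Rightarrow> int \<Rightarrow> nat \<Rightarrow> bool" where
  "row_bounded X t p q n \<longleftrightarrow> (\<exists>q0 c ys. set ys \<subseteq> X \<and> c \<in> {1, t, - t} \<and> q = q0 + 2 * (c + sum_list ys) * p \<and>
     \<bar>q0\<bar> < \<bar>p\<bar> \<and> int n \<le> \<bar>p\<bar> * (\<bar>p\<bar> + t + 1) + int (length ys))"

lemma length_le_sum_list:
  fixes ys :: "int list"
  assumes "\<And>x. x \<in> set ys \<Longrightarrow> 0 < x"
  shows "int (length ys) \<le> sum_list ys"
  using assms by (induction ys) force+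

text \<open>The factor \<open>c + sum_list ys\<close> is never 0: it is positive if \<open>c\<close>
  is 1 or \<open>t\<close>, and for \<open>c = - t\<close> it would exhibit \<open>t\<close> as a
  sum. As \<open>q0\<close> is smaller than \<open>p\<close> in absolute value, \<open>q\<close>
  exceeds \<open>p\<close>. The factor is also at most the absolute value of \<open>q\<close>, so
  \<open>q\<close> bounds the number of the positive summands \<open>ys\<close>.\<close>

lemma row_bounded_length:
  assumes "row_bounded X t p q n" "\<And>x. x \<in> X \<Longrightarrow> 0 < x" "0 < t" "\<nexists>ys. set ys \<subseteq> X \<and> sum_list ys = t"
  shows "int n \<le> \<bar>p\<bar> * (\<bar>p\<bar> + t + 1) + \<bar>q\<bar> + t" "\<bar>p\<bar> < \<bar>q\<bar>"
proof -
  obtain q0 c ys where ys: "set ys \<subseteq> X" "c \<in> {1, t, - t}" "q = q0 + 2 * (c + sum_list ys) * p"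
    "\<bar>q0\<bar> < \<bar>p\<bar>" "int n \<le> \<bar>p\<bar> * (\<bar>p\<bar> + t + 1) + int (length ys)"
    using assms(1) by (auto simp: row_bounded_def)
  define f where "f = c + sum_list ys"
  have len: "int (length ys) \<le> sum_list ys" using length_le_sum_list[of ys] ys(1) assms(2) by blast
  have "f \<noteq> 0"
  proof
    assume "f = 0"
    then have "sum_list ys = t" using ys(2) len assms(3) by (auto simp: f_def)
    then show False using assms(4) ys(1) by blast
  qed
  then have f1: "1 \<le> \<bar>f\<bar>" by simp
  have "\<bar>2 * f * p\<bar> \<le> \<bar>q\<bar> + \<bar>q0\<bar>" using ys(3) unfolding f_def by linarith
  then have le: "2 * (\<bar>f\<bar> * \<bar>p\<bar>) \<le> \<bar>q\<bar> + \<bar>q0\<bar>" by (simp add: abs_mult)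
  have "1 * \<bar>p\<bar> \<le> \<bar>f\<bar> * \<bar>p\<bar>" using f1 by (intro mult_right_mono) auto
  then show "\<bar>p\<bar> < \<bar>q\<bar>" using le ys(4) by linarith
  have "\<bar>f\<bar> * 1 \<le> \<bar>f\<bar> * \<bar>p\<bar>" using ys(4) by (intro mult_left_mono) auto
  moreover have "\<bar>p\<bar> \<le> \<bar>f\<bar> * \<bar>p\<bar>" using \<open>1 * \<bar>p\<bar> \<le> \<bar>f\<bar> * \<bar>p\<bar>\<close> by simp
  ultimately have "\<bar>f\<bar> \<le> \<bar>q\<bar>" using le ys(4) by linarith
  moreover have "sum_list ys \<le> \<bar>f\<bar> + t" using ys(2) assms(3) by (auto simp: f_def)
  ultimately show "int n \<le> \<bar>p\<bar> * (\<bar>p\<bar> + t + 1) + \<bar>q\<bar> + t" using len ys(5) by linarith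
qed

text \<open>\<open>ys\<close> collects the shifts since the last open or close factor,
  \<open>c\<close> the exponent which that factor contributed, and \<open>q0\<close> the second
  coordinate just before it. The value 1 of \<open>c\<close> belongs to the initial row: (1, 2) has
  \<open>q0 = 0\<close> and \<open>q = 2 * 1 * p\<close>.\<close>

lemma row_bounded_mat_prod:
  assumes X: "\<And>x. x \<in> X \<Longrightarrow> 0 < x" "0 < t" "\<nexists>ys. set ys \<subseteq> X \<and> sum_list ys = t"
    and "set As \<subseteq> sum_mats X t" "mat_prod As = mat2 a b c d"
  shows "row_bounded X t (a + 2 * c) (b + 2 * d) (length As)"
  using assms(4,5)
proof (induction As arbitrary: a b c d rule: rev_induct)
  case Nil
  then have "a = 1" "b = 0" "c = 0" "d = 1" by (simp_all add: mat_1_mat2)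
  then show ?case unfolding row_bounded_def using assms(2) by (intro exI[of _ 0] exI[of _ 1] exI[of _ "[]"]) auto
next
  case (snoc A As)
  obtain a' b' c' d' where m: "mat_prod As = mat2 a' b' c' d'" by (rule mat2_cases)
  define p q where "p = a' + 2 * c'" and "q = b' + 2 * d'"
  have IH: "row_bounded X t p q (length As)"
    using snoc.IH[OF _ m] snoc.prems(1) by (simp add: p_def q_def)
  have prod: "mat2 a b c d = mat2 a' b' c' d' ** A"
    using snoc.prems(2) m by (simp add: mat_prod_append)
  have grow: "row_bounded X t p' q' (Suc (length As))"
    if p': "p' = p + 2 * q \<or> p' = p - 2 * q" and q': "q' = q + 2 * e * p'" and e: "e \<in> {t, - t}" for p' q' e
  proof -
    have n: "int (length As) \<le> \<bar>p\<bar> * (\<bar>p\<bar> + t + 1) + \<bar>q\<bar> + t" and pq: "\<bar>p\<bar> < \<bar>q\<bar>"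
      using row_bounded_length[OF IH X] by auto
    have qp': "\<bar>q\<bar> < \<bar>p'\<bar>" using p' pq by linarith
    \<comment> \<open>The first coordinate grows with every open or close factor. The quadratic term
      then increases by at least \<open>\<bar>p'\<bar> + t + 1\<close>, which pays for the earlier
      shifts, at most \<open>\<bar>q\<bar> + t\<close>, and for the new factor.\<close>
    have "(\<bar>p\<bar> + 1) * (\<bar>p'\<bar> + t + 1) \<le> \<bar>p'\<bar> * (\<bar>p'\<bar> + t + 1)"
      using qp' pq X(2) by (intro mult_right_mono) auto
    moreover have "\<bar>p\<bar> * (\<bar>p\<bar> + t + 1) \<le> \<bar>p\<bar> * (\<bar>p'\<bar> + t + 1)"
      using qp' pq by (intro mult_left_mono) auto
    ultimately have "\<bar>p\<bar> * (\<bar>p\<bar> + t + 1) + (\<bar>p'\<bar> + t + 1) \<le> \<bar>p'\<bar> * (\<bar>p'\<bar> + t + 1)"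
      by (simp add: distrib_right)
    then have "int (Suc (length As)) \<le> \<bar>p'\<bar> * (\<bar>p'\<bar> + t + 1)" using n qp' by linarith
    then show ?thesis
      unfolding row_bounded_def using e q' qp' by (intro exI[of _ q] exI[of _ e] exI[of _ "[]"]) auto
  qed
  have "A \<in> sum_mats X t" using snoc.prems(1) by simp
  then consider "A = open_mat t" | "A = close_mat t" | x where "x \<in> X" "A = shift_mat x"
    by (auto simp: sum_mats_def)
  then show ?case
  proof cases
    case 1
    then have "a + 2 * c = p + 2 * q" "b + 2 * d = q + 2 * (- t) * (p + 2 * q)"
      using prod by (simp_all add: open_mat_def p_def q_def algebra_simps)
    then show ?thesis using grow[of "p + 2 * q" _ "- t"] by simp
  next
    case 2
    then have "a + 2 * c = p - 2 * q" "b + 2 * d = q + 2 * t * (p - 2 * q)"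
      using prod by (simp_all add: close_mat_def p_def q_def algebra_simps)
    then show ?thesis using grow[of "p - 2 * q" _ t] by simp
  next
    case 3
    then have e: "a + 2 * c = p" "b + 2 * d = q + 2 * x * p"
      using prod by (simp_all add: shift_mat_def p_def q_def algebra_simps)
    obtain q0 k ys where "set ys \<subseteq> X" "k \<in> {1, t, - t}" "q = q0 + 2 * (k + sum_list ys) * p"
      "\<bar>q0\<bar> < \<bar>p\<bar>" "int (length As) \<le> \<bar>p\<bar> * (\<bar>p\<bar> + t + 1) + int (length ys)"
      using IH by (auto simp: row_bounded_def)
    then show ?thesis
      unfolding row_bounded_def e using 3
      by (intro exI[of _ q0] exI[of _ k] exI[of _ "ys @ [x]"]) (auto simp: algebra_simps)
  qed
qed

lemma sum_mats_iff:
  assumes "finite X" "\<And>x. x \<in> X \<Longrightarrow> 0 < x" "0 < t"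
  shows "has_infinitely_factorizable (sum_mats X t) \<longleftrightarrow> (\<exists>xs. set xs \<subseteq> X \<and> sum_list xs = t)"
proof
  show "\<exists>xs. set xs \<subseteq> X \<and> sum_list xs = t \<Longrightarrow> has_infinitely_factorizable (sum_mats X t)"
    using sum_mats_infinite by blast
  show "\<exists>xs. set xs \<subseteq> X \<and> sum_list xs = t" if inf: "has_infinitely_factorizable (sum_mats X t)"
  proof (rule ccontr)
    assume none: "\<nexists>xs. set xs \<subseteq> X \<and> sum_list xs = t"
    obtain M where M: "infinite (factorizations (sum_mats X t) M)"
      using inf by (auto simp: has_infinitely_factorizable_def)
    obtain a b c d where m: "M = mat2 a b c d" by (rule mat2_cases)
    define p q where "p = a + 2 * c" and "q = b + 2 * d"
    let ?n = "nat (\<bar>p\<bar> * (\<bar>p\<bar> + t + 1) + \<bar>q\<bar> + t)"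
    have "factorizations (sum_mats X t) M \<subseteq> {As. set As \<subseteq> sum_mats X t \<and> length As \<le> ?n}"
    proof
      fix As assume "As \<in> factorizations (sum_mats X t) M"
      then have As: "set As \<subseteq> sum_mats X t" "mat_prod As = mat2 a b c d"
        using m by (auto simp: factorizations_def)
      have "int (length As) \<le> \<bar>p\<bar> * (\<bar>p\<bar> + t + 1) + \<bar>q\<bar> + t"
        using row_bounded_length(1)[OF row_bounded_mat_prod[OF assms(2,3) none As] assms(2,3) none]
        by (simp add: p_def q_def)
      then show "As \<in> {As. set As \<subseteq> sum_mats X t \<and> length As \<le> ?n}" using As by simp
    qed
    moreover have "finite (sum_mats X t)" using assms(1) by (simp add: sum_mats_def)
    ultimately show False
      using M finite_lists_length_le finite_subset by blast
  qed
qed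


section \<open>From tilings to sums with repetition\<close>

text \<open>A tile has a left, right, lower and upper colour. The cells of a grid with rows of length
  \<open>P\<close> are numbered row by row, so the right neighbour of cell \<open>i\<close> is \<open>i + 1\<close> and its upper
  neighbour is \<open>i + P\<close>; the end of a row is adjacent to the start of the next one.\<close>

type_synonym tile = "(nat \<times> nat) \<times> (nat \<times> nat)"

abbreviation left :: "tile \<Rightarrow> nat" where "left a \<equiv> fst (fst a)"
abbreviation right :: "tile \<Rightarrow> nat" where "right a \<equiv> snd (fst a)"
abbreviation lower :: "tile \<Rightarrow> nat" where "lower a \<equiv> fst (snd a)"
abbreviation upper :: "tile \<Rightarrow> nat" where "upper a \<equiv> snd (snd a)"

definition is_tiling :: "tile list list \<Rightarrow> nat \<Rightarrow> (nat \<Rightarrow> tile) \<Rightarrow> bool" where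
  "is_tiling TS P T \<longleftrightarrow> (\<forall>i<length TS. T i \<in> set (TS ! i)) \<and>
     (\<forall>i<length TS. left (T i) = (if i = 0 then 0 else right (T (i - 1)))) \<and>
     (\<forall>i<length TS. lower (T i) = (if i < P then 0 else upper (T (i - P))))"

text \<open>Block \<open>j\<close> has one bit for cell \<open>j\<close>, then \<open>W\<close> bits
  for its left edge and \<open>W\<close> for its lower edge. The tile in cell \<open>j\<close>
  covers the edge bits from its own colour upwards, the neighbour on the other side those below its
  colour; together they cover each bit once exactly if the colours agree. On an edge without a
  neighbour this forces colour 0.\<close>

definition block :: "nat \<Rightarrow> nat \<Rightarrow> nat \<Rightarrow> tile \<Rightarrow> nat \<Rightarrow> bool list" where
  "block P W i a j = (j = i) # map (\<lambda>k. (j = i \<and> \<not> k < left a) \<or> (j = i + 1 \<and> k < right a)) [0..<W] @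
     map (\<lambda>k. (j = i \<and> \<not> k < lower a) \<or> (j = i + P \<and> k < upper a)) [0..<W]"

definition cover_bits :: "nat \<Rightarrow> nat \<Rightarrow> nat \<Rightarrow> nat \<Rightarrow> tile \<Rightarrow> bool list" where
  "cover_bits N P W i a = concat (map (block P W i a) [0..<N])"

lemma length_block: "length (block P W i a j) = 2 * W + 1"
  by (simp add: block_def)

lemma length_cover_bits: "length (cover_bits N P W i a) = N * (2 * W + 1)"
  by (induction N) (auto simp: cover_bits_def length_block)

lemma nth_cover_bits:
  assumes "j < N" "o' < 2 * W + 1"
  shows "cover_bits N P W i a ! (j * (2 * W + 1) + o') = block P W i a j ! o'"
  using assms(1)
proof (induction N)
  case (Suc N)
  have e: "cover_bits (Suc N) P W i a = cover_bits N P W i a @ block P W i a N"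
    by (simp add: cover_bits_def)
  show ?case
  proof (cases "j = N")
    case True
    then show ?thesis by (simp only: e nth_append length_cover_bits) simp
  next
    case False
    then have j: "j < N" using Suc.prems by simp
    have "j * (2 * W + 1) + o' < (j + 1) * (2 * W + 1)" using assms(2) by simp
    also have "\<dots> \<le> N * (2 * W + 1)" using j by (intro mult_le_mono) auto
    finally show ?thesis
      using Suc.IH[OF j] by (simp only: e nth_append length_cover_bits if_True)
  qed
qed simp

section \<open>Exact covers as sums in a large base\<close>

definition bits_val :: "bool list \<Rightarrow> nat" where
  "bits_val bs = foldr (\<lambda>b n. of_bool b + 2 * n) bs 0"

lemma bits_val_simps [simp]:
  "bits_val [] = 0" "bits_val (b # bs) = of_bool b + 2 * bits_val bs"
  by (simp_all add: bits_val_def)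

lemma bits_val_append: "bits_val (xs @ ys) = bits_val xs + 2 ^ length xs * bits_val ys"
  by (induction xs) (auto simp: algebra_simps)

lemma bits_val_replicate: "bits_val (replicate n False) = 0" "bits_val (replicate n True) = 2 ^ n - 1"
proof -
  show "bits_val (replicate n False) = 0" by (induction n) auto
  have "bits_val (replicate n True) + 1 = 2 ^ n" by (induction n) auto
  then show "bits_val (replicate n True) = 2 ^ n - 1" by simp
qed

lemma nat_bits_bits_val: "bs = [] \<or> last bs \<Longrightarrow> nat_bits (bits_val bs) = bs"
proof (induction bs)
  case Nil
  show ?case by (subst nat_bits.simps) simp
next
  case (Cons b bs)
  have "bits_val (b # bs) \<noteq> 0"
  proof (cases "bs = []")
    case False
    then have "nat_bits (bits_val bs) \<noteq> []" using Cons by simp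
    moreover have "nat_bits 0 = []" by (subst nat_bits.simps) simp
    ultimately have "bits_val bs \<noteq> 0" by metis
    then show ?thesis by simp
  qed (use Cons in simp)
  moreover have "odd (bits_val (b # bs)) = b" "bits_val (b # bs) div 2 = bits_val bs" by auto
  moreover have "nat_bits (bits_val bs) = bs" using Cons by (cases "bs = []") auto
  ultimately show ?case by (subst nat_bits.simps) auto
qed

text \<open>The bits become digits in base \<open>2 ^ (N + 1)\<close>; the inserted zeros are the
  room for column sums.\<close>

definition spread :: "nat \<Rightarrow> bool list \<Rightarrow> bool list" where
  "spread N e = concat (map (\<lambda>b. b # replicate N False) e)"

lemma bits_val_spread:
  "bits_val (spread N e) = (\<Sum>j<length e. of_bool (e ! j) * (2 ^ (N + 1)) ^ j)"
proof (induction e)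
  case (Cons b e)
  have "bits_val (spread N (b # e)) = of_bool b + 2 ^ (N + 1) * bits_val (spread N e)"
    by (simp add: spread_def bits_val_append bits_val_replicate)
  also have "\<dots> = (\<Sum>j<length (b # e). of_bool ((b # e) ! j) * (2 ^ (N + 1)) ^ j)"
    unfolding Cons by (simp add: sum.lessThan_Suc_shift sum_distrib_left algebra_simps
        del: sum.lessThan_Suc sum_of_bool_mult_eq sum_mult_of_bool_eq)
  finally show ?case .
qed (simp add: spread_def)

lemma length_spread: "length (spread N e) = (N + 1) * length e"
  by (induction e) (auto simp: spread_def)

definition item_bits :: "nat \<Rightarrow> nat \<Rightarrow> nat \<Rightarrow> nat \<Rightarrow> tile \<Rightarrow> bool list" where
  "item_bits N P W i a = spread N (cover_bits N P W i a) @ replicate i False @ [True]"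

definition target_bits :: "nat \<Rightarrow> nat \<Rightarrow> bool list" where
  "target_bits N W = spread N (replicate (N * (2 * W + 1)) True) @ replicate N True"

text \<open>Below a leading digit \<open>t\<close> there are \<open>D\<close> ordinary digits. The
  leading digit is not limited by the base, so weights can be added up in it.\<close>

definition digits_val :: "nat \<Rightarrow> (nat \<Rightarrow> nat) \<Rightarrow> nat \<Rightarrow> nat \<Rightarrow> nat" where
  "digits_val B c D t = (\<Sum>j<D. c j * B ^ j) + t * B ^ D"

lemma digits_val_Suc: "digits_val B c (Suc D) t = c 0 + B * digits_val B (\<lambda>j. c (Suc j)) D t"
  by (simp add: digits_val_def sum.lessThan_Suc_shift sum_distrib_left algebra_simps del: sum.lessThan_Suc)

lemma digits_val_inject:
  assumes "\<And>j. j < D \<Longrightarrow> c j < B" "\<And>j. j < D \<Longrightarrow> c' j < B" "digits_val B c D t = digits_val B c' D t'"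
  shows "(\<forall>j<D. c j = c' j) \<and> t = t'"
  using assms
proof (induction D arbitrary: c c')
  case 0
  then show ?case by (simp add: digits_val_def)
next
  case (Suc D)
  let ?v = "digits_val B (\<lambda>j. c (Suc j)) D t" and ?v' = "digits_val B (\<lambda>j. c' (Suc j)) D t'"
  have eq: "c 0 + B * ?v = c' 0 + B * ?v'" using Suc.prems(3) by (simp add: digits_val_Suc)
  have lt: "c 0 < B" "c' 0 < B" using Suc.prems by auto
  have "(c 0 + B * ?v) mod B = c 0" "(c' 0 + B * ?v') mod B = c' 0" using lt by simp_all
  then have c0: "c 0 = c' 0" using eq by simp
  moreover have "?v = ?v'" using eq c0 lt by simp
  then have "(\<forall>j<D. c (Suc j) = c' (Suc j)) \<and> t = t'"
    using Suc.prems by (intro Suc.IH) auto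
  ultimately show ?case using less_Suc_eq_0_disj by auto
qed

lemma item_val:
  "bits_val (item_bits N P W i a) =
     digits_val (2 ^ (N + 1)) (\<lambda>j. of_bool (cover_bits N P W i a ! j)) (N * (2 * W + 1)) (2 ^ i)"
  by (simp add: item_bits_def bits_val_append bits_val_spread digits_val_def length_cover_bits
      length_spread bits_val_replicate power_mult[symmetric] algebra_simps del: power_Suc)

lemma target_val:
  "bits_val (target_bits N W) = digits_val (2 ^ (N + 1)) (\<lambda>j. 1) (N * (2 * W + 1)) (2 ^ N - 1)"
  by (simp add: target_bits_def bits_val_append bits_val_spread digits_val_def
      length_spread bits_val_replicate power_mult[symmetric] algebra_simps del: power_Suc)

lemma digits_val_sum_list:
  "sum_list (map (\<lambda>y. digits_val B (c y) D (t y)) ys) =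
     digits_val B (\<lambda>j. sum_list (map (\<lambda>y. c y j) ys)) D (sum_list (map t ys))"
  by (induction ys) (auto simp: digits_val_def sum.distrib algebra_simps)

text \<open>The weights \<open>2 ^ i\<close> in the leading digit bound the number of summands by \<open>2 ^ N - 1\<close>,
  which is less than the base, so no carries occur.\<close>

lemma sum_items_iff:
  "sum_list (map (\<lambda>(i, a). bits_val (item_bits N P W i a)) ys) = bits_val (target_bits N W) \<longleftrightarrow>
   (\<forall>j<N * (2 * W + 1). sum_list (map (\<lambda>(i, a). of_bool (cover_bits N P W i a ! j)) ys) = (1 :: nat)) \<and>
   sum_list (map (\<lambda>(i, a). 2 ^ i) ys) = (2 ^ N - 1 :: nat)"
proof -
  let ?B = "2 ^ (N + 1) :: nat" and ?D = "N * (2 * W + 1)"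
  let ?c = "\<lambda>j. sum_list (map (\<lambda>y. of_bool (cover_bits N P W (fst y) (snd y) ! j)) ys) :: nat"
  let ?t = "sum_list (map (\<lambda>y. 2 ^ fst y) ys) :: nat"
  have "sum_list (map (\<lambda>y. bits_val (item_bits N P W (fst y) (snd y))) ys) = digits_val ?B ?c ?D ?t"
    unfolding item_val by (rule digits_val_sum_list)
  moreover have "digits_val ?B ?c ?D ?t = digits_val ?B (\<lambda>j. 1) ?D (2 ^ N - 1) \<longleftrightarrow>
      (\<forall>j<?D. ?c j = 1) \<and> ?t = 2 ^ N - 1"
  proof
    assume eq: "digits_val ?B ?c ?D ?t = digits_val ?B (\<lambda>j. 1) ?D (2 ^ N - 1)"
    have one: "1 < ?B" by (rule one_less_power) simp_all
    have "(\<Sum>j<D. 1 * ?B ^ j) < ?B ^ D" for D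
    proof (induction D)
      case (Suc D)
      have "?B ^ D + ?B ^ D \<le> ?B * ?B ^ D" using one by (simp add: mult_2[symmetric])
      then show ?case using Suc by simp
    qed simp
    \<comment> \<open>Digits cannot be compared before carries are excluded, so the total weight
      \<open>?t\<close> is bounded by size alone: the target is less than
      \<open>2 ^ N * ?B ^ ?D\<close>.\<close>
    then have "digits_val ?B (\<lambda>j. 1) ?D (2 ^ N - 1) < ?B ^ ?D + (2 ^ N - 1) * ?B ^ ?D"
      unfolding digits_val_def by (intro add_strict_right_mono)
    also have "\<dots> = 2 ^ N * ?B ^ ?D" by (simp add: algebra_simps del: power_Suc)
    finally have "digits_val ?B ?c ?D ?t < 2 ^ N * ?B ^ ?D" unfolding eq .
    moreover have "?t * ?B ^ ?D \<le> digits_val ?B ?c ?D ?t" unfolding digits_val_def by simp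
    ultimately have "?t * ?B ^ ?D < 2 ^ N * ?B ^ ?D" by (rule le_less_trans[rotated])
    then have t: "?t < 2 ^ N" unfolding mult_less_cancel2 by blast
    have "length ys \<le> ?t"
    proof (induction ys)
      case (Cons y ys)
      have "1 \<le> (2::nat) ^ fst y" by simp
      from add_mono[OF this Cons] show ?case by simp
    qed simp
    moreover have "?c j \<le> length ys" for j by (induction ys) (auto simp: of_bool_def)
    moreover have "(2::nat) ^ N \<le> ?B" by simp
    ultimately have "?c j < ?B" for j using t by (meson le_less_trans less_le_trans)
    then show "(\<forall>j<?D. ?c j = 1) \<and> ?t = 2 ^ N - 1"
      using eq one by (intro digits_val_inject[of ?D ?c ?B "\<lambda>j. 1"]) auto
  next
    assume "(\<forall>j<?D. ?c j = 1) \<and> ?t = 2 ^ N - 1"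
    then show "digits_val ?B ?c ?D ?t = digits_val ?B (\<lambda>j. 1) ?D (2 ^ N - 1)"
      by (simp add: digits_val_def)
  qed
  ultimately show ?thesis unfolding target_val case_prod_unfold by simp
qed

lemma sum_list_group:
  fixes N :: nat
  assumes "\<And>y. y \<in> set ys \<Longrightarrow> fst y < N"
  shows "sum_list (map f ys) = (\<Sum>i<N. sum_list (map f (filter (\<lambda>y. fst y = i) ys)) :: nat)"
  using assms
proof (induction ys)
  case (Cons y ys)
  have "(\<Sum>i<N. sum_list (map f (filter (\<lambda>y. fst y = i) (y # ys)))) =
      (\<Sum>i<N. (if fst y = i then f y else 0) + sum_list (map f (filter (\<lambda>y. fst y = i) ys)))"
    by (intro sum.cong) auto
  moreover have "(\<Sum>i<N. if fst y = i then f y else 0) = f y"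
    using Cons.prems[of y] by (subst sum.delta') auto
  ultimately show ?case using Cons by (simp add: sum.distrib)
qed simp

text \<open>If the colours differ, the bit at their minimum is covered twice or not at all.\<close>

lemma threshold_eq:
  fixes a b W :: nat
  assumes "a \<le> W" "b \<le> W"
  shows "(\<forall>k<W. of_bool (\<not> k < a) + of_bool (k < b) = (1 :: nat)) \<longleftrightarrow> a = b"
proof
  assume *: "\<forall>k<W. of_bool (\<not> k < a) + of_bool (k < b) = (1 :: nat)"
  show "a = b"
  proof (rule ccontr)
    assume "a \<noteq> b"
    then have "min a b < W" using assms by (auto simp: min_def)
    with * have "of_bool (\<not> min a b < a) + of_bool (min a b < b) = (1 :: nat)" by blast
    then show False using \<open>a \<noteq> b\<close> by (auto simp: min_def split: if_splits)
  qed
qed auto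

lemma sum_edge:
  assumes "j < N" "0 < (P::nat)"
  shows "(\<Sum>i<N. of_bool ((j = i \<and> A i) \<or> (j = i + P \<and> C i)) :: nat) =
    of_bool (A j) + of_bool (P \<le> j \<and> C (j - P))"
proof -
  have "(\<Sum>i<N. of_bool ((j = i \<and> A i) \<or> (j = i + P \<and> C i)) :: nat) =
      (\<Sum>i<N. (if j = i then of_bool (A j) else 0) + (if i = j - P then of_bool (P \<le> j \<and> C (j - P)) else 0))"
    using assms by (intro sum.cong) auto
  also have "\<dots> = of_bool (A j) + (\<Sum>i<N. if i = j - P then of_bool (P \<le> j \<and> C (j - P)) else 0)"
    using assms(1) by (simp add: sum.distrib)
  also have "(\<Sum>i<N. if i = j - P then of_bool (P \<le> j \<and> C (j - P)) else 0) = (of_bool (P \<le> j \<and> C (j - P)) :: nat)"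
    using assms(1) by (subst sum.delta) auto
  finally show ?thesis .
qed

text \<open>The cell bits force exactly one summand per cell, so a multiset of summands with the
  right sum is a choice of tiles, and the edge bits are its matching conditions. Conversely the
  weights of the cells of a tiling add up to \<open>2 ^ N - 1\<close>.\<close>

lemma tiling_iff_sum:
  assumes P: "0 < P" and W: "\<And>i a. i < length TS \<Longrightarrow> a \<in> set (TS ! i) \<Longrightarrow> left a \<le> W \<and> right a \<le> W \<and> lower a \<le> W \<and> upper a \<le> W"
  defines "N \<equiv> length TS"
  defines "Y \<equiv> {(i, a). i < N \<and> a \<in> set (TS ! i)}"
  shows "(\<exists>T. is_tiling TS P T) \<longleftrightarrow>
    (\<exists>ys. set ys \<subseteq> Y \<and> sum_list (map (\<lambda>(i, a). bits_val (item_bits N P W i a)) ys) = bits_val (target_bits N W))"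
proof -
  have column: "sum_list (map (\<lambda>(i, a). of_bool (block P W i a j ! k)) ys) =
      (\<Sum>i<N. of_bool (block P W i (T i) j ! k) :: nat)"
    if "set ys \<subseteq> Y" "\<And>i. i < N \<Longrightarrow> filter (\<lambda>y. fst y = i) ys = [(i, T i)]" for ys T j k
    using that by (subst sum_list_group[of ys N]) (auto simp: Y_def)
  have tiles: "is_tiling TS P T \<longleftrightarrow> (\<forall>j<N. \<forall>k<2 * W + 1. (\<Sum>i<N. of_bool (block P W i (T i) j ! k) :: nat) = 1)"
    if T: "\<And>i. i < N \<Longrightarrow> T i \<in> set (TS ! i)" for T
  proof -
    have all: "(\<forall>k<2 * W + 1. Q k) \<longleftrightarrow> Q 0 \<and> (\<forall>k<W. Q (Suc k)) \<and> (\<forall>k<W. Q (Suc (W + k)))" for Q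
    proof (intro iffI conjI allI impI)
      fix k assume Q: "Q 0 \<and> (\<forall>k<W. Q (Suc k)) \<and> (\<forall>k<W. Q (Suc (W + k)))" and k: "k < 2 * W + 1"
      show "Q k"
      proof (cases k)
        case (Suc n)
        show ?thesis
        proof (cases "n < W")
          case False
          then have "n = W + (n - W)" "n - W < W" using k Suc by auto
          then show ?thesis using Q Suc by metis
        qed (use Q Suc in simp)
      qed (use Q in simp)
    qed auto
    have 0: "(\<Sum>i<N. of_bool (block P W i (T i) j ! 0) :: nat) = 1" if "j < N" for j
      using sum_edge[OF that P, of "\<lambda>_. True" "\<lambda>_. False"] by (simp add: block_def)
    have h: "(\<Sum>i<N. of_bool (block P W i (T i) j ! Suc k) :: nat) =
        of_bool (\<not> k < left (T j)) + of_bool (k < (if j = 0 then 0 else right (T (j - 1))))" if "j < N" "k < W" for j k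
      using sum_edge[OF that(1), of 1 "\<lambda>i. \<not> k < left (T i)" "\<lambda>i. k < right (T i)"] that(2)
      by (simp add: block_def nth_append del: sum_of_bool_eq)
    have v: "(\<Sum>i<N. of_bool (block P W i (T i) j ! Suc (W + k)) :: nat) =
        of_bool (\<not> k < lower (T j)) + of_bool (k < (if j < P then 0 else upper (T (j - P))))" if "j < N" "k < W" for j k
      using sum_edge[OF that(1) P, of "\<lambda>i. \<not> k < lower (T i)" "\<lambda>i. k < upper (T i)"] that(2)
      by (simp add: block_def nth_append not_less del: sum_of_bool_eq)
    have bound: "left (T j) \<le> W" "right (T j) \<le> W" "lower (T j) \<le> W" "upper (T j) \<le> W" if "j < N" for j
      using W[of j "T j"] T[OF that] that by (auto simp: N_def)
    have h': "(\<forall>k<W. (\<Sum>i<N. of_bool (block P W i (T i) j ! Suc k) :: nat) = 1) \<longleftrightarrow>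
        left (T j) = (if j = 0 then 0 else right (T (j - 1)))" if "j < N" for j
      using threshold_eq[of "left (T j)" W "if j = 0 then 0 else right (T (j - 1))"] bound[OF that] bound[of "j - 1"] that
      by (simp only: h cong: imp_cong) auto
    have v': "(\<forall>k<W. (\<Sum>i<N. of_bool (block P W i (T i) j ! Suc (W + k)) :: nat) = 1) \<longleftrightarrow>
        lower (T j) = (if j < P then 0 else upper (T (j - P)))" if "j < N" for j
      using threshold_eq[of "lower (T j)" W "if j < P then 0 else upper (T (j - P))"] bound[OF that] bound[of "j - P"] that
      by (simp only: v cong: imp_cong) auto
    show ?thesis
      unfolding all is_tiling_def using T 0 h' v' by (auto simp: N_def)
  qed
  have cols: "(\<forall>j<N * (2 * W + 1). Q (\<lambda>i a. cover_bits N P W i a ! j)) \<longleftrightarrow>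
      (\<forall>j<N. \<forall>k<2 * W + 1. Q (\<lambda>i a. block P W i a j ! k))" for Q
  proof (intro iffI allI impI)
    fix j k assume *: "\<forall>j<N * (2 * W + 1). Q (\<lambda>i a. cover_bits N P W i a ! j)" and jk: "j < N" "k < 2 * W + 1"
    have "j * (2 * W + 1) + k < (j + 1) * (2 * W + 1)" using jk by simp
    also have "\<dots> \<le> N * (2 * W + 1)" using jk by (intro mult_le_mono) auto
    finally have "Q (\<lambda>i a. cover_bits N P W i a ! (j * (2 * W + 1) + k))" using * by blast
    then show "Q (\<lambda>i a. block P W i a j ! k)" by (simp only: nth_cover_bits[OF jk])
  next
    fix j assume *: "\<forall>j<N. \<forall>k<2 * W + 1. Q (\<lambda>i a. block P W i a j ! k)" and j: "j < N * (2 * W + 1)"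
    have 1: "j div (2 * W + 1) < N" using j by (rule less_mult_imp_div_less)
    have 2: "j mod (2 * W + 1) < 2 * W + 1" by simp
    have "Q (\<lambda>i a. cover_bits N P W i a ! (j div (2 * W + 1) * (2 * W + 1) + j mod (2 * W + 1)))"
      using * 1 2 unfolding nth_cover_bits[OF 1 2] by blast
    then show "Q (\<lambda>i a. cover_bits N P W i a ! j)" unfolding div_mult_mod_eq .
  qed
  show ?thesis
  proof
    assume "\<exists>T. is_tiling TS P T"
    then obtain T where T: "is_tiling TS P T" by blast
    then have Ti: "\<And>i. i < N \<Longrightarrow> T i \<in> set (TS ! i)" by (simp add: is_tiling_def N_def)
    define ys where "ys = map (\<lambda>i. (i, T i)) [0..<N]"
    have ysY: "set ys \<subseteq> Y" using Ti by (auto simp: ys_def Y_def)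
    have filt: "filter (\<lambda>y. fst y = i) ys = [(i, T i)]" if "i < N" for i
    proof -
      have "filter (\<lambda>k. k = i) [0..<N] = [i]" using that
        by (induction N) (auto simp: less_Suc_eq)
      then show ?thesis by (simp add: ys_def filter_map comp_def)
    qed
    have column_T: "sum_list (map (\<lambda>(i, a). of_bool (block P W i a j ! k)) ys) =
        (\<Sum>i<N. of_bool (block P W i (T i) j ! k) :: nat)" for j k
      by (rule column[OF ysY]) (rule filt)
    have tiles_T: "is_tiling TS P T \<longleftrightarrow> (\<forall>j<N. \<forall>k<2 * W + 1. (\<Sum>i<N. of_bool (block P W i (T i) j ! k) :: nat) = 1)"
      by (rule tiles) (rule Ti)
    have "\<forall>j<N * (2 * W + 1). sum_list (map (\<lambda>(i, a). of_bool (cover_bits N P W i a ! j)) ys) = (1 :: nat)"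
      unfolding cols[of "\<lambda>f. sum_list (map (\<lambda>(i, a). of_bool (f i a)) ys) = (1 :: nat)"]
      using T unfolding tiles_T column_T by blast
    moreover have "sum_list (map (\<lambda>(i, a). 2 ^ i) ys) = (2 ^ N - 1 :: nat)"
    proof -
      have "sum_list (map (\<lambda>(i, a). 2 ^ i) (map (\<lambda>i. (i, T i)) [0..<n])) + 1 = (2 ^ n :: nat)" for n
        by (induction n) auto
      from this[of N] show ?thesis by (simp add: ys_def)
    qed
    ultimately show "\<exists>ys. set ys \<subseteq> Y \<and> sum_list (map (\<lambda>(i, a). bits_val (item_bits N P W i a)) ys) = bits_val (target_bits N W)"
      using ysY sum_items_iff by blast
  next
    assume "\<exists>ys. set ys \<subseteq> Y \<and> sum_list (map (\<lambda>(i, a). bits_val (item_bits N P W i a)) ys) = bits_val (target_bits N W)"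
    then obtain ys where ysY: "set ys \<subseteq> Y" and
      "\<forall>j<N * (2 * W + 1). sum_list (map (\<lambda>(i, a). of_bool (cover_bits N P W i a ! j)) ys) = (1 :: nat)"
      unfolding sum_items_iff by blast
    then have cov: "\<forall>j<N. \<forall>k<2 * W + 1. sum_list (map (\<lambda>(i, a). of_bool (block P W i a j ! k)) ys) = (1 :: nat)"
      unfolding cols[of "\<lambda>f. sum_list (map (\<lambda>(i, a). of_bool (f i a)) ys) = (1 :: nat)"] by blast
    \<comment> \<open>The column of the cell bit of block \<open>i\<close> counts the summands that
      belong to cell \<open>i\<close>.\<close>
    have "\<exists>t. filter (\<lambda>y. fst y = i) ys = [(i, t)]" if "i < N" for i
    proof -
      have "sum_list (map (\<lambda>(i', a). of_bool (block P W i' a i ! 0)) ys) = (1 :: nat)"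
        using cov that by auto
      moreover have "sum_list (map (\<lambda>(i', a). of_bool (block P W i' a i ! 0)) zs) = length (filter (\<lambda>y. fst y = i) zs)" for zs
        by (induction zs) (auto simp: block_def)
      ultimately have "length (filter (\<lambda>y. fst y = i) ys) = 1" by simp
      then obtain y where y: "filter (\<lambda>y. fst y = i) ys = [y]" by (auto simp: length_Suc_conv)
      then have "y \<in> set (filter (\<lambda>y. fst y = i) ys)" by simp
      then have "fst y = i" by simp
      then show ?thesis using y by (cases y) auto
    qed
    then obtain T where filt: "\<And>i. i < N \<Longrightarrow> filter (\<lambda>y. fst y = i) ys = [(i, T i)]" by metis
    have Ti: "T i \<in> set (TS ! i)" if "i < N" for i
    proof -
      have "(i, T i) \<in> set (filter (\<lambda>y. fst y = i) ys)" using filt[OF that] by simp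
      then show ?thesis using ysY by (auto simp: Y_def)
    qed
    have column_T: "sum_list (map (\<lambda>(i, a). of_bool (block P W i a j ! k)) ys) =
        (\<Sum>i<N. of_bool (block P W i (T i) j ! k) :: nat)" for j k
      by (rule column[OF ysY]) (rule filt)
    have "is_tiling TS P T \<longleftrightarrow> (\<forall>j<N. \<forall>k<2 * W + 1. (\<Sum>i<N. of_bool (block P W i (T i) j ! k) :: nat) = 1)"
      by (rule tiles) (rule Ti)
    then have "is_tiling TS P T" using cov unfolding column_T by blast
    then show "\<exists>T. is_tiling TS P T" by blast
  qed
qed


section \<open>From Turing machines to tilings\<close>

text \<open>Tape cells are indexed relative to the heads: the symbols read and written are always at
  offset 0, and a head movement shifts the whole tape by one.\<close>

definition head_column :: "tape list \<Rightarrow> int \<Rightarrow> nat list" where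
  "head_column ts o' = map (\<lambda>t. fst t (snd t + o')) ts"

definition list_of :: "'a set \<Rightarrow> 'a list" where
  "list_of A = (SOME xs. set xs = A)"

lemma set_list_of: "finite A \<Longrightarrow> set (list_of A) = A"
  unfolding list_of_def using someI_ex[OF finite_list] .

locale machine_tiling =
  fixes M :: tm
  assumes machine: "turing_machine M"
begin

definition head_columns :: "nat list set" where
  "head_columns = {c. length c = num_tapes M \<and> (\<forall>s\<in>set c. s < num_symbols M)}"

definition blank_column :: "nat list" where
  "blank_column = replicate (num_tapes M) 0"

text \<open>Halted configurations idle, as in \<open>step\<close>, so the tableau can always be
  continued up to a time fixed in advance.\<close>

definition action :: "nat \<Rightarrow> nat list \<Rightarrow> nat \<times> (nat \<times> move) list" where
  "action q ss = (if q = accept_state M \<or> q = reject_state M then (q, map (\<lambda>s. (s, Stay)) ss) else delta M q ss)"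

text \<open>The tapes after writing and before the heads move. Since heads may move in different
  directions, the next column is assembled by \<open>shift\<close> tape by tape from a column and
  its two neighbours.\<close>

definition post :: "tape list \<Rightarrow> (nat \<times> move) list \<Rightarrow> int \<Rightarrow> nat list" where
  "post ts as o' = (if o' = 0 then map fst as else head_column ts o')"

definition shift :: "(nat \<times> move) list \<Rightarrow> nat list \<Rightarrow> nat list \<Rightarrow> nat list \<Rightarrow> nat list" where
  "shift as x y z = map (\<lambda>j. case snd (as ! j) of Left \<Rightarrow> x ! j | Stay \<Rightarrow> y ! j | Right \<Rightarrow> z ! j) [0..<num_tapes M]"

lemma finite_columns: "finite head_columns"
proof -
  have "head_columns = {c. set c \<subseteq> {..<num_symbols M} \<and> length c = num_tapes M}" by (auto simp: head_columns_def)
  then show ?thesis by (simp add: finite_lists_length_eq)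
qed

lemma action_in:
  assumes "q < num_states M" "ss \<in> head_columns"
  shows "fst (action q ss) < num_states M" "length (snd (action q ss)) = num_tapes M"
    "map fst (snd (action q ss)) \<in> head_columns"
proof -
  have d: "fst (delta M q ss) < num_states M \<and> length (snd (delta M q ss)) = num_tapes M \<and>
      (\<forall>(s, m)\<in>set (snd (delta M q ss)). s < num_symbols M)"
    using machine assms unfolding turing_machine_def head_columns_def by blast
  show "fst (action q ss) < num_states M" "length (snd (action q ss)) = num_tapes M"
    using d assms by (auto simp: action_def head_columns_def)
  show "map fst (snd (action q ss)) \<in> head_columns"
    using d assms by (auto simp: action_def head_columns_def comp_def)
qed

lemma step_action:
  assumes "length ts = num_tapes M"
  shows "step M (q, ts) = (fst (action q (head_column ts 0)), map2 act_tape ts (snd (action q (head_column ts 0))))"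
proof -
  have r: "head_column ts 0 = map read_tape ts"
    by (auto simp: head_column_def)
  have "map2 act_tape ts (map (\<lambda>s. (s, Stay)) (map read_tape ts)) = ts"
    by (rule nth_equalityI) auto
  then show ?thesis by (auto simp: action_def r split: prod.split)
qed

lemma column_step:
  assumes "length ts = num_tapes M" "length as = num_tapes M"
  shows "head_column (map2 act_tape ts as) o' = shift as (post ts as (o' - 1)) (post ts as o') (post ts as (o' + 1))"
proof (rule nth_equalityI)
  show "length (head_column (map2 act_tape ts as) o') = length (shift as (post ts as (o' - 1)) (post ts as o') (post ts as (o' + 1)))"
    using assms by (simp add: head_column_def shift_def)
  fix j assume "j < length (head_column (map2 act_tape ts as) o')"
  then have j: "j < num_tapes M" using assms by (simp add: head_column_def)
  obtain f h where t: "ts ! j = (f, h)" by fastforce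
  obtain s mv where a: "as ! j = (s, mv)" by fastforce
  have p: "post ts as i ! j = (if i = 0 then s else f (h + i))" for i
    using j assms t a by (simp add: post_def head_column_def)
  show "head_column (map2 act_tape ts as) o' ! j = shift as (post ts as (o' - 1)) (post ts as o') (post ts as (o' + 1)) ! j"
    using j assms t a by (cases mv) (auto simp: head_column_def shift_def p algebra_simps)
qed

lemma shift_in:
  assumes "x \<in> head_columns" "y \<in> head_columns" "z \<in> head_columns"
  shows "shift as x y z \<in> head_columns"
proof -
  have "x ! j < num_symbols M" "y ! j < num_symbols M" "z ! j < num_symbols M" if "j < num_tapes M" for j
    using assms that by (auto simp: head_columns_def)
  then show ?thesis by (auto simp: head_columns_def shift_def split: move.split)
qed

section \<open>Runs in coordinates relative to the heads\<close>

definition state_at :: "bool list \<Rightarrow> nat \<Rightarrow> nat" where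
  "state_at u t = fst (run M u t)"

definition tapes_at :: "bool list \<Rightarrow> nat \<Rightarrow> tape list" where
  "tapes_at u t = snd (run M u t)"

definition action_at :: "bool list \<Rightarrow> nat \<Rightarrow> nat \<times> (nat \<times> move) list" where
  "action_at u t = action (state_at u t) (head_column (tapes_at u t) 0)"

abbreviation post_at :: "bool list \<Rightarrow> nat \<Rightarrow> int \<Rightarrow> nat list" where
  "post_at u t \<equiv> post (tapes_at u t) (snd (action_at u t))"

definition input_symbol :: "bool list \<Rightarrow> int \<Rightarrow> nat" where
  "input_symbol u o' = (if 0 \<le> o' \<and> o' < int (length u) then bit_symbol (u ! nat o') else 0)"

definition symbol_column :: "nat \<Rightarrow> nat list" where
  "symbol_column s = s # replicate (num_tapes M - 1) 0"

lemma run_Suc: "run M u (Suc t) = step M (run M u t)"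
  by (simp add: run_def)

lemma num_tapes_pos: "num_tapes M \<ge> 1"
  using machine by (simp add: turing_machine_def)

lemma column_0: "head_column (tapes_at u 0) o' = symbol_column (input_symbol u o')"
  by (auto simp: head_column_def tapes_at_def run_def initial_config_def input_tape_def symbol_column_def
      input_symbol_def blank_tape_def)

lemma symbol_column_in: "s \<le> 2 \<Longrightarrow> symbol_column s \<in> head_columns"
  using machine num_tapes_pos by (auto simp: symbol_column_def head_columns_def turing_machine_def)

lemma input_symbol_le: "input_symbol u o' \<le> 2"
  by (simp add: input_symbol_def bit_symbol_def)

lemma run_action:
  assumes "length (tapes_at u t) = num_tapes M"
  shows "state_at u (Suc t) = fst (action_at u t)"
    "tapes_at u (Suc t) = map2 act_tape (tapes_at u t) (snd (action_at u t))"
proof -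
  have "run M u (Suc t) = step M (state_at u t, tapes_at u t)"
    unfolding run_Suc state_at_def tapes_at_def by (simp only: prod.collapse)
  then have "run M u (Suc t) = (fst (action_at u t), map2 act_tape (tapes_at u t) (snd (action_at u t)))"
    unfolding step_action[OF assms] action_at_def .
  then show "state_at u (Suc t) = fst (action_at u t)"
    "tapes_at u (Suc t) = map2 act_tape (tapes_at u t) (snd (action_at u t))"
    unfolding state_at_def[of u "Suc t"] tapes_at_def[of u "Suc t"] by simp_all
qed

lemma good_run:
  "state_at u t < num_states M \<and> length (tapes_at u t) = num_tapes M \<and> (\<forall>o'. head_column (tapes_at u t) o' \<in> head_columns)"
proof (induction t)
  case 0
  have "state_at u 0 < num_states M" "length (tapes_at u 0) = num_tapes M"
    using machine num_tapes_pos by (auto simp: state_at_def tapes_at_def run_def initial_config_def turing_machine_def)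
  then show ?case using symbol_column_in[OF input_symbol_le] column_0 by simp
next
  case (Suc t)
  let ?a = "action_at u t"
  have a: "fst ?a < num_states M" "length (snd ?a) = num_tapes M" "map fst (snd ?a) \<in> head_columns"
    using action_in Suc unfolding action_at_def by auto
  have e: "state_at u (Suc t) = fst ?a" "tapes_at u (Suc t) = map2 act_tape (tapes_at u t) (snd ?a)"
    using run_action Suc by auto
  have "post_at u t o' \<in> head_columns" for o' using Suc a by (simp add: post_def)
  then have "head_column (tapes_at u (Suc t)) o' \<in> head_columns" for o'
    unfolding e using Suc a by (simp add: column_step shift_in)
  then show ?case using a Suc e by simp
qed

lemma run_step:
  "state_at u (Suc t) = fst (action_at u t)"
  "head_column (tapes_at u (Suc t)) o' = shift (snd (action_at u t)) (post_at u t (o' - 1)) (post_at u t o') (post_at u t (o' + 1))"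
proof -
  let ?a = "action_at u t"
  have a: "length (snd ?a) = num_tapes M"
    using action_in good_run unfolding action_at_def by auto
  have e: "state_at u (Suc t) = fst ?a" "tapes_at u (Suc t) = map2 act_tape (tapes_at u t) (snd ?a)"
    using run_action good_run by auto
  show "state_at u (Suc t) = fst ?a" by (rule e)
  show "head_column (tapes_at u (Suc t)) o' = shift (snd ?a) (post_at u t (o' - 1)) (post_at u t o') (post_at u t (o' + 1))"
    unfolding e using good_run[of u t] a by (simp add: column_step)
qed

lemma post_at_in: "post_at u t o' \<in> head_columns"
  using good_run[of u t] action_in[of "state_at u t" "head_column (tapes_at u t) 0"] by (simp add: post_def action_at_def)

text \<open>Relative to its head, a tape moves by at most one cell per step, and new symbols arise
  only at offset 0. This determines the width of the tableau.\<close>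

lemma blank_outside:
  "o' < - int t \<or> int (length u) + int t < o' \<Longrightarrow> head_column (tapes_at u t) o' = blank_column"
proof (induction t arbitrary: o')
  case 0
  have "symbol_column 0 = blank_column"
    using num_tapes_pos by (simp add: symbol_column_def blank_column_def Cons_replicate_eq)
  then show ?case using 0 by (auto simp: column_0 input_symbol_def)
next
  case (Suc t)
  have "post_at u t (o' + d) = blank_column" if "d \<in> {-1, 0, 1}" for d
    using Suc.prems that Suc.IH[of "o' + d"] by (auto simp: post_def)
  from this[of "-1"] this[of 0] this[of 1] show ?case
    by (auto simp: run_step shift_def blank_column_def intro!: nth_equalityI split: move.split)
qed

text \<open>Colours: 0 is neutral; horizontal colours of computation rows carry the control state, the
  symbols read and two adjacent columns after writing.\<close>

definition hcolour :: "nat \<Rightarrow> nat list \<Rightarrow> nat list \<Rightarrow> nat list \<Rightarrow> nat" where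
  "hcolour q ss x y = Suc (to_nat (q, ss, x, y))"

definition vcolour :: "nat \<Rightarrow> nat list \<Rightarrow> nat" where
  "vcolour q c = Suc (to_nat (q, c))"

lemma colour_eq [simp]:
  "hcolour q ss x y = hcolour q' ss' x' y' \<longleftrightarrow> q = q' \<and> ss = ss' \<and> x = x' \<and> y = y'"
  "vcolour q c = vcolour q' c' \<longleftrightarrow> q = q' \<and> c = c'"
  by (auto simp: hcolour_def vcolour_def)

text \<open>The flags mark the first, the central and the last cell of a row. Vertical colours show
  columns before writing, horizontal ones columns after it; the two differ only at the centre, where
  the symbols read appear below. State and symbols read are carried along the whole row, because
  every cell must know the movements.\<close>

definition step_tile :: "bool \<Rightarrow> bool \<Rightarrow> bool \<Rightarrow> nat \<Rightarrow> nat list \<Rightarrow> nat list \<Rightarrow> nat list \<Rightarrow> nat list \<Rightarrow> tile" where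
  "step_tile fi ce la q ss x y z =
    ((if fi then 0 else hcolour q ss x y, if la then 0 else hcolour q ss y z),
     (vcolour q (if ce then ss else y), vcolour (fst (action q ss)) (shift (snd (action q ss)) x y z)))"

definition step_tiles :: "bool \<Rightarrow> bool \<Rightarrow> bool \<Rightarrow> tile set" where
  "step_tiles fi ce la = {step_tile fi ce la q ss x y z | q ss x y z. q < num_states M \<and> ss \<in> head_columns \<and>
     x \<in> head_columns \<and> y \<in> head_columns \<and> z \<in> head_columns \<and> (fi \<longrightarrow> x = blank_column) \<and> (la \<longrightarrow> z = blank_column) \<and>
     (ce \<longrightarrow> y = map fst (snd (action q ss)))}"

definition start_tile :: "nat \<Rightarrow> nat \<Rightarrow> nat \<Rightarrow> tile" where
  "start_tile e e' s = ((e, e'), (0, vcolour (start_state M) (symbol_column s)))"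

text \<open>The horizontal colours 0 and 1 are the states of an automaton: bits as long as the
  colour is 0, only blanks once it is 1. The certificate is thereby a word of any length up to
  \<open>c\<close>, padded with blanks.\<close>

definition certificate_tiles :: "tile set" where
  "certificate_tiles = {start_tile 0 0 1, start_tile 0 0 2, start_tile 0 1 0, start_tile 1 1 0}"

definition rest_tiles :: "tile set" where
  "rest_tiles = {start_tile 0 0 0, start_tile 1 0 0}"

definition final_tiles :: "tile set" where
  "final_tiles = (\<lambda>c. ((0, 0), (vcolour (accept_state M) c, 0))) ` head_columns"

text \<open>The heads start over position \<open>t + 1\<close>. The margins are wide enough that
  even the columns just outside the row remain blank through all rows of the computation.\<close>

definition start_row :: "bool list \<Rightarrow> nat \<Rightarrow> nat \<Rightarrow> tile list list" where
  "start_row x c t = replicate (t + 1) [start_tile 0 0 0] @ map (\<lambda>b. [start_tile 0 0 (bit_symbol b)]) (delimit x) @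
     replicate c (list_of certificate_tiles) @ replicate (t + 2) (list_of rest_tiles)"

definition step_row :: "nat \<Rightarrow> nat \<Rightarrow> nat \<Rightarrow> tile list list" where
  "step_row n c t = [list_of (step_tiles True False False)] @ replicate t (list_of (step_tiles False False False)) @
     [list_of (step_tiles False True False)] @ replicate (2 * n + 1 + c + t) (list_of (step_tiles False False False)) @
     [list_of (step_tiles False False True)]"

definition row_length :: "nat \<Rightarrow> nat \<Rightarrow> nat \<Rightarrow> nat" where
  "row_length n c t = 2 * t + 2 * n + c + 4"

definition tableau_rows :: "bool list \<Rightarrow> nat \<Rightarrow> nat \<Rightarrow> tile list list list" where
  "tableau_rows x c t = start_row x c t # replicate t (step_row (length x) c t) @
     [replicate (row_length (length x) c t) (list_of final_tiles)]"

definition tableau :: "bool list \<Rightarrow> nat \<Rightarrow> nat \<Rightarrow> tile list list" where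
  "tableau x c t = concat (tableau_rows x c t)"

lemma finite_step_tiles: "finite (step_tiles fi ce la)"
proof -
  have "step_tiles fi ce la \<subseteq> (\<lambda>(q, ss, x, y, z). step_tile fi ce la q ss x y z) `
      ({..<num_states M} \<times> head_columns \<times> head_columns \<times> head_columns \<times> head_columns)"
  proof
    fix a assume "a \<in> step_tiles fi ce la"
    then obtain q ss x y z where "a = step_tile fi ce la q ss x y z" "q < num_states M"
      "ss \<in> head_columns" "x \<in> head_columns" "y \<in> head_columns" "z \<in> head_columns"
      unfolding step_tiles_def by blast
    then show "a \<in> (\<lambda>(q, ss, x, y, z). step_tile fi ce la q ss x y z) `
        ({..<num_states M} \<times> head_columns \<times> head_columns \<times> head_columns \<times> head_columns)"
      by (intro image_eqI[of _ _ "(q, ss, x, y, z)"]) simp_all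
  qed
  then show ?thesis
    by (rule finite_subset) (intro finite_imageI finite_SigmaI finite_columns finite_lessThan)
qed

lemma set_tile_lists:
  "set (list_of (step_tiles fi ce la)) = step_tiles fi ce la"
  "set (list_of certificate_tiles) = certificate_tiles"
  "set (list_of rest_tiles) = rest_tiles" "set (list_of final_tiles) = final_tiles"
  using finite_step_tiles finite_columns
  by (auto intro!: set_list_of simp: certificate_tiles_def rest_tiles_def final_tiles_def)

section \<open>The tableau as a rectangular grid\<close>

lemma length_start_row: "length (start_row x c t) = row_length (length x) c t"
  by (simp add: start_row_def row_length_def length_delimit)

lemma length_step_row: "length (step_row n c t) = row_length n c t"
  by (simp add: step_row_def row_length_def)

lemma step_row_nth:
  assumes "p < row_length n c t"
  shows "set (step_row n c t ! p) = step_tiles (p = 0) (p = t + 1) (Suc p = row_length n c t)"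
proof -
  consider "p = 0" | "0 < p" "p < t + 1" | "p = t + 1" | "t + 1 < p" "Suc p < row_length n c t" | "Suc p = row_length n c t"
    using assms by linarith
  then show ?thesis
  proof cases
    case 2
    then have "step_row n c t ! p = list_of (step_tiles False False False)"
      by (auto simp: step_row_def nth_append nth_Cons')
    then show ?thesis using 2 by (simp add: set_tile_lists row_length_def)
  next
    case 4
    then have "step_row n c t ! p = list_of (step_tiles False False False)"
      by (auto simp: step_row_def nth_append nth_Cons' row_length_def)
    then show ?thesis using 4 by (simp add: set_tile_lists)
  qed (auto simp: step_row_def nth_append nth_Cons' row_length_def set_tile_lists)
qed

lemma nth_concat_rows:
  assumes "\<And>r. r \<in> set rs \<Longrightarrow> length r = P" "t < length rs" "p < P"
  shows "concat rs ! (t * P + p) = rs ! t ! p"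
  using assms
proof (induction rs arbitrary: t)
  case (Cons r rs)
  show ?case
  proof (cases t)
    case 0
    then show ?thesis using Cons.prems by (simp add: nth_append)
  next
    case (Suc t')
    have "length r = P" using Cons.prems(1) by simp
    moreover have "concat rs ! (t' * P + p) = rs ! t' ! p"
      using Cons.prems Suc by (intro Cons.IH) auto
    ultimately show ?thesis using Suc by (simp add: nth_append algebra_simps)
  qed
qed simp

lemma length_tableau: "length (tableau x c t) = (t + 2) * row_length (length x) c t"
  by (simp add: tableau_def tableau_rows_def length_concat length_start_row length_step_row sum_list_replicate)

lemma tableau_nth:
  assumes "r < t + 2" "p < row_length (length x) c t"
  shows "tableau x c t ! (r * row_length (length x) c t + p) =
    (if r = 0 then start_row x c t ! p else if r \<le> t then step_row (length x) c t ! p else list_of final_tiles)"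
proof -
  have "tableau x c t ! (r * row_length (length x) c t + p) = tableau_rows x c t ! r ! p"
    unfolding tableau_def using assms
    by (intro nth_concat_rows) (auto simp: tableau_rows_def length_start_row length_step_row)
  also have "\<dots> = (if r = 0 then start_row x c t ! p else if r \<le> t then step_row (length x) c t ! p else list_of final_tiles)"
    using assms by (auto simp: tableau_rows_def nth_Cons' nth_append)
  finally show ?thesis .
qed

definition is_grid :: "bool list \<Rightarrow> nat \<Rightarrow> nat \<Rightarrow> (nat \<Rightarrow> nat \<Rightarrow> tile) \<Rightarrow> bool" where
  "is_grid x c t g \<longleftrightarrow> (let P = row_length (length x) c t in
     (\<forall>p<P. g 0 p \<in> set (start_row x c t ! p)) \<and>
     (\<forall>r p. 0 < r \<and> r \<le> t \<and> p < P \<longrightarrow> g r p \<in> step_tiles (p = 0) (p = t + 1) (Suc p = P)) \<and>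
     (\<forall>p<P. g (t + 1) p \<in> final_tiles) \<and>
     (\<forall>r p. r < t + 2 \<and> p < P \<longrightarrow> left (g r p) = (if p = 0 then 0 else right (g r (p - 1)))) \<and>
     (\<forall>r p. r < t + 2 \<and> p < P \<longrightarrow> lower (g r p) = (if r = 0 then 0 else upper (g (r - 1) p))))"

text \<open>Every row ends with colour 0, so the adjacency between the end of a row and the start of
  the next only says that rows begin with colour 0.\<close>

lemma row_ends:
  "a \<in> step_tiles fi ce True \<Longrightarrow> right a = 0" "a \<in> final_tiles \<Longrightarrow> right a = 0"
  "a \<in> set (start_row x c t ! (row_length (length x) c t - 1)) \<Longrightarrow> right a = 0"
proof -
  have "start_row x c t ! (row_length (length x) c t - 1) = list_of rest_tiles"
    by (simp add: start_row_def row_length_def nth_append length_delimit nth_Cons')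
  then have "set (start_row x c t ! (row_length (length x) c t - 1)) = rest_tiles"
    by (simp only: set_tile_lists)
  then show "a \<in> set (start_row x c t ! (row_length (length x) c t - 1)) \<Longrightarrow> right a = 0"
    by (auto simp: rest_tiles_def start_tile_def)
qed (auto simp: step_tiles_def step_tile_def final_tiles_def)

lemma is_gridD:
  assumes "is_grid x c t g"
  shows "p < row_length (length x) c t \<Longrightarrow> g 0 p \<in> set (start_row x c t ! p)"
    "0 < r \<Longrightarrow> r \<le> t \<Longrightarrow> p < row_length (length x) c t \<Longrightarrow>
      g r p \<in> step_tiles (p = 0) (p = t + 1) (Suc p = row_length (length x) c t)"
    "p < row_length (length x) c t \<Longrightarrow> g (t + 1) p \<in> final_tiles"
    "r < t + 2 \<Longrightarrow> p < row_length (length x) c t \<Longrightarrow> left (g r p) = (if p = 0 then 0 else right (g r (p - 1)))"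
    "r < t + 2 \<Longrightarrow> p < row_length (length x) c t \<Longrightarrow> lower (g r p) = (if r = 0 then 0 else upper (g (r - 1) p))"
  using assms unfolding is_grid_def Let_def by blast+

lemma ex_tiling_iff_grid:
  "(\<exists>T. is_tiling (tableau x c t) (row_length (length x) c t) T) \<longleftrightarrow> (\<exists>g. is_grid x c t g)"
proof
  let ?P = "row_length (length x) c t"
  have P: "0 < ?P" by (simp add: row_length_def)
  have idx: "r * ?P + p < length (tableau x c t)" if "r < t + 2" "p < ?P" for r p
  proof -
    have "r * ?P + p < (r + 1) * ?P" using that by simp
    also have "\<dots> \<le> (t + 2) * ?P" using that by (intro mult_le_mono) auto
    finally show ?thesis unfolding length_tableau .
  qed
  {
    assume "\<exists>T. is_tiling (tableau x c t) ?P T"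
    then obtain T where T: "is_tiling (tableau x c t) ?P T" by blast
    define g where "g r p = T (r * ?P + p)" for r p
    have mem: "g r p \<in> set (if r = 0 then start_row x c t ! p else if r \<le> t then step_row (length x) c t ! p else list_of final_tiles)"
      if "r < t + 2" "p < ?P" for r p
    proof -
      have "g r p \<in> set (tableau x c t ! (r * ?P + p))"
        using T idx[OF that] unfolding is_tiling_def g_def by blast
      then show ?thesis unfolding tableau_nth[OF that] .
    qed
    have m0: "g 0 p \<in> set (start_row x c t ! p)" if "p < ?P" for p using mem[of 0 p] that by simp
    have m1: "g r p \<in> step_tiles (p = 0) (p = t + 1) (Suc p = ?P)" if "0 < r" "r \<le> t" "p < ?P" for r p
      using mem[of r p] that step_row_nth[of p] by simp
    have m2: "g (t + 1) p \<in> final_tiles" if "p < ?P" for p using mem[of "t + 1" p] that by (simp add: set_tile_lists)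
    have last0: "right (g r (?P - 1)) = 0" if "r < t + 2" for r
    proof -
      consider "r = 0" | "0 < r" "r \<le> t" | "r = t + 1" using \<open>r < t + 2\<close> by linarith
      then show ?thesis
        using m0[of "?P - 1"] m1[of r "?P - 1"] m2[of "?P - 1"] row_ends P by cases auto
    qed
    have lefts: "left (g r p) = (if p = 0 then 0 else right (g r (p - 1)))" if "r < t + 2" "p < ?P" for r p
    proof -
      have l: "left (g r p) = (if r * ?P + p = 0 then 0 else right (T (r * ?P + p - 1)))"
        using T idx[OF that] unfolding is_tiling_def g_def by blast
      show ?thesis
      proof (cases "p = 0")
        case True
        have "r * ?P - 1 = (r - 1) * ?P + (?P - 1)" if "0 < r"
          using that P by (cases r) auto
        then show ?thesis using l True last0[of "r - 1"] \<open>r < t + 2\<close> P by (cases "r = 0") (auto simp: g_def)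
      next
        case False
        then have "r * ?P + p - 1 = r * ?P + (p - 1)" by simp
        then show ?thesis using l False by (simp add: g_def)
      qed
    qed
    have lowers: "lower (g r p) = (if r = 0 then 0 else upper (g (r - 1) p))" if "r < t + 2" "p < ?P" for r p
    proof -
      have l: "lower (g r p) = (if r * ?P + p < ?P then 0 else upper (T (r * ?P + p - ?P)))"
        using T idx[OF that] unfolding is_tiling_def g_def by blast
      show ?thesis
      proof (cases r)
        case (Suc r')
        then show ?thesis using l by (simp add: g_def)
      qed (use l that in simp)
    qed
    show "\<exists>g. is_grid x c t g"
      unfolding is_grid_def Let_def using m0 m1 m2 lefts lowers by blast
  }
  {
    assume "\<exists>g. is_grid x c t g"
    then obtain g where g: "is_grid x c t g" by blast
    define T where "T i = g (i div ?P) (i mod ?P)" for i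
    have Tg: "T (r * ?P + p) = g r p" if "p < ?P" for r p
      using that by (simp add: T_def)
    have split: "\<exists>r p. i = r * ?P + p \<and> r < t + 2 \<and> p < ?P" if "i < length (tableau x c t)" for i
    proof (intro exI conjI)
      show "i = i div ?P * ?P + i mod ?P" by simp
      show "i div ?P < t + 2" using that unfolding length_tableau by (rule less_mult_imp_div_less)
      show "i mod ?P < ?P" using P by simp
    qed
    have "T i \<in> set (tableau x c t ! i) \<and> left (T i) = (if i = 0 then 0 else right (T (i - 1))) \<and>
        lower (T i) = (if i < ?P then 0 else upper (T (i - ?P)))" if "i < length (tableau x c t)" for i
    proof -
      obtain r p where i: "i = r * ?P + p" "r < t + 2" "p < ?P" using split[OF \<open>i < length (tableau x c t)\<close>] by blast
      have "g r p \<in> set (tableau x c t ! i)"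
      proof -
        consider "r = 0" | "0 < r" "r \<le> t" | "r = t + 1" using i(2) by linarith
        then show ?thesis
          unfolding i(1) tableau_nth[OF i(2,3)] using is_gridD(1)[OF g i(3)] is_gridD(2)[OF g _ _ i(3), of r] is_gridD(3)[OF g i(3)] i(3)
          by cases (auto simp: step_row_nth set_tile_lists)
      qed
      moreover have "left (g r p) = (if i = 0 then 0 else right (T (i - 1)))"
      proof (cases "p = 0")
        case True
        show ?thesis
        proof (cases r)
          case 0
          then show ?thesis using is_gridD(4)[OF g i(2,3)] i True by simp
        next
          case (Suc r')
          have "i - 1 = r' * ?P + (?P - 1)" using i(1) True Suc P by simp
          then have "T (i - 1) = g r' (?P - 1)" using Tg[of "?P - 1" r'] P by simp
          moreover have "right (g r' (?P - 1)) = 0"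
          proof -
            consider "r' = 0" | "0 < r'" "r' \<le> t" using i(2) Suc by linarith
            then show ?thesis
              using is_gridD(1)[OF g, of "?P - 1"] is_gridD(2)[OF g, of r' "?P - 1"] row_ends P by cases auto
          qed
          moreover have "left (g r p) = 0" using is_gridD(4)[OF g i(2,3)] True by simp
          ultimately show ?thesis by simp
        qed
      next
        case False
        then have "T (i - 1) = g r (p - 1)" using Tg[of "p - 1" r] i by simp
        then show ?thesis using is_gridD(4)[OF g i(2,3)] i False by simp
      qed
      moreover have "lower (g r p) = (if i < ?P then 0 else upper (T (i - ?P)))"
      proof (cases r)
        case 0
        then show ?thesis using is_gridD(5)[OF g i(2,3)] i by simp
      next
        case (Suc r')
        then have "T (i - ?P) = g r' p" using Tg[of p r'] i by simp
        then show ?thesis using is_gridD(5)[OF g i(2,3)] i Suc by simp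
      qed
      ultimately show ?thesis using Tg[OF i(3), of r] i(1) by simp
    qed
    then show "\<exists>T. is_tiling (tableau x c t) ?P T" unfolding is_tiling_def by blast
  }
qed

section \<open>Grids correspond to accepting runs\<close>

lemma start_row_nth:
  assumes "p < row_length (length x) c t"
  shows "set (start_row x c t ! p) = (if p < t + 1 then {start_tile 0 0 0}
    else if p < t + 1 + (2 * length x + 1) then {start_tile 0 0 (bit_symbol (delimit x ! (p - (t + 1))))}
    else if p < t + 1 + (2 * length x + 1) + c then certificate_tiles else rest_tiles)"
proof -
  have "start_row x c t ! p = (if p < t + 1 then [start_tile 0 0 0]
    else if p < t + 1 + (2 * length x + 1) then [start_tile 0 0 (bit_symbol (delimit x ! (p - (t + 1))))]
    else if p < t + 1 + (2 * length x + 1) + c then list_of certificate_tiles else list_of rest_tiles)"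
    using assms by (auto simp: start_row_def row_length_def nth_append length_delimit nth_Cons' simp del: replicate_Suc)
  then show ?thesis by (simp add: set_tile_lists)
qed

abbreviation offset :: "nat \<Rightarrow> nat \<Rightarrow> int" where
  "offset t p \<equiv> int p - int (t + 1)"

lemma input_symbol_pair_code:
  "input_symbol (pair_code x y) (offset t p) = (if p < t + 1 then 0
    else if p < t + 1 + (2 * length x + 1) then bit_symbol (delimit x ! (p - (t + 1)))
    else if p - (t + 1 + (2 * length x + 1)) < length y then bit_symbol (y ! (p - (t + 1 + (2 * length x + 1)))) else 0)"
proof -
  have "nat (offset t p) = p - (t + 1)" by simp
  then show ?thesis
    by (auto simp: input_symbol_def pair_code_def length_delimit nth_append)
qed

lemma state_at_0: "state_at u 0 = start_state M"
  by (simp add: state_at_def run_def initial_config_def)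

lemma blank_post:
  assumes "o' < - int t - 1 \<or> int (length u) + int t < o'" "r \<le> t"
  shows "post_at u r o' = blank_column"
  using assms blank_outside[of o' r u] by (auto simp: post_def)

lemma length_pair_code: "length (pair_code x y) = 2 * length x + 1 + length y"
  by (simp add: pair_code_def length_delimit)

lemma grid_from_run:
  assumes y: "length y \<le> c" and acc: "state_at (pair_code x y) t = accept_state M"
  shows "\<exists>g. is_grid x c t g"
proof -
  let ?u = "pair_code x y" and ?P = "row_length (length x) c t" and ?b = "t + 1 + (2 * length x + 1)"
  \<comment> \<open>\<open>e p\<close> is the colour of the edge to the left of position
    \<open>p\<close>: it is 1 from behind the first padding blank up to the beginning of the right
    margin.\<close>
  define e :: "nat \<Rightarrow> nat" where "e p = of_bool (?b + length y < p \<and> p \<le> ?b + c)" for p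
  define g where "g r p = (if r = 0 then start_tile (e p) (e (Suc p)) (input_symbol ?u (offset t p))
    else if r \<le> t then step_tile (p = 0) (p = t + 1) (Suc p = ?P) (state_at ?u (r - 1)) (head_column (tapes_at ?u (r - 1)) 0)
      (post_at ?u (r - 1) (offset t p - 1)) (post_at ?u (r - 1) (offset t p)) (post_at ?u (r - 1) (offset t p + 1))
    else ((0, 0), (vcolour (accept_state M) (head_column (tapes_at ?u t) (offset t p)), 0)))" for r p
  have up: "upper (g r p) = vcolour (state_at ?u r) (head_column (tapes_at ?u r) (offset t p))" if "r \<le> t" for r p
  proof (cases r)
    case 0
    then show ?thesis by (simp add: g_def start_tile_def state_at_0 column_0)
  next
    case (Suc r')
    then show ?thesis using that by (simp add: g_def step_tile_def run_step action_at_def)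
  qed
  have row0: "g 0 p \<in> set (start_row x c t ! p)" if "p < ?P" for p
    unfolding start_row_nth[OF that] g_def input_symbol_pair_code
    using y by (auto simp: e_def certificate_tiles_def rest_tiles_def bit_symbol_def)
  have rows: "g r p \<in> step_tiles (p = 0) (p = t + 1) (Suc p = ?P)" if "0 < r" "r \<le> t" "p < ?P" for r p
  proof -
    have first: "post_at ?u (r - 1) (offset t p - 1) = blank_column" if "p = 0"
      using \<open>r \<le> t\<close> that by (intro blank_post[of _ t]) auto
    have last: "post_at ?u (r - 1) (offset t p + 1) = blank_column" if "Suc p = ?P"
      using \<open>r \<le> t\<close> that y by (intro blank_post[of _ t]) (auto simp: row_length_def length_pair_code)
    have centre: "post_at ?u (r - 1) (offset t p) = map fst (snd (action_at ?u (r - 1)))" if "p = t + 1"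
      using that by (simp add: post_def)
    have "g r p = step_tile (p = 0) (p = t + 1) (Suc p = ?P) (state_at ?u (r - 1)) (head_column (tapes_at ?u (r - 1)) 0)
      (post_at ?u (r - 1) (offset t p - 1)) (post_at ?u (r - 1) (offset t p)) (post_at ?u (r - 1) (offset t p + 1))"
      using that by (simp add: g_def)
    then show ?thesis
      unfolding step_tiles_def using good_run[of ?u "r - 1"] post_at_in first last centre
      unfolding action_at_def by blast
  qed
  have fin: "g (t + 1) p \<in> final_tiles" for p
    using good_run[of ?u t] by (simp add: g_def final_tiles_def)
  have lefts: "left (g r p) = (if p = 0 then 0 else right (g r (p - 1)))" if "r < t + 2" "p < ?P" for r p
  proof (cases "p = 0")
    case True
    then show ?thesis by (simp add: g_def start_tile_def step_tile_def e_def)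
  next
    case False
    then obtain p' where p: "p = Suc p'" by (cases p) auto
    then show ?thesis using that by (simp add: g_def start_tile_def step_tile_def algebra_simps)
  qed
  have lowers: "lower (g r p) = (if r = 0 then 0 else upper (g (r - 1) p))" if "r < t + 2" "p < ?P" for r p
  proof (cases r)
    case 0
    then show ?thesis by (simp add: g_def start_tile_def)
  next
    case (Suc r')
    have "offset t p = 0 \<longleftrightarrow> p = t + 1" by auto
    then have "lower (g r p) = vcolour (state_at ?u r') (head_column (tapes_at ?u r') (offset t p))"
      using Suc that acc by (cases "r' = t") (auto simp: g_def step_tile_def post_def)
    moreover have "r' \<le> t" using Suc that by simp
    ultimately show ?thesis using up[of r' p] Suc by simp
  qed
  show ?thesis
    unfolding is_grid_def Let_def using row0 rows fin lefts lowers by blast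
qed

text \<open>The certificate is read off the bottom row. By induction on the rows, vertical colours
  determine the state and all columns; horizontal colours make the tiles of a row agree on the
  symbols read, so that the row is the next configuration of the run.\<close>

lemma run_from_grid:
  assumes g: "is_grid x c t g"
  shows "\<exists>y. length y \<le> c \<and> state_at (pair_code x y) t = accept_state M"
proof -
  let ?P = "row_length (length x) c t" and ?b = "t + 1 + (2 * length x + 1)"
  have bP: "?b + c < ?P" by (simp add: row_length_def)
  let ?v = "\<lambda>s. vcolour (start_state M) (symbol_column s)"
  \<comment> \<open>Left colour 0 at position \<open>i\<close> means that the certificate has not
    ended yet, hence that all \<open>i\<close> cells so far hold bits.\<close>
  have cert: "\<exists>y. length y \<le> i \<and> (\<forall>j<i. upper (g 0 (?b + j)) = ?v (if j < length y then bit_symbol (y ! j) else 0)) \<and>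
      (left (g 0 (?b + i)) = 0 \<longrightarrow> length y = i)" if "i \<le> c" for i
    using that
  proof (induction i)
    case 0
    show ?case by simp
  next
    case (Suc i)
    then obtain y where y: "length y \<le> i" "\<forall>j<i. upper (g 0 (?b + j)) = ?v (if j < length y then bit_symbol (y ! j) else 0)"
      "left (g 0 (?b + i)) = 0 \<longrightarrow> length y = i" by auto
    have "?b + i < ?P" "?b + Suc i < ?P" using Suc.prems bP by auto
    then have tile: "g 0 (?b + i) \<in> certificate_tiles" and next_left: "left (g 0 (?b + Suc i)) = right (g 0 (?b + i))"
      using is_gridD(1)[OF g, of "?b + i"] is_gridD(4)[OF g, of 0 "?b + Suc i"] Suc.prems by (auto simp: start_row_nth)
    from tile consider "g 0 (?b + i) = start_tile 0 0 1" | "g 0 (?b + i) = start_tile 0 0 2"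
      | "g 0 (?b + i) = start_tile 0 1 0" | "g 0 (?b + i) = start_tile 1 1 0"
      unfolding certificate_tiles_def by blast
    then show ?case
    proof cases
      case 1
      then have "length y = i" using y(3) by (simp add: start_tile_def)
      then show ?thesis using y 1 next_left
        by (intro exI[of _ "y @ [False]"]) (auto simp: start_tile_def nth_append less_Suc_eq bit_symbol_def)
    next
      case 2
      then have "length y = i" using y(3) by (simp add: start_tile_def)
      then show ?thesis using y 2 next_left
        by (intro exI[of _ "y @ [True]"]) (auto simp: start_tile_def nth_append less_Suc_eq bit_symbol_def)
    next
      case 3
      then show ?thesis using y next_left
        by (intro exI[of _ y]) (auto simp: start_tile_def less_Suc_eq)
    next
      case 4
      then show ?thesis using y next_left
        by (intro exI[of _ y]) (auto simp: start_tile_def less_Suc_eq)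
    qed
  qed
  from cert[of c] obtain y where y: "length y \<le> c"
    "\<And>j. j < c \<Longrightarrow> upper (g 0 (?b + j)) = ?v (if j < length y then bit_symbol (y ! j) else 0)" by auto
  let ?u = "pair_code x y"
  have up: "upper (g r p) = vcolour (state_at ?u r) (head_column (tapes_at ?u r) (offset t p))"
    if "r \<le> t" "p < ?P" for r p
    using that
  proof (induction r arbitrary: p)
    case 0
    consider "p < ?b" | "?b \<le> p" "p < ?b + c" | "?b + c \<le> p" by linarith
    then have "upper (g 0 p) = ?v (input_symbol ?u (offset t p))"
    proof cases
      case 1
      then show ?thesis
        unfolding input_symbol_pair_code using is_gridD(1)[OF g 0(2)] 0(2)
        by (auto simp: start_row_nth start_tile_def split: if_splits)
    next
      case 2
      then have j: "p - ?b < c" "?b + (p - ?b) = p" by linarith+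
      from y(2)[OF j(1)] show ?thesis unfolding input_symbol_pair_code j(2) using 2 by simp
    next
      case 3
      then show ?thesis
        unfolding input_symbol_pair_code using is_gridD(1)[OF g 0(2)] 0(2) y(1)
        by (auto simp: start_row_nth start_tile_def rest_tiles_def split: if_splits)
    qed
    then show ?case by (simp add: state_at_0 column_0)
  next
    case (Suc r)
    let ?q = "state_at ?u r" and ?c = "\<lambda>p. head_column (tapes_at ?u r) (offset t p)"
    have "\<exists>q ss X Y Z. g (Suc r) p = step_tile (p = 0) (p = t + 1) (Suc p = ?P) q ss X Y Z \<and>
        (p = 0 \<longrightarrow> X = blank_column) \<and> (Suc p = ?P \<longrightarrow> Z = blank_column) \<and> (p = t + 1 \<longrightarrow> Y = map fst (snd (action q ss)))"
      if "p < ?P" for p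
      using is_gridD(2)[OF g _ Suc.prems(1) that] unfolding step_tiles_def by blast
    then obtain q ss X Y Z where tile: "\<And>p. p < ?P \<Longrightarrow> g (Suc r) p = step_tile (p = 0) (p = t + 1) (Suc p = ?P) (q p) (ss p) (X p) (Y p) (Z p) \<and>
        (p = 0 \<longrightarrow> X p = blank_column) \<and> (Suc p = ?P \<longrightarrow> Z p = blank_column) \<and> (p = t + 1 \<longrightarrow> Y p = map fst (snd (action (q p) (ss p))))"
      by metis
    have low: "q p = ?q \<and> (if p = t + 1 then ss p else Y p) = ?c p" if "p < ?P" for p
    proof -
      have "lower (g (Suc r) p) = upper (g r p)" using is_gridD(5)[OF g _ that, of "Suc r"] Suc.prems(1) by simp
      then show ?thesis using Suc.IH[OF _ that] Suc.prems(1) tile[OF that] by (simp add: step_tile_def split: if_splits)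
    qed
    have link: "ss (Suc p) = ss p \<and> X (Suc p) = Y p \<and> Z p = Y (Suc p)" if "Suc p < ?P" for p
    proof -
      have "left (g (Suc r) (Suc p)) = right (g (Suc r) p)"
        using is_gridD(4)[OF g _ that, of "Suc r"] Suc.prems(1) by simp
      then show ?thesis using tile[OF that] tile[of p] that by (simp add: step_tile_def)
    qed
    \<comment> \<open>A tile could guess any symbols \<open>ss\<close>; equality along the row
      reduces this to the centre, whose lower colour shows what is really read.\<close>
    have ss0: "ss p = ss 0" if "p < ?P" for p
      using that by (induction p) (use link in auto)
    have tP: "t + 1 < ?P" using bP by simp
    have ss: "ss p = head_column (tapes_at ?u r) 0" if "p < ?P" for p
      using ss0[OF that] ss0[OF tP] low[OF tP] by simp
    have act: "action (q p) (ss p) = action_at ?u r" if "p < ?P" for p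
      using low[OF that] ss[OF that] by (simp add: action_at_def)
    have Y: "Y p = post_at ?u r (offset t p)" if "p < ?P" for p
      using tile[OF that] low[OF that] act[OF that] by (auto simp: post_def split: if_splits)
    have X: "X p = post_at ?u r (offset t p - 1)" if "p < ?P" for p
    proof (cases p)
      case 0
      have "post_at ?u r (offset t 0 - 1) = blank_column"
        using Suc.prems(1) by (intro blank_post[of _ t]) auto
      then show ?thesis using 0 tile[OF that] by simp
    next
      case (Suc p')
      then show ?thesis using link[of p'] Y[of p'] that by (simp add: algebra_simps)
    qed
    have Z: "Z p = post_at ?u r (offset t p + 1)" if "p < ?P" for p
    proof (cases "Suc p = ?P")
      case True
      have "post_at ?u r (offset t p + 1) = blank_column"
        using Suc.prems(1) True y(1) by (intro blank_post[of _ t]) (auto simp: row_length_def length_pair_code)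
      then show ?thesis using True tile[OF that] by simp
    next
      case False
      then show ?thesis using link[of p] Y[of "Suc p"] that by (simp add: algebra_simps)
    qed
    show ?case
      using tile[OF Suc.prems(2)] act[OF Suc.prems(2)] X[OF Suc.prems(2)] Y[OF Suc.prems(2)] Z[OF Suc.prems(2)]
      by (simp add: step_tile_def run_step)
  qed
  have "g (t + 1) 0 \<in> final_tiles" "lower (g (t + 1) 0) = upper (g t 0)"
    using is_gridD(3)[OF g, of 0] is_gridD(5)[OF g, of "t + 1" 0] bP by auto
  then have "state_at ?u t = accept_state M"
    using up[of t 0] bP by (auto simp: final_tiles_def)
  then show ?thesis using y(1) by blast
qed

lemma tiling_iff_accepting:
  "(\<exists>T. is_tiling (tableau x c t) (row_length (length x) c t) T) \<longleftrightarrow>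
   (\<exists>y. length y \<le> c \<and> fst (run M (pair_code x y) t) = accept_state M)"
  unfolding ex_tiling_iff_grid using grid_from_run run_from_grid unfolding state_at_def by blast

end


section \<open>The reduction\<close>

lemma feasible_enumerate: "feasible P f \<Longrightarrow> feasible P (\<lambda>x. List.enumerate 0 (f x))"
proof -
  assume f: "feasible P f"
  have *: "foldl (\<lambda>a y. (length a, y) # a) [] ys = rev (List.enumerate 0 ys)" for ys :: "'b list"
    by (induction ys rule: rev_induct) (auto simp: enumerate_append_eq)
  have sz_rev: "sz (rev xs) = sz xs" for xs :: "(nat \<times> 'b) list"
  proof (induction xs)
    case (Cons x xs)
    then show ?case using sz_append[of "rev xs" "[x]"] by simp
  qed simp
  have bound: "sz (List.enumerate n ys) \<le> sz ys + length ys * (2 * (n + length ys) + 3)" for n and ys :: "'b list"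
  proof (induction ys arbitrary: n)
    case (Cons y ys)
    show ?case using Cons[of "Suc n"] by (simp add: sz_nat algebra_simps)
  qed simp
  have "feasible P (\<lambda>x. foldl (\<lambda>a y. (length a, y) # a) [] (f x))"
  proof (rule feasible_foldl[where q = "\<lambda>x. sz (f x) + sz (f x) * (2 * sz (f x) + 3)"])
    fix c k
    let ?ys = "take k (f c)"
    have "sz (List.enumerate 0 ?ys) \<le> sz ?ys + length ?ys * (2 * length ?ys + 3)" using bound[of 0 ?ys] by simp
    moreover have "sz ?ys \<le> sz (f c)" by (rule sz_take)
    moreover have "length ?ys \<le> sz (f c)" using length_le_sz[of ?ys] sz_take[of k "f c"] by simp
    then have "length ?ys * (2 * length ?ys + 3) \<le> sz (f c) * (2 * sz (f c) + 3)"
      by (intro mult_le_mono add_mono) auto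
    ultimately show "sz (foldl (\<lambda>a y. (length a, y) # a) [] ?ys) \<le> sz (f c) + sz (f c) * (2 * sz (f c) + 3)"
      unfolding * sz_rev by linarith
    show "polybounded (\<lambda>x. sz (f x) + sz (f x) * (2 * sz (f x) + 3))" if P
      using f that by (intro polybounded_intros feasible_polybounded_sz) simp_all
  qed (intro feasible_intros f)+
  from feasible_rev[OF this] show ?thesis by (simp add: *)
qed

lemma feasible_cover_bits:
  assumes "feasible P n" "feasible P p" "feasible P i" "feasible P a"
  shows "feasible P (\<lambda>x. cover_bits (n x) (p x) W (i x) (a x))"
proof -
  have "feasible P (\<lambda>z. cover_bits (fst (fst z)) (snd (fst z)) W (fst (snd z)) (snd (snd z)))"
    unfolding cover_bits_def block_def by (intro feasible_intros)
  from feasible_comp[OF feasible_Pair[OF feasible_Pair[OF assms(1,2)] feasible_Pair[OF assms(3,4)]] this]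
  show ?thesis by simp
qed

lemma feasible_spread: "feasible P n \<Longrightarrow> feasible P e \<Longrightarrow> feasible P (\<lambda>x. spread (n x) (e x))"
proof (rule feasible_comp2[where h = spread])
  show "feasible P (\<lambda>p. spread (fst p) (snd p))"
    unfolding spread_def by (intro feasible_intros)
qed

definition item_list :: "nat \<Rightarrow> tile list list \<Rightarrow> nat \<Rightarrow> bool list list" where
  "item_list W TS P = concat (map (\<lambda>y. map (\<lambda>a. item_bits (length TS) P W (fst y) a) (snd y)) (List.enumerate 0 TS))"

lemma feasible_item_list: "feasible P f \<Longrightarrow> feasible P g \<Longrightarrow> feasible P (\<lambda>x. item_list W (f x) (g x))"
proof (rule feasible_comp2[where h = "item_list W"])
  show "feasible P (\<lambda>p. item_list W (fst p) (snd p))"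
    unfolding item_list_def item_bits_def
    by (intro feasible_intros feasible_spread feasible_cover_bits feasible_enumerate)
qed

lemma feasible_target_bits: "feasible P n \<Longrightarrow> feasible P (\<lambda>x. target_bits (n x) W)"
  unfolding target_bits_def by (intro feasible_intros feasible_spread)

text \<open>Codes are written without arithmetic, least significant bit first: doubling prepends
  \<open>False\<close>, and for odd \<open>t\<close> with bits \<open>True # v\<close> the number
  \<open>4 * t - 1\<close> is 3 plus 8 times the value of \<open>v\<close>, with bits
  \<open>True # True # False # v\<close>.\<close>

definition shift_code :: "bool list \<Rightarrow> bool list" where
  "shift_code b = int_code 1 @ (False # delimit (False # b)) @ int_code 0 @ int_code 1"

definition open_code :: "bool list \<Rightarrow> bool list" where
  "open_code b = int_code 1 @ (True # delimit (False # b)) @ int_code 2 @ (True # delimit (True # True # False # tl b))"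

definition close_code :: "bool list \<Rightarrow> bool list" where
  "close_code b = int_code 1 @ (False # delimit (False # b)) @ int_code (- 2) @ (True # delimit (True # True # False # tl b))"

text \<open>\<open>nat_bits\<close> yields no leading zeros, hence the condition on the last bit. In
  the open and close matrices \<open>hd b\<close> makes the number odd, and a nonempty
  \<open>tl b\<close> prevents the rewritten entry from ending in the bit
  \<open>False\<close>.\<close>

lemma matrix_codes:
  assumes "b \<noteq> []" "last b"
  shows "shift_code b = matrix_code (shift_mat (int (bits_val b)))"
    "hd b \<Longrightarrow> tl b \<noteq> [] \<Longrightarrow> open_code b = matrix_code (open_mat (int (bits_val b)))"
    "hd b \<Longrightarrow> tl b \<noteq> [] \<Longrightarrow> close_code b = matrix_code (close_mat (int (bits_val b)))"
proof -
  have b2: "nat_bits (2 * bits_val b) = False # b"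
    using nat_bits_bits_val[of "False # b"] assms by simp
  have pos: "0 < bits_val b"
    using nat_bits_bits_val[of b] assms nat_bits.simps[of 0] by (cases "bits_val b = 0") auto
  have i2: "int_code (2 * int (bits_val b)) = False # delimit (False # b)"
    using b2 by (simp add: int_code_def nat_mult_distrib)
  have i2': "int_code (- (2 * int (bits_val b))) = True # delimit (False # b)"
    using b2 pos by (simp add: int_code_def nat_mult_distrib)
  show "shift_code b = matrix_code (shift_mat (int (bits_val b)))"
    using i2 by (simp add: shift_code_def matrix_code_def shift_mat_def)
  have i4: "int_code (1 - 4 * int (bits_val b)) = True # delimit (True # True # False # tl b)" if hb: "hd b" "tl b \<noteq> []"
  proof -
    obtain v where v: "b = True # v" "v \<noteq> []" using hb assms by (cases b) auto
    have "nat_bits (bits_val (True # True # False # v)) = True # True # False # v"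
      using assms v by (intro nat_bits_bits_val) simp
    moreover have "nat \<bar>1 - 4 * int (bits_val b)\<bar> = bits_val (True # True # False # v)"
      using v by simp
    ultimately show ?thesis using v by (simp add: int_code_def)
  qed
  show "hd b \<Longrightarrow> tl b \<noteq> [] \<Longrightarrow> open_code b = matrix_code (open_mat (int (bits_val b)))"
    using i2' i4 by (simp add: open_code_def matrix_code_def open_mat_def)
  show "hd b \<Longrightarrow> tl b \<noteq> [] \<Longrightarrow> close_code b = matrix_code (close_mat (int (bits_val b)))"
    using i2 i4 by (simp add: close_code_def matrix_code_def close_mat_def)
qed

definition sum_instance :: "bool list list \<Rightarrow> bool list \<Rightarrow> bool list" where
  "sum_instance items target = (True # open_code target) @ (True # close_code target) @
     concat (map (\<lambda>b. True # shift_code b) items) @ [False]"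

lemma feasible_sum_instance:
  "feasible P f \<Longrightarrow> feasible P g \<Longrightarrow> feasible P (\<lambda>x. sum_instance (f x) (g x))"
  unfolding sum_instance_def open_code_def close_code_def shift_code_def
  by (intro feasible_intros feasible_delimit)

lemma ex_map_subset: "set xs \<subseteq> f ` A \<Longrightarrow> \<exists>ys. set ys \<subseteq> A \<and> xs = map f ys"
proof (induction xs)
  case (Cons x xs)
  then obtain ys where "set ys \<subseteq> A" "xs = map f ys" by auto
  moreover obtain y where "y \<in> A" "x = f y" using Cons.prems by auto
  ultimately show ?case by (intro exI[of _ "y # ys"]) auto
qed simp

lemma sum_instance_iff:
  assumes items: "\<And>b. b \<in> set items \<Longrightarrow> b \<noteq> [] \<and> last b"
    and target: "target \<noteq> []" "last target" "hd target" "tl target \<noteq> []"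
  shows "sum_instance items target \<in> infinite_factorization_problem \<longleftrightarrow>
    (\<exists>bs. set bs \<subseteq> set items \<and> sum_list (map bits_val bs) = bits_val target)"
proof -
  let ?t = "int (bits_val target)"
  let ?As = "open_mat ?t # close_mat ?t # map (\<lambda>b. shift_mat (int (bits_val b))) items"
  let ?X = "(\<lambda>b. int (bits_val b)) ` set items"
  have codes: "map (\<lambda>A. True # matrix_code A) (map (\<lambda>b. shift_mat (int (bits_val b))) items) =
      map (\<lambda>b. True # shift_code b) items"
    unfolding map_map using items matrix_codes(1) by (intro map_cong) auto
  have "sum_instance items target = instance_code ?As"
    unfolding sum_instance_def instance_code_def list.map(2) codes
    using matrix_codes(2,3)[OF target] by simp
  moreover have "set ?As = sum_mats ?X ?t"
    by (auto simp: sum_mats_def)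
  moreover have "instance_code As \<in> infinite_factorization_problem \<longleftrightarrow>
      set As \<subseteq> SL2Z \<and> has_infinitely_factorizable (set As)" for As
    unfolding infinite_factorization_problem_def using injD[OF inj_instance_code] by blast
  ultimately have "sum_instance items target \<in> infinite_factorization_problem \<longleftrightarrow> has_infinitely_factorizable (sum_mats ?X ?t)"
    using sum_mats_SL2Z[of ?X ?t] by (simp only: simp_thms)
  also have "\<dots> \<longleftrightarrow> (\<exists>xs. set xs \<subseteq> ?X \<and> sum_list xs = ?t)"
  proof (rule sum_mats_iff)
    have pos: "0 < bits_val b" if "b \<noteq> []" "last b" for b
    proof (rule ccontr)
      assume "\<not> 0 < bits_val b"
      then have "nat_bits 0 = b" using nat_bits_bits_val[of b] that by simp
      then show False using that by (simp add: nat_bits.simps)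
    qed
    show "0 < x" if "x \<in> ?X" for x using that items pos by auto
    show "0 < ?t" using pos target by simp
  qed simp
  also have "\<dots> \<longleftrightarrow> (\<exists>bs. set bs \<subseteq> set items \<and> sum_list (map bits_val bs) = bits_val target)"
  proof
    assume "\<exists>xs. set xs \<subseteq> ?X \<and> sum_list xs = ?t"
    then obtain xs where xs: "set xs \<subseteq> ?X" "sum_list xs = ?t" by blast
    obtain bs where bs: "set bs \<subseteq> set items" "xs = map (\<lambda>b. int (bits_val b)) bs"
      using ex_map_subset[OF xs(1)] by blast
    have "int (sum_list (map bits_val bs)) = sum_list (map (\<lambda>b. int (bits_val b)) bs)" for bs
      by (induction bs) auto
    then have "int (sum_list (map bits_val bs)) = ?t" using xs(2) bs(2) by simp
    then show "\<exists>bs. set bs \<subseteq> set items \<and> sum_list (map bits_val bs) = bits_val target"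
      using bs(1) by (intro exI[of _ bs]) simp
  next
    assume "\<exists>bs. set bs \<subseteq> set items \<and> sum_list (map bits_val bs) = bits_val target"
    then obtain bs where bs: "set bs \<subseteq> set items" "sum_list (map bits_val bs) = bits_val target" by blast
    have "int (sum_list (map bits_val bs)) = sum_list (map (\<lambda>b. int (bits_val b)) bs)" for bs
      by (induction bs) auto
    then have "sum_list (map (\<lambda>b. int (bits_val b)) bs) = ?t" using bs(2) by metis
    then show "\<exists>xs. set xs \<subseteq> ?X \<and> sum_list xs = ?t"
      using bs(1) by (intro exI[of _ "map (\<lambda>b. int (bits_val b)) bs"]) auto
  qed
  finally show ?thesis .
qed

lemma set_enumerate: "set (List.enumerate 0 xs) = {(i, xs ! i) | i. i < length xs}"
  by (auto simp: in_set_enumerate_eq)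

lemma item_list_iff_tiling:
  assumes P: "0 < P" and TS: "TS \<noteq> []"
    and W: "\<And>l a. l \<in> set TS \<Longrightarrow> a \<in> set l \<Longrightarrow> left a \<le> W \<and> right a \<le> W \<and> lower a \<le> W \<and> upper a \<le> W"
  shows "sum_instance (item_list W TS P) (target_bits (length TS) W) \<in> infinite_factorization_problem \<longleftrightarrow>
    (\<exists>T. is_tiling TS P T)"
proof -
  let ?N = "length TS"
  let ?Y = "{(i, a). i < ?N \<and> a \<in> set (TS ! i)}"
  let ?f = "\<lambda>y. item_bits ?N P W (fst y) (snd y)"
  have items: "set (item_list W TS P) = ?f ` ?Y"
    unfolding item_list_def set_concat set_map set_enumerate by force
  obtain n where n: "?N * (2 * W + 1) = Suc n"
    using TS by (cases "?N * (2 * W + 1)") auto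
  obtain k where k: "?N = Suc k" using TS by (cases ?N) auto
  \<comment> \<open>All digits of the target are 1, so it is odd; this is what makes the bit
    formulas for the open and close matrices applicable.\<close>
  have t: "target_bits ?N W = True # (replicate ?N False @ spread ?N (replicate n True)) @ replicate ?N True"
    unfolding target_bits_def n by (simp add: spread_def)
  have "sum_instance (item_list W TS P) (target_bits ?N W) \<in> infinite_factorization_problem \<longleftrightarrow>
    (\<exists>bs. set bs \<subseteq> ?f ` ?Y \<and> sum_list (map bits_val bs) = bits_val (target_bits ?N W))"
    unfolding items[symmetric]
  proof (rule sum_instance_iff)
    show "b \<noteq> [] \<and> last b" if "b \<in> set (item_list W TS P)" for b
      using that unfolding items by (auto simp: item_bits_def)
    show "last (target_bits ?N W)" unfolding t using k by (simp add: last_append)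
  qed (use TS in \<open>simp_all add: t\<close>)
  also have "\<dots> \<longleftrightarrow> (\<exists>ys. set ys \<subseteq> ?Y \<and> sum_list (map (\<lambda>(i, a). bits_val (item_bits ?N P W i a)) ys) = bits_val (target_bits ?N W))"
  proof
    assume "\<exists>bs. set bs \<subseteq> ?f ` ?Y \<and> sum_list (map bits_val bs) = bits_val (target_bits ?N W)"
    then obtain bs where bs: "set bs \<subseteq> ?f ` ?Y" "sum_list (map bits_val bs) = bits_val (target_bits ?N W)" by blast
    obtain ys where ys: "set ys \<subseteq> ?Y" "bs = map ?f ys" using ex_map_subset[OF bs(1)] by blast
    have "map (\<lambda>(i, a). bits_val (item_bits ?N P W i a)) ys = map bits_val bs"
      unfolding ys(2) by (simp add: case_prod_unfold)
    then show "\<exists>ys. set ys \<subseteq> ?Y \<and> sum_list (map (\<lambda>(i, a). bits_val (item_bits ?N P W i a)) ys) = bits_val (target_bits ?N W)"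
      using ys(1) bs(2) by (intro exI[of _ ys]) simp
  next
    assume "\<exists>ys. set ys \<subseteq> ?Y \<and> sum_list (map (\<lambda>(i, a). bits_val (item_bits ?N P W i a)) ys) = bits_val (target_bits ?N W)"
    then obtain ys where ys: "set ys \<subseteq> ?Y"
      "sum_list (map (\<lambda>(i, a). bits_val (item_bits ?N P W i a)) ys) = bits_val (target_bits ?N W)" by blast
    have eq: "map bits_val (map ?f ys) = map (\<lambda>(i, a). bits_val (item_bits ?N P W i a)) ys"
      by (simp add: case_prod_unfold)
    show "\<exists>bs. set bs \<subseteq> ?f ` ?Y \<and> sum_list (map bits_val bs) = bits_val (target_bits ?N W)"
    proof (intro exI conjI)
      show "set (map ?f ys) \<subseteq> ?f ` ?Y" using ys(1) by (simp only: set_map image_mono)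
      show "sum_list (map bits_val (map ?f ys)) = bits_val (target_bits ?N W)" unfolding eq by (rule ys(2))
    qed
  qed
  also have "\<dots> \<longleftrightarrow> (\<exists>T. is_tiling TS P T)"
    by (rule tiling_iff_sum[OF P, symmetric]) (use W nth_mem in blast)
  finally show ?thesis .
qed

section \<open>The reduction belonging to a machine\<close>

context machine_tiling
begin

definition tiles :: "tile set" where
  "tiles = (\<Union>fi. \<Union>ce. \<Union>la. step_tiles fi ce la) \<union> certificate_tiles \<union> rest_tiles \<union> final_tiles \<union>
     range (\<lambda>b. start_tile 0 0 (bit_symbol b))"

lemma finite_tiles: "finite tiles"
  by (auto simp: tiles_def finite_step_tiles certificate_tiles_def rest_tiles_def final_tiles_def finite_columns)

lemma tableau_tiles: "l \<in> set (tableau x c t) \<Longrightarrow> a \<in> set l \<Longrightarrow> a \<in> tiles"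
proof -
  have sub: "b \<in> step_tiles fi ce la \<Longrightarrow> b \<in> tiles" "b \<in> certificate_tiles \<Longrightarrow> b \<in> tiles"
    "b \<in> rest_tiles \<Longrightarrow> b \<in> tiles" "b \<in> final_tiles \<Longrightarrow> b \<in> tiles"
    "start_tile 0 0 (bit_symbol d) \<in> tiles" "start_tile 0 0 0 \<in> tiles" for fi ce la b d
    by (auto simp: tiles_def rest_tiles_def)
  assume "l \<in> set (tableau x c t)" "a \<in> set l"
  then show "a \<in> tiles"
    by (auto simp: tableau_def tableau_rows_def start_row_def step_row_def set_tile_lists sub split: if_splits)
qed

text \<open>The number of colours depends on the machine but not on its input, so the unary coding
  of colours costs only a constant factor.\<close>

definition palette :: nat where
  "palette = Max (insert 0 (\<Union>a\<in>tiles. {left a, right a, lower a, upper a}))"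

lemma palette_bound:
  assumes "a \<in> tiles"
  shows "left a \<le> palette \<and> right a \<le> palette \<and> lower a \<le> palette \<and> upper a \<le> palette"
  unfolding palette_def using assms finite_tiles by (intro conjI Max_ge) auto

text \<open>For a fixed machine the tile lists are constants that the program merely pushes. That
  they come from choice and from \<open>to_nat\<close> has no effect on feasibility.\<close>

lemma feasible_tableau:
  assumes "feasible P f" "feasible P c" "feasible P t"
  shows "feasible P (\<lambda>x. tableau (f x) (c x) (t x))"
proof -
  have b: "start_tile 0 0 (bit_symbol b) = (if b then start_tile 0 0 2 else start_tile 0 0 1)" for b
    by (simp add: bit_symbol_def)
  show ?thesis
    unfolding tableau_def tableau_rows_def start_row_def step_row_def row_length_def b
    by (intro feasible_intros feasible_delimit assms)
qed

definition reduction :: "(nat \<Rightarrow> nat) \<Rightarrow> (nat \<Rightarrow> nat) \<Rightarrow> bool list \<Rightarrow> bool list" where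
  "reduction c t x = sum_instance
     (item_list palette (tableau x (c (length x)) (t (length x))) (row_length (length x) (c (length x)) (t (length x))))
     (target_bits (length (tableau x (c (length x)) (t (length x)))) palette)"

lemma reduction_iff:
  "reduction c t x \<in> infinite_factorization_problem \<longleftrightarrow>
   (\<exists>y. length y \<le> c (length x) \<and> fst (run M (pair_code x y) (t (length x))) = accept_state M)"
  unfolding reduction_def tiling_iff_accepting[symmetric]
proof (rule item_list_iff_tiling)
  show "0 < row_length (length x) (c (length x)) (t (length x))" by (simp add: row_length_def)
  have "length (tableau x (c (length x)) (t (length x))) \<noteq> 0"
    unfolding length_tableau by (simp add: row_length_def)
  then show "tableau x (c (length x)) (t (length x)) \<noteq> []" by auto
qed (use tableau_tiles palette_bound in blast)

lemma feasible_reduction: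
  fixes p q :: "nat poly"
  shows "feasible P (reduction (poly p) (\<lambda>n. poly q (2 * n + 1 + poly p n)))"
  unfolding reduction_def[abs_def] row_length_def
  by (intro feasible_sum_instance feasible_item_list feasible_target_bits feasible_tableau feasible_intros)

end

lemma run_halted:
  assumes "fst (run M u t) = accept_state M \<or> fst (run M u t) = reject_state M" "t \<le> t'"
  shows "fst (run M u t') = fst (run M u t)"
proof -
  have "run M u t' = (step M ^^ (t' - t)) (run M u t)"
    unfolding run_def using assms(2) by (metis comp_apply funpow_add le_add_diff_inverse2)
  then show ?thesis
    using step_accept_reject[of "fst (run M u t)" M "t' - t" "snd (run M u t)"] assms(1) by simp
qed

text \<open>The height of the tableau must be computed from the length of the input alone, while the
  verifier may stop at a different time for each certificate. As halted runs persist, all of them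
  can be inspected at one common time.\<close>

lemma NP_hard_infinite_factorization_problem: "NP_hard infinite_factorization_problem"
  unfolding NP_hard_def
proof (intro allI impI)
  fix L assume "in_NP L"
  then obtain V p where V: "polytime_decidable V"
    and L: "L = {x. \<exists>y. length y \<le> poly p (length x) \<and> pair_code x y \<in> V}"
    unfolding in_NP_def by blast
  obtain M q where M: "turing_machine M" and q: "\<And>u. \<exists>t\<le>poly q (length u). decided_at M V u t"
    using V unfolding polytime_decidable_def by blast
  interpret machine_tiling M by unfold_locales (rule M)
  \<comment> \<open>The argument of \<open>q\<close> bounds the length of
    \<open>pair_code x y\<close> for every admissible certificate \<open>y\<close>.\<close>
  let ?t = "\<lambda>n. poly q (2 * n + 1 + poly p n)"
  have dec: "pair_code x y \<in> V \<longleftrightarrow> fst (run M (pair_code x y) (?t (length x))) = accept_state M"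
    if "length y \<le> poly p (length x)" for x y
  proof -
    obtain t where t: "t \<le> poly q (length (pair_code x y))" "decided_at M V (pair_code x y) t" using q by blast
    have "poly q (length (pair_code x y)) \<le> ?t (length x)"
      using that by (intro poly_nat_mono) (simp add: length_pair_code)
    then have "fst (run M (pair_code x y) (?t (length x))) = fst (run M (pair_code x y) t)"
      using t by (intro run_halted) (auto simp: decided_at_def)
    then show ?thesis
      using t(2) M by (auto simp: decided_at_def turing_machine_def)
  qed
  have "x \<in> L \<longleftrightarrow> reduction (poly p) ?t x \<in> infinite_factorization_problem" for x
    unfolding reduction_iff L using dec by auto
  then show "polytime_reducible L infinite_factorization_problem"
    unfolding polytime_reducible_def
    using polytime_computable_if_feasible[OF feasible_reduction] by blast
qed

theorem theorem3:
  shows "decidable infinite_factorization_problem \<and> NP_hard infinite_factorization_problem"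
  using decidable_infinite_factorization_problem NP_hard_infinite_factorization_problem by blast

end
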